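(* Let $d\in\mathbb{N}$, fix an integer $0\le q<d$ and $t\in[0,1]$, and let $P$ be a stationary and ergodic probability measure on $\Omega=[0,1]^{\mathcal{K}^d}$ which is a product measure. Then there exists a constant $\sigma^2\ge0$ (depending on $d,q,t$) such that, as $n\to\infty$, $$\frac{1}{|\Lambda_n|}E\Big[\big(\beta_q^n(t)-E[\beta_q^n(t)]\big)^2\Big]\to\sigma^2$$ and $$\frac{1}{|\Lambda_n|^{1/2}}\big(\beta_q^n(t)-E[\beta_q^n(t)]\big)\Rightarrow\mathcal{N}(0,\sigma^2),$$ where $\Rightarrow$ denotes convergence in law and $\mathcal{N}(0,\sigma^2)$ is the centered Gaussian law with variance $\sigma^2$.
   Context: An elementary interval is $[l,l+1]$ or $[l]=[l,l]$ with $l\in\mathbb{Z}$; an elementary cube in $\mathbb{R}^d$ is a product of $d$ elementary intervals, of dimension equal to the number of nondegenerate factors; $\mathcal{K}^d$ is the set of all elementary cubes. A cubical set is a union of elementary cubes. For a cubical set $X$, $C_k(X)$ is the free $\mathbb{Z}$-module on the $k$-dimensional elementary cubes contained in $X$ with the standard cubical boundary operator; $H_k(X)$ is the resulting homology and, for bounded $X$, $\beta_k(X)$ is the rank of the free part of $H_k(X)$. $\Omega=[0,1]^{\mathcal{K}^d}$ with product topology and Borel $\sigma$-field, $\omega=(\omega_Q)_{Q\in\mathcal{K}^d}$; $\tau_x\omega=(\omega_{-x+Q})_Q$ for $x\in\mathbb{Z}^d$; stationarity: $P\circ\tau_x^{-1}=P$ for all $x$; ergodicity: translation-invariant events have probability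 $0$ or $1$; $E$ is expectation under $P$. $X(t)=\bigcup\{Q:\omega_Q\le t\}$, $\Lambda_n=[-n,n]^d$, $X^n(t)=X(t)\cap\Lambda_n$, $\beta_q^n(t)=\beta_q(X^n(t))$, $|\Lambda_n|=(2n)^d$. *)

theory Defs
  imports "HOL-Probability.Probability"
begin

text \<open>Elementary cubes in R^d, with d = CARD('n). A cube is given coordinatewise by
  (l_i, b_i): the factor is [l_i, l_i+1] if b_i, and the degenerate interval [l_i] otherwise.
  The linear order on 'n fixes the coordinate order used in the boundary signs.\<close>

type_synonym 'n cube = "'n \<Rightarrow> int \<times> bool"

definition cube_dim :: "('n::finite) cube \<Rightarrow> nat" where
  "cube_dim Q = card {i. snd (Q i)}"

definition cube_set :: "('n::finite) cube \<Rightarrow> (real^'n) set" where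
  "cube_set Q = {p. \<forall>i. real_of_int (fst (Q i)) \<le> p $ i \<and>
                          p $ i \<le> real_of_int (fst (Q i)) + (if snd (Q i) then 1 else 0)}"

definition cubes_in :: "nat \<Rightarrow> (real^'n) set \<Rightarrow> ('n::finite) cube set" where
  "cubes_in k S = {Q. cube_dim Q = k \<and> cube_set Q \<subseteq> S}"

definition chains :: "nat \<Rightarrow> (real^('n::finite)) set \<Rightarrow> (('n) cube \<Rightarrow> int) set" where
  "chains k S = {c. finite {Q. c Q \<noteq> 0} \<and> {Q. c Q \<noteq> 0} \<subseteq> cubes_in k S}"

definition incidence :: "('n::{finite,linorder}) cube \<Rightarrow> 'n cube \<Rightarrow> int" where
  "incidence Q P = (\<Sum>j\<in>{j. snd (Q j)}.
       (-1) ^ card {i. i < j \<and> snd (Q i)} *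
       ((if P = Q(j := (fst (Q j) + 1, False)) then 1 else 0)
        - (if P = Q(j := (fst (Q j), False)) then 1 else 0)))"

definition bdry :: "(('n::{finite,linorder}) cube \<Rightarrow> int) \<Rightarrow> ('n cube \<Rightarrow> int)" where
  "bdry c = (\<lambda>P. \<Sum>Q\<in>{Q. c Q \<noteq> 0}. c Q * incidence Q P)"

definition cycles :: "nat \<Rightarrow> (real^('n::{finite,linorder})) set \<Rightarrow> (('n) cube \<Rightarrow> int) set" where
  "cycles k S = {c \<in> chains k S. bdry c = (\<lambda>_. 0)}"

definition boundaries :: "nat \<Rightarrow> (real^('n::{finite,linorder})) set \<Rightarrow> (('n) cube \<Rightarrow> int) set" where
  "boundaries k S = bdry ` chains (Suc k) S"

text \<open>Rank of the free part of H_k(S) = Z_k/B_k: the maximal size of a family of cycles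
  that is Z-linearly independent modulo boundaries.\<close>
definition betti :: "nat \<Rightarrow> (real^('n::{finite,linorder})) set \<Rightarrow> nat" where
  "betti k S = Sup {card A | A :: (('n) cube \<Rightarrow> int) set.
      finite A \<and> A \<subseteq> cycles k S \<and>
      (\<forall>a :: ('n cube \<Rightarrow> int) \<Rightarrow> int.
          (\<lambda>P. \<Sum>z\<in>A. a z * z P) \<in> boundaries k S \<longrightarrow> (\<forall>z\<in>A. a z = 0))}"

definition Xt :: "real \<Rightarrow> (('n::finite) cube \<Rightarrow> real) \<Rightarrow> (real^'n) set" where
  "Xt t \<omega> = \<Union>{cube_set Q | Q. \<omega> Q \<le> t}"

definition Lambda :: "nat \<Rightarrow> (real^'n::finite) set" where
  "Lambda n = {p. \<forall>i. - real n \<le> p $ i \<and> p $ i \<le> real n}"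

definition Xn :: "nat \<Rightarrow> real \<Rightarrow> (('n::finite) cube \<Rightarrow> real) \<Rightarrow> (real^'n) set" where
  "Xn n t \<omega> = Xt t \<omega> \<inter> Lambda n"

definition cshift :: "int^'n \<Rightarrow> ('n::finite) cube \<Rightarrow> 'n cube" where
  "cshift x Q = (\<lambda>i. (fst (Q i) + x $ i, snd (Q i)))"

definition tau :: "int^'n \<Rightarrow> (('n::finite) cube \<Rightarrow> real) \<Rightarrow> ('n cube \<Rightarrow> real)" where
  "tau x \<omega> = (\<lambda>Q. \<omega> (cshift (- x) Q))"

definition gaussian_law :: "real \<Rightarrow> real measure" where
  "gaussian_law v = (if v = 0 then return borel 0
                     else density lborel (normal_density 0 (sqrt v)))"

end

theory Submission
  imports Defs "HOL-Library.Function_Algebras"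
begin

text \<open>
  The Betti number of a finite cubical complex is a modular function of its set of cubes minus the
  ranks of two boundary maps. Ranks are submodular, so the cost of opening a cube is monotone in
  the observation window; being bounded, its mean stabilises as the window grows. By the
  Efron--Stein inequality this makes the Betti number of a large box, after removal of the sum of
  the Betti numbers of well-separated smaller boxes, have variance of small order compared to
  the volume. The smaller boxes contribute independent and identically distributed summands, for
  which the characteristic function is explicit, and Levy's continuity theorem concludes.
\<close>

section \<open>Linear algebra over function spaces\<close>

text \<open>Monotonicity of the opening cost yields more than convergence of its mean. Let
  \<open>D\<close> be the cost of opening a cube in the large box minus its cost in a block. Then
  \<open>D\<close> is nonnegative and bounded, so its second moment is at most a constant times its
  mean, and that mean is at most the difference of two expected costs in windows centred at the cube
  itself. Up to translation there are finitely many cubes, so one radius \<open>k\<close> serves all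
  of them. The comparison needs the cube to lie at depth \<open>k\<close> inside its block; all
  other cubes are merely counted, and their share vanishes as the blocks grow. No candidate for the
  variance is known beforehand: it is the limit of a sequence shown to be Cauchy by comparison with
  block variances. Two discrepancies shape the algebra. The rank is defined over the integers, so
  denominators are cleared to reach rational linear algebra. Opening a cube also adds its faces, so
  the rank formula is extended to sets of cubes not closed under faces and cells are inserted one at
  a time.\<close>

lemma (in vector_space) dim_insert_finite:
  assumes "finite S"
  shows "dim (insert x S) = (if x \<in> span S then dim S else Suc (dim S))"
proof (cases "x \<in> span S")
  case True
  then show ?thesis by (metis dim_span span_redundant)
next
  case False
  obtain B where B: "B \<subseteq> S" "independent B" "S \<subseteq> span B" "card B = dim S"
    using basis_exists .
  have sp: "span B = span S"
    using B span_mono[of B S] span_minimal[OF B(3)] by auto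
  have "finite B" using B(1) assms finite_subset by blast
  have "independent (insert x B)"
    using B(2) False sp by (simp add: independent_insertI)
  moreover have "x \<notin> B" using False B(1) span_base[of x S] by blast
  moreover have "insert x S \<subseteq> span (insert x B)"
    using B(3) span_mono[of B "insert x B"] span_base[of x "insert x B"] by auto
  ultimately have "dim (insert x S) = card (insert x B)"
    using B(1) by (intro dim_unique[of "insert x B"]) auto
  then show ?thesis using False \<open>finite B\<close> \<open>x \<notin> B\<close> B(4) by simp
qed

text \<open>The coefficients are indexed by \<open>A\<close> and not by the image, so
  \<open>f\<close> need not be injective.\<close>

lemma (in vector_space) span_image_coeffs:
  assumes "finite A" "x \<in> span (f ` A)"
  shows "\<exists>u. x = (\<Sum>a\<in>A. scale (u a) (f a))"
  using assms
proof (induction A arbitrary: x rule: finite_induct)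
  case empty
  then show ?case by simp
next
  case (insert a A)
  then obtain k where "x - scale k (f a) \<in> span (f ` A)"
    by (auto simp: span_breakdown_eq)
  then obtain u where u: "x - scale k (f a) = (\<Sum>b\<in>A. scale (u b) (f b))"
    using insert.IH by blast
  have "x = (\<Sum>b\<in>insert a A. scale ((u(a := k)) b) (f b))"
  proof -
    have "(\<Sum>b\<in>A. scale ((u(a := k)) b) (f b)) = (\<Sum>b\<in>A. scale (u b) (f b))"
      using insert.hyps by (intro sum.cong) auto
    then show ?thesis using insert.hyps u by (simp add: algebra_simps)
  qed
  then show ?case by blast
qed

text \<open>Turns independence modulo a subspace, the form used in \<open>betti\<close>, into
  ordinary independence. The cardinality claim also records that \<open>f\<close> is injective on
  \<open>A\<close> with image disjoint from \<open>T\<close>.\<close>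

lemma (in vector_space) independent_image_Un:
  assumes "finite A" "independent T" "finite T"
    and "\<And>a. (\<Sum>z\<in>A. scale (a z) (f z)) \<in> span T \<Longrightarrow> \<forall>z\<in>A. a z = 0"
  shows "independent (f ` A \<union> T) \<and> card (f ` A \<union> T) = card A + card T"
  using assms(1,4)
proof (induction A rule: finite_induct)
  case empty
  then show ?case using assms by simp
next
  case (insert z A)
  have IH: "independent (f ` A \<union> T) \<and> card (f ` A \<union> T) = card A + card T"
  proof (rule insert.IH)
    fix a assume a: "(\<Sum>z\<in>A. scale (a z) (f z)) \<in> span T"
    have "(\<Sum>y\<in>insert z A. scale ((a(z := 0)) y) (f y)) = (\<Sum>y\<in>A. scale (a y) (f y))"
      using insert.hyps by (simp add: sum.If_cases) (intro sum.cong, auto)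
    with a have "\<forall>y\<in>insert z A. (a(z := 0)) y = 0"
      by (intro insert.prems) simp
    then show "\<forall>z\<in>A. a z = 0" using insert.hyps by (metis fun_upd_apply insertCI)
  qed
  have notin: "f z \<notin> span (f ` A \<union> T)"
  proof
    assume "f z \<in> span (f ` A \<union> T)"
    then obtain x t where xt: "f z = x + t" "x \<in> span (f ` A)" "t \<in> span T"
      by (auto simp: span_Un)
    obtain u where u: "x = (\<Sum>a\<in>A. scale (u a) (f a))"
      using span_image_coeffs[OF insert.hyps(1) xt(2)] by blast
    \<comment> \<open>Moving \<open>x\<close> to the left of \<open>f z = x + t\<close> leaves a
      combination in \<open>span T\<close> with coefficient 1 at \<open>z\<close>, which the
      hypothesis forbids.\<close>
    let ?a = "(\<lambda>y. - u y)(z := 1)"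
    have "(\<Sum>y\<in>A. scale (?a y) (f y)) = - x"
      unfolding u sum_negf[symmetric] using insert.hyps by (intro sum.cong) auto
    then have "(\<Sum>y\<in>insert z A. scale (?a y) (f y)) = t"
      using insert.hyps xt by simp
    with xt(3) have "\<forall>y\<in>insert z A. ?a y = 0" by (intro insert.prems) simp
    then show False by auto
  qed
  then have "f z \<notin> f ` A \<union> T" using span_base[of "f z" "f ` A \<union> T"] by blast
  then show ?case using IH notin insert.hyps assms(3)
    by (simp add: independent_insert)
qed

lemma (in vector_space) independent_Un_coeffs_zero:
  assumes "finite C" "independent (C \<union> T)" "C \<inter> T = {}"
    and "(\<Sum>c\<in>C. scale (a c) c) \<in> span T" "c \<in> C"
  shows "a c = 0"
proof (rule ccontr)
  assume nz: "a c \<noteq> 0"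
  let ?S = "span (C \<union> T - {c})"
  have "(\<Sum>y\<in>C - {c}. scale (a y) y) \<in> ?S"
    by (intro span_sum span_scale span_base) auto
  moreover have "(\<Sum>c\<in>C. scale (a c) c) \<in> ?S"
    using assms(3,4,5) span_mono[of T "C \<union> T - {c}"] by blast
  ultimately have "(\<Sum>c\<in>C. scale (a c) c) - (\<Sum>y\<in>C - {c}. scale (a y) y) \<in> ?S"
    by (rule span_diff[rotated])
  then have "scale (a c) c \<in> ?S"
    using assms(1,5) by (simp add: sum.remove)
  then have "scale (inverse (a c)) (scale (a c) c) \<in> ?S" by (rule span_scale)
  then have "c \<in> ?S" using nz by simp
  then show False using assms(2,5) unfolding dependent_def by blast
qed

interpretation fun_vs: vector_space "\<lambda>(r::'b::field) (f::'a \<Rightarrow> 'b) x. r * f x"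
  by standard (auto simp: fun_eq_iff algebra_simps)

text \<open>With \<open>\<phi> Q\<close> read as column \<open>Q\<close> of a matrix, this is the
  kernel of the columns in \<open>A\<close>. Extension by zero puts the kernels for different
  \<open>A\<close> into one space, where they can be compared by inclusion.\<close>

definition ker_on :: "('a \<Rightarrow> 'b \<Rightarrow> rat) \<Rightarrow> 'a set \<Rightarrow> ('a \<Rightarrow> rat) set" where
  "ker_on \<phi> A = {c. (\<forall>Q. Q \<notin> A \<longrightarrow> c Q = 0) \<and> (\<forall>P. (\<Sum>Q\<in>A. c Q * \<phi> Q P) = 0)}"

lemma subspace_ker_on: "fun_vs.subspace (ker_on \<phi> A)"
proof -
  have "(\<Sum>Q\<in>A. c Q * \<phi> Q P + d Q * \<phi> Q P) = 0"
    if "(\<Sum>Q\<in>A. c Q * \<phi> Q P) = 0" "(\<Sum>Q\<in>A. d Q * \<phi> Q P) = 0" for c d P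
    using that by (simp add: sum.distrib)
  moreover have "(\<Sum>Q\<in>A. k * c Q * \<phi> Q P) = 0" if "(\<Sum>Q\<in>A. c Q * \<phi> Q P) = 0" for c k P
    using that by (simp add: mult.assoc flip: sum_distrib_left)
  ultimately show ?thesis
    by (auto simp: fun_vs.subspace_def ker_on_def distrib_right)
qed

lemma sum_fun_apply: "(\<Sum>a\<in>A. f a) x = (\<Sum>a\<in>A. f a x)"
  for f :: "'a \<Rightarrow> 'b \<Rightarrow> 'c::comm_monoid_add"
  by (induction A rule: infinite_finite_induct) auto

text \<open>Rank-nullity, one column at a time: a column in the span of the earlier ones adds one
  vector to the kernel, any other column raises the rank and leaves the kernel unchanged.\<close>

lemma ker_on_basis:
  fixes \<phi> :: "'a \<Rightarrow> 'b \<Rightarrow> rat"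
  assumes "finite A"
  shows "\<exists>B. finite B \<and> fun_vs.independent B \<and> B \<subseteq> ker_on \<phi> A \<and> ker_on \<phi> A \<subseteq> fun_vs.span B
      \<and> card B + fun_vs.dim (\<phi> ` A) = card A"
  using assms
proof (induction A rule: finite_induct)
  case empty
  have "ker_on \<phi> {} \<subseteq> {0}" by (auto simp: ker_on_def fun_eq_iff)
  moreover have "fun_vs.dim ({} :: ('b \<Rightarrow> rat) set) = 0"
    using fun_vs.dim_le_card'[of "{}"] by simp
  ultimately show ?case
    by (intro exI[of _ "{}"]) (auto simp: fun_vs.independent_empty)
next
  case (insert \<sigma> A)
  then obtain B where B: "finite B" "fun_vs.independent B" "B \<subseteq> ker_on \<phi> A"
    "ker_on \<phi> A \<subseteq> fun_vs.span B" "card B + fun_vs.dim (\<phi> ` A) = card A" by blast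
  have mono: "ker_on \<phi> A \<subseteq> ker_on \<phi> (insert \<sigma> A)"
    using insert.hyps by (auto simp: ker_on_def)
  show ?case
  proof (cases "\<phi> \<sigma> \<in> fun_vs.span (\<phi> ` A)")
    case True
    then obtain u where u: "\<phi> \<sigma> = (\<Sum>a\<in>A. (\<lambda>x. u a * \<phi> a x))"
      using fun_vs.span_image_coeffs[OF insert.hyps(1)] by blast
    have u': "\<phi> \<sigma> P = (\<Sum>a\<in>A. u a * \<phi> a P)" for P
      by (subst u) (simp add: sum_fun_apply)
    \<comment> \<open>The new kernel vector is the dependence relation of the column
      \<open>\<phi> \<sigma>\<close>.\<close>
    define z where "z = (\<lambda>Q. if Q = \<sigma> then -1 else if Q \<in> A then u Q else 0)"
    have zA: "(\<Sum>Q\<in>A. z Q * \<phi> Q P) = \<phi> \<sigma> P" for P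
      unfolding u' using insert.hyps by (intro sum.cong) (auto simp: z_def)
    have zk: "z \<in> ker_on \<phi> (insert \<sigma> A)"
      using insert.hyps zA by (auto simp: ker_on_def) (auto simp: z_def)
    have "fun_vs.span B \<subseteq> ker_on \<phi> A"
      using B(3) subspace_ker_on by (rule fun_vs.span_minimal)
    moreover have "z \<notin> ker_on \<phi> A"
    proof
      assume "z \<in> ker_on \<phi> A"
      then have "z \<sigma> = 0" using insert.hyps(2) unfolding ker_on_def by blast
      then show False by (simp add: z_def)
    qed
    ultimately have zn: "z \<notin> fun_vs.span B" by blast
    have "c \<in> fun_vs.span (insert z B)" if c: "c \<in> ker_on \<phi> (insert \<sigma> A)" for c
    proof -
      have eq: "c \<sigma> * \<phi> \<sigma> P + (\<Sum>Q\<in>A. c Q * \<phi> Q P) = 0" for P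
        using c insert.hyps by (auto simp: ker_on_def)
      \<comment> \<open>Since \<open>z \<sigma> = -1\<close>, adding \<open>c \<sigma>\<close> times
        \<open>z\<close> cancels the entry at \<open>\<sigma>\<close> and brings \<open>c\<close>
        back into the old kernel.\<close>
      have "c Q + c \<sigma> * z Q = 0" if "Q \<notin> A" for Q
        using c that by (auto simp: ker_on_def z_def)
      moreover have "(\<Sum>Q\<in>A. (c Q + c \<sigma> * z Q) * \<phi> Q P) = 0" for P
      proof -
        have "(\<Sum>Q\<in>A. (c Q + c \<sigma> * z Q) * \<phi> Q P)
            = (\<Sum>Q\<in>A. c Q * \<phi> Q P) + c \<sigma> * (\<Sum>Q\<in>A. z Q * \<phi> Q P)"
          by (simp add: distrib_right sum.distrib sum_distrib_left mult.assoc)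
        then show ?thesis using eq[of P] by (simp add: zA)
      qed
      ultimately have "c - (\<lambda>x. (- c \<sigma>) * z x) \<in> ker_on \<phi> A"
        unfolding ker_on_def by simp
      then have "c - (\<lambda>x. (- c \<sigma>) * z x) \<in> fun_vs.span B" using B(4) by (rule set_mp[rotated])
      then show ?thesis unfolding fun_vs.span_breakdown_eq by (rule exI)
    qed
    moreover have "fun_vs.dim (\<phi> ` insert \<sigma> A) = fun_vs.dim (\<phi> ` A)"
      using True insert.hyps by (simp add: fun_vs.dim_insert_finite)
    moreover have "z \<notin> B" using zn fun_vs.span_base[of z B] by blast
    ultimately show ?thesis
      using B zk zn mono insert.hyps
      by (intro exI[of _ "insert z B"]) (auto simp: fun_vs.independent_insert)
  next
    case False
    have "ker_on \<phi> (insert \<sigma> A) \<subseteq> ker_on \<phi> A"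
    proof
      fix c assume c: "c \<in> ker_on \<phi> (insert \<sigma> A)"
      have eq: "c \<sigma> * \<phi> \<sigma> P + (\<Sum>Q\<in>A. c Q * \<phi> Q P) = 0" for P
        using c insert.hyps by (auto simp: ker_on_def)
      have "c \<sigma> = 0"
      proof (rule ccontr)
        assume nz: "c \<sigma> \<noteq> 0"
        have "\<phi> \<sigma> = (\<lambda>P. (- 1 / c \<sigma>) * (\<Sum>Q\<in>A. (\<lambda>P. c Q * \<phi> Q P)) P)"
        proof
          fix P
          have "(\<Sum>Q\<in>A. c Q * \<phi> Q P) = - c \<sigma> * \<phi> \<sigma> P"
            using eq[of P] by linarith
          then show "\<phi> \<sigma> P = (- 1 / c \<sigma>) * (\<Sum>Q\<in>A. (\<lambda>P. c Q * \<phi> Q P)) P"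
            using nz by (simp add: sum_fun_apply)
        qed
        moreover have "(\<Sum>Q\<in>A. (\<lambda>P. c Q * \<phi> Q P)) \<in> fun_vs.span (\<phi> ` A)"
          by (intro fun_vs.span_sum fun_vs.span_scale fun_vs.span_base) auto
        then have "(\<lambda>P. (- 1 / c \<sigma>) * (\<Sum>Q\<in>A. (\<lambda>P. c Q * \<phi> Q P)) P) \<in> fun_vs.span (\<phi> ` A)"
          by (rule fun_vs.span_scale)
        ultimately show False using False by simp
      qed
      moreover have "c Q = 0" if "Q \<notin> insert \<sigma> A" for Q
        using c that unfolding ker_on_def by blast
      ultimately have "\<forall>Q. Q \<notin> A \<longrightarrow> c Q = 0" by (metis insertE)
      then show "c \<in> ker_on \<phi> A"
        using eq insert.hyps unfolding ker_on_def by auto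
    qed
    then have "ker_on \<phi> (insert \<sigma> A) = ker_on \<phi> A" using mono by blast
    moreover have "fun_vs.dim (\<phi> ` insert \<sigma> A) = Suc (fun_vs.dim (\<phi> ` A))"
      using False insert.hyps by (simp add: fun_vs.dim_insert_finite)
    ultimately show ?thesis
      using B insert.hyps by (intro exI[of _ B]) simp
  qed
qed

section \<open>The cubical boundary operator\<close>

lemma incidence_nonzeroE:
  assumes "incidence Q P \<noteq> 0"
  obtains j where "snd (Q j)"
    "P = Q(j := (fst (Q j) + 1, False)) \<or> P = Q(j := (fst (Q j), False))"
proof -
  have "\<exists>j\<in>{j. snd (Q j)}. (-1) ^ card {i. i < j \<and> snd (Q i)} *
       ((if P = Q(j := (fst (Q j) + 1, False)) then 1 else 0)
        - (if P = Q(j := (fst (Q j), False)) then 1 else (0::int))) \<noteq> 0"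
    using assms unfolding incidence_def by (rule contrapos_np) (intro sum.neutral, blast)
  then show ?thesis using that by (auto split: if_splits)
qed

lemma cube_dim_face:
  assumes "snd (Q j)" "cube_dim Q = Suc k"
  shows "cube_dim (Q(j := (l, False))) = k"
proof -
  have "{i. snd ((Q(j := (l, False))) i)} = {i. snd (Q i)} - {j}" by auto
  then show ?thesis using assms by (simp add: cube_dim_def)
qed

lemma cube_set_face:
  assumes "snd (Q j)" "P = Q(j := (fst (Q j) + 1, False)) \<or> P = Q(j := (fst (Q j), False))"
  shows "cube_set P \<subseteq> cube_set Q"
proof
  fix p assume p: "p \<in> cube_set P"
  show "p \<in> cube_set Q" unfolding cube_set_def
  proof (intro CollectI allI)
    fix i
    show "real_of_int (fst (Q i)) \<le> p $ i \<and> p $ i \<le> real_of_int (fst (Q i)) + (if snd (Q i) then 1 else 0)"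
      using p assms unfolding cube_set_def by (cases "i = j") (auto dest!: spec[of _ i])
  qed
qed

lemma faces_in_cubes_in:
  assumes "Q \<in> cubes_in (Suc k) S" "snd (Q j)"
  shows "Q(j := (fst (Q j) + 1, False)) \<in> cubes_in k S" "Q(j := (fst (Q j), False)) \<in> cubes_in k S"
  using assms cube_set_face[of Q j] by (auto simp: cubes_in_def cube_dim_face)

lemma sum_incidence:
  fixes g :: "('n::{finite,linorder}) cube \<Rightarrow> int"
  assumes "finite A"
    and "\<And>j. snd (Q j) \<Longrightarrow> Q(j := (fst (Q j) + 1, False)) \<in> A \<and> Q(j := (fst (Q j), False)) \<in> A"
  shows "(\<Sum>P\<in>A. incidence Q P * g P) = (\<Sum>j\<in>{j. snd (Q j)}. (-1) ^ card {i. i < j \<and> snd (Q i)} *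
       (g (Q(j := (fst (Q j) + 1, False))) - g (Q(j := (fst (Q j), False)))))"
proof -
  let ?s = "\<lambda>j. (-1::int) ^ card {i. i < j \<and> snd (Q i)}"
  let ?a = "\<lambda>j. Q(j := (fst (Q j) + 1, False))" and ?b = "\<lambda>j. Q(j := (fst (Q j), False))"
  have "(\<Sum>P\<in>A. incidence Q P * g P)
      = (\<Sum>P\<in>A. \<Sum>j\<in>{j. snd (Q j)}. ?s j * ((if P = ?a j then g P else 0) - (if P = ?b j then g P else 0)))"
    unfolding incidence_def sum_distrib_right by (intro sum.cong) auto
  also have "\<dots> = (\<Sum>j\<in>{j. snd (Q j)}. \<Sum>P\<in>A. ?s j * ((if P = ?a j then g P else 0) - (if P = ?b j then g P else 0)))"
    by (rule sum.swap)
  also have "\<dots> = (\<Sum>j\<in>{j. snd (Q j)}. ?s j * (g (?a j) - g (?b j)))"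
    using assms by (intro sum.cong) (auto simp: sum_subtractf simp flip: sum_distrib_left)
  finally show ?thesis .
qed

text \<open>The boundary of a boundary vanishes: collapsing two directions \<open>j\<close> and
  \<open>k\<close> in either order reaches the same face, with opposite signs.\<close>

lemma incidence_incidence:
  fixes Q R :: "('n::{finite,linorder}) cube"
  assumes "finite A"
    and "\<And>j. snd (Q j) \<Longrightarrow> Q(j := (fst (Q j) + 1, False)) \<in> A \<and> Q(j := (fst (Q j), False)) \<in> A"
  shows "(\<Sum>P\<in>A. incidence Q P * incidence P R) = 0"
proof -
  let ?J = "{j. snd (Q j)}"
  let ?s = "\<lambda>j. (-1::int) ^ card {i. i < j \<and> snd (Q i)}"
  \<comment> \<open>The sign of direction \<open>k\<close> once direction \<open>j\<close> has been
    collapsed.\<close>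
  define s' where "s' j k = (-1::int) ^ card {i. i < k \<and> i \<noteq> j \<and> snd (Q i)}" for j k
  define e where "e j a k b = (if R = Q(j := (fst (Q j) + a, False), k := (fst (Q k) + b, False)) then 1 else (0::int))"
    for j a k b
  define T where "T j k = (if j = k then 0 else ?s j * s' j k *
     (e j 1 k 1 - e j 1 k 0 - e j 0 k 1 + e j 0 k 0))" for j k
  have inc: "incidence (Q(j := (fst (Q j) + a, False))) R
      = (\<Sum>k\<in>?J - {j}. s' j k * (e j a k 1 - e j a k 0))" if "j \<in> ?J" for j a
  proof -
    have "{k. snd ((Q(j := (fst (Q j) + a, False))) k)} = ?J - {j}" by auto
    moreover have "{i. i < k \<and> snd ((Q(j := (fst (Q j) + a, False))) i)} = {i. i < k \<and> i \<noteq> j \<and> snd (Q i)}" for k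
      by auto
    ultimately show ?thesis
      unfolding incidence_def s'_def e_def by (intro sum.cong) auto
  qed
  have anti: "T j k = - T k j" if "j \<in> ?J" "k \<in> ?J" for j k
  proof -
    \<comment> \<open>Collapsing the smaller direction lowers the count below the larger one by one;
      collapsing the larger does not affect the count below the smaller. So exactly one sign
      flips.\<close>
    have *: "?s j * s' j k = - (?s k * s' k j)" if "j < k" "j \<in> ?J" "k \<in> ?J" for j k
    proof -
      have "{i. i < k \<and> snd (Q i)} = insert j {i. i < k \<and> i \<noteq> j \<and> snd (Q i)}"
        using that by auto
      then have "?s k = - s' j k" unfolding s'_def by simp
      moreover have "{i. i < j \<and> i \<noteq> k \<and> snd (Q i)} = {i. i < j \<and> snd (Q i)}" using that by auto
      then have "s' k j = ?s j" unfolding s'_def by simp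
      ultimately show ?thesis by simp
    qed
    have e: "e j a k b = e k b j a" if "j \<noteq> k" for a b
      unfolding e_def using that by (simp add: fun_upd_twist)
    consider "j < k" | "k < j" | "j = k" by force
    then show ?thesis
    proof cases
      case 1
      then show ?thesis using *[of j k] that e by (simp add: T_def algebra_simps)
    next
      case 2
      then show ?thesis using *[of k j] that e by (simp add: T_def algebra_simps)
    qed (simp add: T_def)
  qed
  have "(\<Sum>P\<in>A. incidence Q P * incidence P R)
      = (\<Sum>j\<in>?J. ?s j * (incidence (Q(j := (fst (Q j) + 1, False))) R - incidence (Q(j := (fst (Q j), False))) R))"
    by (rule sum_incidence[OF assms])
  also have "\<dots> = (\<Sum>j\<in>?J. \<Sum>k\<in>?J. T j k)"
  proof (intro sum.cong refl)
    fix j assume j: "j \<in> ?J"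
    have "?s j * (incidence (Q(j := (fst (Q j) + 1, False))) R - incidence (Q(j := (fst (Q j), False))) R)
        = (\<Sum>k\<in>?J - {j}. T j k)"
      unfolding inc[OF j] inc[OF j, of 0, simplified] sum_subtractf[symmetric] sum_distrib_left
      by (intro sum.cong) (auto simp: T_def algebra_simps)
    also have "\<dots> = (\<Sum>k\<in>?J. T j k)"
      by (rule sum.mono_neutral_left) (auto simp: T_def)
    finally show "?s j * (incidence (Q(j := (fst (Q j) + 1, False))) R - incidence (Q(j := (fst (Q j), False))) R)
        = (\<Sum>k\<in>?J. T j k)" .
  qed
  also have "\<dots> = 0"
  proof -
    have "(\<Sum>j\<in>?J. \<Sum>k\<in>?J. T j k) = (\<Sum>j\<in>?J. \<Sum>k\<in>?J. - T k j)"
      by (intro sum.cong refl anti)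
    also have "\<dots> = - (\<Sum>j\<in>?J. \<Sum>k\<in>?J. T k j)" by (simp add: sum_negf)
    also have "(\<Sum>j\<in>?J. \<Sum>k\<in>?J. T k j) = (\<Sum>j\<in>?J. \<Sum>k\<in>?J. T j k)" by (rule sum.swap)
    finally show ?thesis by simp
  qed
  finally show ?thesis .
qed

text \<open>Column of the boundary matrix. Rational entries suffice because torsion does not affect
  the rank of the free part.\<close>

definition bcol :: "('n::{finite,linorder}) cube \<Rightarrow> 'n cube \<Rightarrow> rat" where
  "bcol Q = (\<lambda>P. of_int (incidence Q P))"

lemma bcol_in_ker_on:
  assumes "finite (cubes_in k S)" "Q \<in> cubes_in (Suc k) S"
  shows "bcol Q \<in> ker_on bcol (cubes_in k S)"
proof -
  have "bcol Q P = 0" if "P \<notin> cubes_in k S" for P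
    using that faces_in_cubes_in[OF assms(2)] incidence_nonzeroE[of Q P] unfolding bcol_def by (metis of_int_0)
  moreover have "(\<Sum>P\<in>cubes_in k S. bcol Q P * bcol P R) = 0" for R
  proof -
    have "(\<Sum>P\<in>cubes_in k S. bcol Q P * bcol P R)
        = of_int (\<Sum>P\<in>cubes_in k S. incidence Q P * incidence P R)"
      by (simp add: bcol_def)
    then show ?thesis
      using incidence_incidence[OF assms(1), of Q R] faces_in_cubes_in[OF assms(2)] by simp
  qed
  ultimately show ?thesis by (simp add: ker_on_def)
qed

lemma bdry_on_chains:
  assumes "finite (cubes_in k S)" "c \<in> chains k S"
  shows "of_int (bdry c P) = (\<Sum>Q\<in>cubes_in k S. of_int (c Q) * bcol Q P)"
proof -
  have "bdry c P = (\<Sum>Q\<in>cubes_in k S. c Q * incidence Q P)"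
    unfolding bdry_def using assms by (intro sum.mono_neutral_left) (auto simp: chains_def)
  then show ?thesis by (simp add: bcol_def)
qed

text \<open>Integral cycles are the integral points of a rational kernel.\<close>

lemma cycles_iff_ker_on:
  assumes "finite (cubes_in k S)"
  shows "z \<in> cycles k S \<longleftrightarrow> (\<lambda>P. of_int (z P)) \<in> ker_on bcol (cubes_in k S)"
proof -
  have ch: "z \<in> chains k S \<longleftrightarrow> (\<forall>Q. Q \<notin> cubes_in k S \<longrightarrow> z Q = 0)"
    using finite_subset[OF _ assms, of "{Q. z Q \<noteq> 0}"] by (auto simp: chains_def)
  show ?thesis
  proof (cases "z \<in> chains k S")
    case True
    then have "bdry z = (\<lambda>_. 0) \<longleftrightarrow> (\<forall>P. (\<Sum>Q\<in>cubes_in k S. of_int (z Q) * bcol Q P) = 0)"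
      unfolding bdry_on_chains[OF assms True, symmetric] fun_eq_iff by simp
    then show ?thesis using True ch by (simp add: cycles_def ker_on_def)
  qed (use ch in \<open>auto simp: cycles_def ker_on_def\<close>)
qed

text \<open>The bridge back from rational relations and kernel vectors to the integral chains in
  which \<open>betti\<close> is stated.\<close>

lemma common_denominator:
  fixes f :: "'a \<Rightarrow> rat"
  assumes "finite A"
  shows "\<exists>N::int. N > 0 \<and> (\<forall>x\<in>A. \<exists>m::int. of_int N * f x = of_int m)"
  using assms
proof (induction A rule: finite_induct)
  case empty
  then show ?case by (intro exI[of _ 1]) simp
next
  case (insert x A)
  then obtain N where N: "N > 0" "\<forall>x\<in>A. \<exists>m::int. of_int N * f x = of_int m" by blast
  obtain a b where ab: "f x = of_int a / of_int b" "b > 0"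
    by (metis quotient_of_denom_pos quotient_of_div surj_pair)
  show ?case
  proof (rule exI[of _ "N * b"], rule conjI, use N ab in simp, rule ballI)
    fix y assume "y \<in> insert x A"
    then consider "y = x" | "y \<in> A" by blast
    then show "\<exists>m::int. of_int (N * b) * f y = of_int m"
    proof cases
      case 1
      then show ?thesis using ab by (intro exI[of _ "N * a"]) simp
    next
      case 2
      then obtain m where "of_int N * f y = of_int m" using N by blast
      then show ?thesis by (intro exI[of _ "m * b"]) (simp add: mult.commute mult.left_commute)
    qed
  qed
qed

section \<open>Betti numbers as ranks\<close>

lemma independent_bases_card_eq:
  assumes "fun_vs.independent B" "fun_vs.independent C" "finite B"
    "B \<subseteq> V" "C \<subseteq> V" "V \<subseteq> fun_vs.span B" "V \<subseteq> fun_vs.span C"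
  shows "finite C \<and> card C = card B"
proof -
  have C: "finite C \<and> card C \<le> card B"
    using assms by (intro fun_vs.independent_span_bound) auto
  moreover have "finite B \<and> card B \<le> card C"
    using assms C by (intro fun_vs.independent_span_bound) auto
  ultimately show ?thesis by auto
qed

text \<open>Cycles independent modulo integral boundaries stay independent modulo the rational span
  of the boundary columns. Together with a basis \<open>E\<close> of that span they fit into the
  kernel, whose dimension is known from rank-nullity.\<close>

lemma betti_rank_upper:
  fixes S :: "(real^('n::{finite,linorder})) set"
  assumes fin: "finite (cubes_in k S)" "finite (cubes_in (Suc k) S)"
    and A: "finite A" "A \<subseteq> cycles k S"
    and indep: "\<forall>a. (\<lambda>P. \<Sum>z\<in>A. a z * z P) \<in> boundaries k S \<longrightarrow> (\<forall>z\<in>A. a z = 0)"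
  shows "card A + fun_vs.dim (bcol ` cubes_in k S) + fun_vs.dim (bcol ` cubes_in (Suc k) S)
       \<le> card (cubes_in k S)"
proof -
  let ?K = "cubes_in k S" and ?K1 = "cubes_in (Suc k) S"
  define f where "f = (\<lambda>(z::'n cube \<Rightarrow> int) P. rat_of_int (z P))"
  obtain B where B: "finite B" "fun_vs.independent B" "B \<subseteq> ker_on bcol ?K"
    "ker_on bcol ?K \<subseteq> fun_vs.span B" "card B + fun_vs.dim (bcol ` ?K) = card ?K"
    using ker_on_basis[OF fin(1), of bcol] by blast
  obtain E where E: "E \<subseteq> bcol ` ?K1" "fun_vs.independent E" "bcol ` ?K1 \<subseteq> fun_vs.span E"
    "card E = fun_vs.dim (bcol ` ?K1)" using fun_vs.basis_exists .
  have finE: "finite E" using E(1) fin(2) finite_subset by blast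
  have "fun_vs.independent (f ` A \<union> E) \<and> card (f ` A \<union> E) = card A + card E"
  proof (rule fun_vs.independent_image_Un[OF A(1) E(2) finE])
    fix a :: "('n cube \<Rightarrow> int) \<Rightarrow> rat"
    assume "(\<Sum>z\<in>A. (\<lambda>x. a z * f z x)) \<in> fun_vs.span E"
    then have "(\<Sum>z\<in>A. (\<lambda>x. a z * f z x)) \<in> fun_vs.span (bcol ` ?K1)"
      using fun_vs.span_mono[OF E(1)] by blast
    then obtain u where u: "(\<Sum>z\<in>A. (\<lambda>x. a z * f z x)) = (\<Sum>Q\<in>?K1. (\<lambda>x. u Q * bcol Q x))"
      using fun_vs.span_image_coeffs[OF fin(2)] by blast
    have u': "(\<Sum>z\<in>A. a z * f z P) = (\<Sum>Q\<in>?K1. u Q * bcol Q P)" for P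
      using fun_cong[OF u, of P] by (simp add: sum_fun_apply)
    obtain N1 where N1: "N1 > 0" "\<forall>x\<in>A. \<exists>m::int. of_int N1 * a x = of_int m"
      using common_denominator[OF A(1), of a] by blast
    obtain N2 where N2: "N2 > 0" "\<forall>x\<in>?K1. \<exists>m::int. of_int N2 * u x = of_int m"
      using common_denominator[OF fin(2), of u] by blast
    obtain a' where a': "\<forall>x\<in>A. of_int N1 * a x = of_int (a' x)" using bchoice[OF N1(2)] by blast
    obtain w where w: "\<forall>x\<in>?K1. of_int N2 * u x = of_int (w x)" using bchoice[OF N2(2)] by blast
    \<comment> \<open>Multiplying the relation by \<open>N1 * N2\<close> makes both sides integral:
      coefficients \<open>N2 * a'\<close> on the cycles and \<open>N1 * w\<close> on the bounding
      chain.\<close>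
    define c where "c = (\<lambda>Q. if Q \<in> ?K1 then N1 * w Q else 0)"
    have c: "c \<in> chains (Suc k) S"
      by (auto simp: chains_def c_def intro: finite_subset[OF _ fin(2)])
    have "(\<lambda>P. \<Sum>z\<in>A. (N2 * a' z) * z P) = bdry c"
    proof
      fix P
      have "rat_of_int (\<Sum>z\<in>A. (N2 * a' z) * z P) = (\<Sum>z\<in>A. (of_int N2 * (of_int N1 * a z)) * f z P)"
        using a' by (auto simp: f_def intro!: sum.cong)
      also have "\<dots> = of_int N1 * of_int N2 * (\<Sum>z\<in>A. a z * f z P)"
        by (simp add: sum_distrib_left mult_ac)
      also have "\<dots> = (\<Sum>Q\<in>?K1. of_int N1 * (of_int N2 * u Q) * bcol Q P)"
        unfolding u' by (simp add: sum_distrib_left mult_ac)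
      also have "\<dots> = (\<Sum>Q\<in>?K1. of_int (c Q) * bcol Q P)"
        using w by (auto simp: c_def intro!: sum.cong)
      also have "\<dots> = of_int (bdry c P)"
        by (rule bdry_on_chains[OF fin(2) c, symmetric])
      finally show "(\<Sum>z\<in>A. (N2 * a' z) * z P) = bdry c P" by (simp only: of_int_eq_iff)
    qed
    then have "(\<lambda>P. \<Sum>z\<in>A. (N2 * a' z) * z P) \<in> boundaries k S"
      using c unfolding boundaries_def by blast
    from indep[rule_format, OF this] have "\<forall>z\<in>A. N2 * a' z = 0" by blast
    then have "\<forall>z\<in>A. a' z = 0" using N2(1) by auto
    then show "\<forall>z\<in>A. a z = 0" using a' N1(1) by auto
  qed
  moreover have "f ` A \<union> E \<subseteq> fun_vs.span B"
  proof -
    have "f ` A \<subseteq> ker_on bcol ?K" using A(2) cycles_iff_ker_on[OF fin(1)] unfolding f_def by blast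
    moreover have "E \<subseteq> ker_on bcol ?K" using E(1) bcol_in_ker_on[OF fin(1)] by blast
    ultimately show ?thesis using B(4) by blast
  qed
  ultimately have "card A + card E \<le> card B"
    using fun_vs.independent_span_bound[OF B(1)] by metis
  then show ?thesis using B(5) E(4) by linarith
qed

text \<open>A basis \<open>E\<close> of the boundary space extends to a basis of the kernel; the
  added vectors, scaled to be integral, are cycles independent modulo boundaries.\<close>

lemma betti_rank_lower:
  fixes S :: "(real^('n::{finite,linorder})) set"
  assumes fin: "finite (cubes_in k S)" "finite (cubes_in (Suc k) S)"
  shows "\<exists>A. finite A \<and> A \<subseteq> cycles k S \<and>
     (\<forall>a. (\<lambda>P. \<Sum>z\<in>A. a z * z P) \<in> boundaries k S \<longrightarrow> (\<forall>z\<in>A. a z = 0)) \<and>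
     card A + fun_vs.dim (bcol ` cubes_in k S) + fun_vs.dim (bcol ` cubes_in (Suc k) S)
       = card (cubes_in k S)"
proof -
  let ?K = "cubes_in k S" and ?K1 = "cubes_in (Suc k) S"
  obtain B where B: "finite B" "fun_vs.independent B" "B \<subseteq> ker_on bcol ?K"
    "ker_on bcol ?K \<subseteq> fun_vs.span B" "card B + fun_vs.dim (bcol ` ?K) = card ?K"
    using ker_on_basis[OF fin(1), of bcol] by blast
  obtain E where E: "E \<subseteq> bcol ` ?K1" "fun_vs.independent E" "bcol ` ?K1 \<subseteq> fun_vs.span E"
    "card E = fun_vs.dim (bcol ` ?K1)" using fun_vs.basis_exists .
  have finE: "finite E" using E(1) fin(2) finite_subset by blast
  have Ek: "E \<subseteq> ker_on bcol ?K" using E(1) bcol_in_ker_on[OF fin(1)] by blast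
  obtain B' where B': "E \<subseteq> B'" "B' \<subseteq> ker_on bcol ?K" "fun_vs.independent B'" "ker_on bcol ?K \<subseteq> fun_vs.span B'"
    using fun_vs.maximal_independent_subset_extend[OF Ek E(2)] by blast
  have cB': "finite B'" "card B' = card B"
    using independent_bases_card_eq[OF B(2) B'(3) B(1) B(3) B'(2) B(4) B'(4)] by auto
  define C where "C = B' - E"
  have finC: "finite C" using cB' by (simp add: C_def)
  have cardC: "card C + card E = card B"
    using cB' B'(1) finE card_mono[OF cB'(1) B'(1)] by (simp add: C_def card_Diff_subset)
  have CE: "C \<union> E = B'" "C \<inter> E = {}" using B'(1) by (auto simp: C_def)
  have ex: "\<exists>N z. N > 0 \<and> z \<in> cycles k S \<and> (\<forall>P. of_int (z P) = of_int N * c P)" if "c \<in> C" for c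
  proof -
    have ck: "c \<in> ker_on bcol ?K" using that B'(2) by (auto simp: C_def)
    obtain N where N: "N > 0" "\<forall>x\<in>?K. \<exists>m::int. of_int N * c x = of_int m"
      using common_denominator[OF fin(1), of c] by blast
    obtain z where z: "\<forall>x\<in>?K. of_int N * c x = of_int (z x)" using bchoice[OF N(2)] by blast
    define z' where "z' = (\<lambda>x. if x \<in> ?K then z x else 0)"
    have z': "of_int (z' P) = of_int N * c P" for P
      using z ck by (auto simp: z'_def ker_on_def)
    have "(\<lambda>P. of_int (z' P)) = (\<lambda>P. of_int N * c P)" using z' by auto
    moreover have "(\<lambda>P. of_int N * c P) \<in> ker_on bcol ?K"
      using fun_vs.subspace_scale[OF subspace_ker_on ck] by blast
    ultimately have "z' \<in> cycles k S" using cycles_iff_ker_on[OF fin(1)] by metis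
    then show ?thesis using z' N(1) by blast
  qed
  then obtain N z where Nz: "\<And>c. c \<in> C \<Longrightarrow> N c > 0" "\<And>c. c \<in> C \<Longrightarrow> z c \<in> cycles k S"
    "\<And>c P. c \<in> C \<Longrightarrow> of_int (z c P) = of_int (N c) * c P" by metis
  have key: "\<forall>c\<in>C. a c = 0"
    if a: "(\<Sum>c\<in>C. (\<lambda>P. of_int (a c * N c) * c P)) \<in> fun_vs.span E" for a :: "('n cube \<Rightarrow> rat) \<Rightarrow> int"
  proof
    fix c assume c: "c \<in> C"
    have "rat_of_int (a c * N c) = 0"
      using fun_vs.independent_Un_coeffs_zero[OF finC _ CE(2) a c] B'(3) CE(1) by simp
    then show "a c = 0" using Nz(1)[OF c] by simp
  qed
  have expand: "(\<Sum>c\<in>C. (\<lambda>P. rat_of_int (a c * N c) * c P)) = (\<lambda>P. of_int (\<Sum>c\<in>C. a c * z c P))"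
    for a :: "('n cube \<Rightarrow> rat) \<Rightarrow> int"
    by (rule ext, simp add: sum_fun_apply, intro sum.cong refl, simp add: Nz(3))
  \<comment> \<open>\<open>betti\<close> counts a set of cycles, so distinct basis vectors must have
    distinct integral multiples. A coincidence would give a relation with coefficients 1 and
    -1.\<close>
  have inj: "inj_on z C"
  proof (rule inj_onI, rule ccontr)
    fix c c' assume c: "c \<in> C" "c' \<in> C" "z c = z c'" "c \<noteq> c'"
    define a where "a = (\<lambda>x. if x = c then 1 else if x = c' then -1 else (0::int))"
    have "(\<Sum>x\<in>C. a x * z x P) = 0" for P
    proof -
      have "(\<Sum>x\<in>C. a x * z x P) = (\<Sum>x\<in>{c,c'}. a x * z x P)"
        using finC c by (intro sum.mono_neutral_right) (auto simp: a_def)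
      then show ?thesis using c by (simp add: a_def)
    qed
    then have "(\<Sum>c\<in>C. (\<lambda>P. rat_of_int (a c * N c) * c P)) = 0"
      unfolding expand by (simp add: fun_eq_iff)
    then have "(\<Sum>c\<in>C. (\<lambda>P. rat_of_int (a c * N c) * c P)) \<in> fun_vs.span E"
      by (simp only: fun_vs.span_zero)
    then have "\<forall>c\<in>C. a c = 0" by (rule key)
    then show False using c(1) by (auto simp: a_def)
  qed
  have "\<forall>y\<in>z ` C. a y = 0" if "(\<lambda>P. \<Sum>y\<in>z ` C. a y * y P) \<in> boundaries k S" for a
  proof -
    obtain w where w: "w \<in> chains (Suc k) S" "(\<lambda>P. \<Sum>y\<in>z ` C. a y * y P) = bdry w"
      using \<open>(\<lambda>P. \<Sum>y\<in>z ` C. a y * y P) \<in> boundaries k S\<close> unfolding boundaries_def by blast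
    have "(\<Sum>c\<in>C. (\<lambda>P. rat_of_int (a (z c) * N c) * c P)) = (\<lambda>P. of_int (\<Sum>y\<in>z ` C. a y * y P))"
      unfolding expand by (simp only: sum.reindex[OF inj] o_def)
    also have "\<dots> = (\<Sum>Q\<in>?K1. (\<lambda>P. of_int (w Q) * bcol Q P))"
      using w(2) by (auto simp: fun_eq_iff sum_fun_apply bdry_on_chains[OF fin(2) w(1), symmetric]
          simp del: of_int_sum)
    also have "\<dots> \<in> fun_vs.span E"
      using E(3) by (intro fun_vs.span_sum fun_vs.span_scale) blast
    finally show ?thesis using key[of "\<lambda>c. a (z c)"] by blast
  qed
  moreover have "card (z ` C) = card C" using inj by (rule card_image)
  ultimately show ?thesis
    using finC Nz(2) B(5) E(4) cardC by (intro exI[of _ "z ` C"]) auto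
qed

text \<open>Written additively to avoid truncated subtraction. The supremum in \<open>betti\<close>
  is attained, so no default value of \<open>Sup\<close> intervenes.\<close>

theorem betti_rank:
  fixes S :: "(real^('n::{finite,linorder})) set"
  assumes fin: "finite (cubes_in k S)" "finite (cubes_in (Suc k) S)"
  shows "betti k S + fun_vs.dim (bcol ` cubes_in k S) + fun_vs.dim (bcol ` cubes_in (Suc k) S)
     = card (cubes_in k S)"
proof -
  let ?X = "{card A | A :: ('n cube \<Rightarrow> int) set.
      finite A \<and> A \<subseteq> cycles k S \<and>
      (\<forall>a :: ('n cube \<Rightarrow> int) \<Rightarrow> int.
          (\<lambda>P. \<Sum>z\<in>A. a z * z P) \<in> boundaries k S \<longrightarrow> (\<forall>z\<in>A. a z = 0))}"
  obtain A where A: "finite A" "A \<subseteq> cycles k S"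
    "\<forall>a. (\<lambda>P. \<Sum>z\<in>A. a z * z P) \<in> boundaries k S \<longrightarrow> (\<forall>z\<in>A. a z = 0)"
    "card A + fun_vs.dim (bcol ` cubes_in k S) + fun_vs.dim (bcol ` cubes_in (Suc k) S)
       = card (cubes_in k S)"
    using betti_rank_lower[OF fin] by blast
  have "betti k S = card A" unfolding betti_def
  proof (rule cSup_eq_maximum)
    show "card A \<in> ?X" using A(1,2,3) by blast
    fix x assume "x \<in> ?X"
    then show "x \<le> card A" using betti_rank_upper[OF fin] A(4) by fastforce
  qed
  then show ?thesis using A(4) by simp
qed

section \<open>Betti numbers of sets of cubes\<close>

lemma linear_precomp:
  "Vector_Spaces.linear (\<lambda>(r::'b::field) (f::'a \<Rightarrow> 'b) x. r * f x) (\<lambda>r f x. r * f x) (\<lambda>f x. f (h x))"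
  by standard (auto simp: fun_eq_iff)

text \<open>Precomposition with a surjection is linear and injective. It is applied to translations,
  which relabel the rows of the boundary matrix.\<close>

lemma dim_precomp_image:
  fixes S :: "('a \<Rightarrow> 'b::field) set"
  assumes "surj h"
  shows "fun_vs.dim ((\<lambda>f x. f (h x)) ` S) = fun_vs.dim S"
proof -
  interpret T: Vector_Spaces.linear "\<lambda>(r::'b) (f::'a \<Rightarrow> 'b) x. r * f x" "\<lambda>r f x. r * f x" "\<lambda>f x. f (h x)"
    by (rule linear_precomp)
  have inj: "inj (\<lambda>(f::'a \<Rightarrow> 'b) x. f (h x))"
    using assms by (auto intro!: injI simp: fun_eq_iff) (metis surjD)
  obtain B where B: "B \<subseteq> S" "fun_vs.independent B" "S \<subseteq> fun_vs.span B" "card B = fun_vs.dim S"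
    using fun_vs.basis_exists .
  show ?thesis
  proof (rule fun_vs.dim_unique)
    show "(\<lambda>f x. f (h x)) ` B \<subseteq> (\<lambda>f x. f (h x)) ` S" using B(1) by (rule image_mono)
    show "(\<lambda>f x. f (h x)) ` S \<subseteq> fun_vs.span ((\<lambda>f x. f (h x)) ` B)"
      unfolding T.span_image using B(3) by (rule image_mono)
    show "fun_vs.independent ((\<lambda>f x. f (h x)) ` B)"
      using B(2) inj T.dependent_inj_imageD[of B] by (meson inj_on_subset subset_UNIV)
    show "card ((\<lambda>f x. f (h x)) ` B) = fun_vs.dim S"
      using B(4) inj by (metis card_image inj_on_subset subset_UNIV)
  qed
qed

definition cubes_dim :: "nat \<Rightarrow> ('n::finite) cube set \<Rightarrow> 'n cube set" where
  "cubes_dim k A = {Q \<in> A. cube_dim Q = k}"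

definition bdry_rank :: "nat \<Rightarrow> ('n::{finite,linorder}) cube set \<Rightarrow> nat" where
  "bdry_rank k A = fun_vs.dim (bcol ` cubes_dim k A)"

text \<open>The right-hand side of the rank formula makes sense for every finite set of cubes,
  closed under faces or not. Hence the faces of an opened cube can be inserted one by one in any
  order.\<close>

definition betti_cubes :: "nat \<Rightarrow> ('n::{finite,linorder}) cube set \<Rightarrow> real" where
  "betti_cubes q A = real (card (cubes_dim q A)) - real (bdry_rank q A) - real (bdry_rank (Suc q) A)"

lemma cubes_dim_insert:
  "cubes_dim k (insert c A) = (if cube_dim c = k then insert c (cubes_dim k A) else cubes_dim k A)"
  by (auto simp: cubes_dim_def)

lemma finite_cubes_dim [simp]: "finite A \<Longrightarrow> finite (cubes_dim k A)"
  by (simp add: cubes_dim_def)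

lemma bdry_rank_insert:
  assumes "finite A"
  shows "bdry_rank k (insert c A) = bdry_rank k A +
    (if cube_dim c = k \<and> bcol c \<notin> fun_vs.span (bcol ` cubes_dim k A) then 1 else 0)"
  using assms by (simp add: bdry_rank_def cubes_dim_insert fun_vs.dim_insert_finite)

text \<open>Submodularity of rank: a column outside the larger span is outside the smaller
  one.\<close>

lemma bdry_rank_marginal_antimono:
  assumes "A \<subseteq> B" "finite B"
  shows "bdry_rank k (insert c B) + bdry_rank k A \<le> bdry_rank k (insert c A) + bdry_rank k B"
proof -
  have "fun_vs.span (bcol ` cubes_dim k A) \<subseteq> fun_vs.span (bcol ` cubes_dim k B)"
    using assms(1) by (intro fun_vs.span_mono image_mono) (auto simp: cubes_dim_def)
  then have "bcol c \<in> fun_vs.span (bcol ` cubes_dim k B)" if "bcol c \<in> fun_vs.span (bcol ` cubes_dim k A)"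
    using that by blast
  then show ?thesis
    using finite_subset[OF assms] assms(2) by (auto simp: bdry_rank_insert)
qed

lemma card_cubes_dim_insert:
  assumes "finite A" "c \<notin> A"
  shows "card (cubes_dim k (insert c A)) = card (cubes_dim k A) + (if cube_dim c = k then 1 else 0)"
  using assms by (auto simp: cubes_dim_insert) (simp add: cubes_dim_def)

text \<open>A new \<open>q\<close>-cube raises the count by one and the first rank by zero or one; a
  new cube of dimension \<open>Suc q\<close> affects only the second rank; other dimensions change
  nothing.\<close>

lemma betti_cubes_insert_lipschitz:
  assumes "finite A"
  shows "\<bar>betti_cubes q (insert c A) - betti_cubes q A\<bar> \<le> 1"
proof (cases "c \<in> A")
  case False
  then show ?thesis
    using assms by (auto simp: betti_cubes_def bdry_rank_insert card_cubes_dim_insert)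
qed (simp add: insert_absorb)

lemma betti_cubes_lipschitz:
  assumes "finite A" "finite T"
  shows "\<bar>betti_cubes q (A \<union> T) - betti_cubes q A\<bar> \<le> real (card T)"
  using assms(2)
proof (induction T rule: finite_induct)
  case (insert c T)
  have "\<bar>betti_cubes q (insert c (A \<union> T)) - betti_cubes q (A \<union> T)\<bar> \<le> 1"
    using assms(1) insert.hyps by (intro betti_cubes_insert_lipschitz) auto
  then show ?case using insert by simp
qed simp

text \<open>The condition \<open>T \<inter> B \<subseteq> A\<close> makes each cube of
  \<open>T\<close> new to both sets or to neither, so the counts cancel and only the submodular
  ranks, entering with a minus sign, remain.\<close>

lemma betti_cubes_supermodular:
  assumes "A \<subseteq> B" "finite B" "finite T" "T \<inter> B \<subseteq> A"
  shows "betti_cubes q (A \<union> T) - betti_cubes q A \<le> betti_cubes q (B \<union> T) - betti_cubes q B"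
  using assms(3,4)
proof (induction T rule: finite_induct)
  case (insert c T)
  then have IH: "betti_cubes q (A \<union> T) - betti_cubes q A \<le> betti_cubes q (B \<union> T) - betti_cubes q B"
    by auto
  show ?case
  proof (cases "c \<in> B")
    case True
    then show ?thesis using insert IH by (simp add: insert_absorb)
  next
    case False
    have fin: "finite (A \<union> T)" "finite (B \<union> T)"
      using assms(1,2) insert.hyps finite_subset by auto
    have c: "c \<notin> A \<union> T" "c \<notin> B \<union> T" using False assms(1) insert.hyps by auto
    have "bdry_rank k (insert c (B \<union> T)) + bdry_rank k (A \<union> T) \<le> bdry_rank k (insert c (A \<union> T)) + bdry_rank k (B \<union> T)" for k
      using assms(1) fin by (intro bdry_rank_marginal_antimono) auto
    from this[of q] this[of "Suc q"] show ?thesis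
      using IH by (simp add: betti_cubes_def card_cubes_dim_insert[OF fin(1) c(1)] card_cubes_dim_insert[OF fin(2) c(2)])
  qed
qed simp

section \<open>Translation invariance of the rank formula\<close>

lemma cshift_cshift [simp]: "cshift x (cshift y Q) = cshift (x + y) Q"
  by (auto simp: cshift_def fun_eq_iff)

lemma cshift_zero [simp]: "cshift 0 Q = Q"
  by (auto simp: cshift_def fun_eq_iff)

lemma inj_cshift: "inj (cshift x)"
  by (rule inj_on_inverseI[where g = "cshift (- x)"]) simp

lemma surj_cshift: "surj (cshift x)"
  by (rule surjI[where f = "cshift (- x)"]) simp

lemma cube_dim_cshift [simp]: "cube_dim (cshift x Q) = cube_dim Q"
  by (simp add: cube_dim_def cshift_def)

lemma bcol_cshift: "bcol (cshift y Q) = (\<lambda>P. bcol Q (cshift (- y) P))"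
proof -
  have eq: "P = (cshift y Q)(j := (fst (Q j) + y $ j + a, False))
     \<longleftrightarrow> cshift (- y) P = Q(j := (fst (Q j) + a, False))" for P j a
  proof -
    have "(cshift y Q)(j := (fst (Q j) + y $ j + a, False)) = cshift y (Q(j := (fst (Q j) + a, False)))"
      by (auto simp: cshift_def fun_eq_iff)
    then show ?thesis by (metis add.left_inverse add.right_inverse cshift_cshift cshift_zero)
  qed
  have "fst (cshift y Q j) = fst (Q j) + y $ j" "snd (cshift y Q j) = snd (Q j)" for j
    by (auto simp: cshift_def)
  then show ?thesis
    unfolding bcol_def incidence_def using eq eq[of _ _ 0] by (simp add: fun_eq_iff)
qed

lemma cubes_dim_cshift: "cubes_dim k (cshift y ` A) = cshift y ` cubes_dim k A"
  by (auto simp: cubes_dim_def)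

lemma betti_cubes_cshift: "betti_cubes q (cshift y ` A) = betti_cubes q A"
proof -
  have "bcol ` cshift y ` B = (\<lambda>f x. f (cshift (- y) x)) ` bcol ` B" for B
    by (auto simp: bcol_cshift image_image)
  then have "bdry_rank k (cshift y ` A) = bdry_rank k A" for k
    unfolding bdry_rank_def cubes_dim_cshift by (simp only: dim_precomp_image[OF surj_cshift])
  moreover have "card (cshift y ` B) = card B" for B
    using inj_cshift by (metis card_image inj_on_subset subset_UNIV)
  ultimately show ?thesis by (simp add: betti_cubes_def cubes_dim_cshift)
qed

section \<open>Elementary cubes in boxes\<close>

definition ilen :: "bool \<Rightarrow> int" where
  "ilen b = (if b then 1 else 0)"

lemma ilen_bounds: "0 \<le> ilen b" "ilen b \<le> 1"
  by (auto simp: ilen_def)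

definition face :: "('n::finite) cube \<Rightarrow> 'n cube \<Rightarrow> bool" where
  "face c Q \<longleftrightarrow> (\<forall>i. fst (Q i) \<le> fst (c i) \<and> fst (c i) + ilen (snd (c i)) \<le> fst (Q i) + ilen (snd (Q i)))"

text \<open>The closure under faces of the set of open cubes, that is, the cubical complex
  underlying \<open>Xt\<close>.\<close>

definition cover :: "('n::finite) cube set \<Rightarrow> 'n cube set" where
  "cover U = {c. \<exists>Q\<in>U. face c Q}"

definition qbox :: "int^'n \<Rightarrow> nat \<Rightarrow> ('n::finite) cube set" where
  "qbox x n = {c. \<forall>i. x $ i - int n \<le> fst (c i) \<and> fst (c i) + ilen (snd (c i)) \<le> x $ i + int n}"

text \<open>\<open>cube_center c\<close> lies in the relative interior of \<open>c\<close>, hence an elementary cube contained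
  in a union of elementary cubes is already contained in one of them.\<close>

definition cube_center :: "('n::finite) cube \<Rightarrow> real^'n" where
  "cube_center c = (\<chi> i. real_of_int (fst (c i)) + real_of_int (ilen (snd (c i))) / 2)"

lemma cube_center_in: "cube_center c \<in> cube_set c"
  by (auto simp: cube_center_def cube_set_def ilen_def)

lemma cube_center_in_iff_face: "cube_center c \<in> cube_set Q \<longleftrightarrow> face c Q"
proof -
  have "(real_of_int L \<le> real_of_int l + real_of_int (ilen b) / 2 \<and>
         real_of_int l + real_of_int (ilen b) / 2 \<le> real_of_int L + (if B then 1 else 0))
     \<longleftrightarrow> (L \<le> l \<and> l + ilen b \<le> L + ilen B)" (is "?P \<longleftrightarrow> ?Q") for L l b B
  proof
    assume ?P
    \<comment> \<open>Doubling turns the half-integer coordinate of the centre into an integer; what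
      remains is integer arithmetic.\<close>
    then have "2 * L \<le> 2 * l + ilen b" "2 * l + ilen b \<le> 2 * L + 2 * ilen B"
      by (auto simp: ilen_def split: if_splits)
    then show ?Q by (auto simp: ilen_def split: if_splits, presburger)
  next
    assume ?Q
    then show ?P by (auto simp: ilen_def split: if_splits)
  qed
  then show ?thesis by (simp add: cube_center_def cube_set_def face_def)
qed

lemma cube_set_mono_face: "face c Q \<Longrightarrow> cube_set c \<subseteq> cube_set Q"
proof
  fix p assume f: "face c Q" and p: "p \<in> cube_set c"
  show "p \<in> cube_set Q" unfolding cube_set_def
  proof (intro CollectI allI)
    fix i
    have "fst (Q i) \<le> fst (c i)" "fst (c i) + ilen (snd (c i)) \<le> fst (Q i) + ilen (snd (Q i))"
      using f by (auto simp: face_def)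
    moreover have "real_of_int (fst (c i)) \<le> p $ i" "p $ i \<le> real_of_int (fst (c i)) + (if snd (c i) then 1 else 0)"
      using p by (auto simp: cube_set_def)
    ultimately show "real_of_int (fst (Q i)) \<le> p $ i \<and> p $ i \<le> real_of_int (fst (Q i)) + (if snd (Q i) then 1 else 0)"
      by (auto simp: ilen_def split: if_splits)
  qed
qed

lemma cube_set_subset_Lambda_iff: "cube_set c \<subseteq> Lambda n \<longleftrightarrow> c \<in> qbox 0 n"
proof
  assume *: "cube_set c \<subseteq> Lambda n"
  \<comment> \<open>The lowest and the highest corner of the cube suffice to confine it to the
    box.\<close>
  have "(\<chi> i. real_of_int (fst (c i))) \<in> cube_set c"
    "(\<chi> i. real_of_int (fst (c i) + ilen (snd (c i)))) \<in> cube_set c"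
    by (auto simp: cube_set_def ilen_def)
  then have "(\<chi> i. real_of_int (fst (c i))) \<in> Lambda n"
    "(\<chi> i. real_of_int (fst (c i) + ilen (snd (c i)))) \<in> Lambda n" using * by blast+
  then have "- real n \<le> real_of_int (fst (c i)) \<and> real_of_int (fst (c i) + ilen (snd (c i))) \<le> real n" for i
    by (auto simp: Lambda_def)
  then have "- int n \<le> fst (c i) \<and> fst (c i) + ilen (snd (c i)) \<le> int n" for i
    by (metis of_int_le_iff of_int_minus of_int_of_nat_eq)
  then show "c \<in> qbox 0 n" by (simp add: qbox_def)
next
  assume c: "c \<in> qbox 0 n"
  show "cube_set c \<subseteq> Lambda n"
  proof
    fix p assume p: "p \<in> cube_set c"
    show "p \<in> Lambda n" unfolding Lambda_def
    proof (intro CollectI allI)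
      fix i
      have "- int n \<le> fst (c i)" "fst (c i) + ilen (snd (c i)) \<le> int n" using c by (auto simp: qbox_def)
      moreover have "real_of_int (fst (c i)) \<le> p $ i" "p $ i \<le> real_of_int (fst (c i)) + (if snd (c i) then 1 else 0)"
        using p by (auto simp: cube_set_def)
      ultimately show "- real n \<le> p $ i \<and> p $ i \<le> real n"
        by (auto simp: ilen_def split: if_splits)
    qed
  qed
qed

text \<open>The passage from point sets to combinatorics: after this, only sets of cubes are
  handled.\<close>

lemma cubes_in_Xn: "cubes_in k (Xn n t \<omega>) = cubes_dim k (cover {Q. \<omega> Q \<le> t} \<inter> qbox 0 n)"
proof -
  have "cube_set c \<subseteq> Xt t \<omega> \<longleftrightarrow> c \<in> cover {Q. \<omega> Q \<le> t}" for c
  proof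
    assume "cube_set c \<subseteq> Xt t \<omega>"
    then have "cube_center c \<in> Xt t \<omega>" using cube_center_in by blast
    then show "c \<in> cover {Q. \<omega> Q \<le> t}"
      by (auto simp: Xt_def cover_def cube_center_in_iff_face)
  next
    assume "c \<in> cover {Q. \<omega> Q \<le> t}"
    then show "cube_set c \<subseteq> Xt t \<omega>"
      using cube_set_mono_face unfolding Xt_def cover_def by blast
  qed
  then show ?thesis
    unfolding cubes_in_def Xn_def cubes_dim_def
    by (auto simp: cube_set_subset_Lambda_iff)
qed

text \<open>Each coordinate offers \<open>2 * n + 1\<close> points and \<open>2 * n\<close> unit
  intervals.\<close>

lemma card_qbox_eq: "finite (qbox x n) \<and> card (qbox (x :: int^'n::finite) n) = (4 * n + 1) ^ CARD('n)"
proof -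
  define I where "I i = {x $ i - int n .. x $ i + int n} \<times> {False} \<union> {x $ i - int n .. x $ i + int n - 1} \<times> {True}" for i
  have finI: "finite (I i)" for i by (simp add: I_def)
  have "card (I i) = card ({x $ i - int n .. x $ i + int n} \<times> {False}) + card ({x $ i - int n .. x $ i + int n - 1} \<times> {True})" for i
    unfolding I_def by (rule card_Un_disjoint) auto
  then have "card (I i) = 4 * n + 1" for i
    by (simp add: card_cartesian_product)
  moreover have "qbox x n = PiE UNIV I"
  proof (intro set_eqI)
    fix c
    have "(x $ i - int n \<le> fst (c i) \<and> fst (c i) + ilen (snd (c i)) \<le> x $ i + int n) \<longleftrightarrow> c i \<in> I i" for i
      by (cases "c i") (auto simp: I_def ilen_def)
    then show "c \<in> qbox x n \<longleftrightarrow> c \<in> PiE UNIV I" by (simp add: qbox_def PiE_iff)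
  qed
  ultimately show ?thesis using finI by (simp add: card_PiE finite_PiE)
qed

lemma finite_qbox [simp]: "finite (qbox x n)"
  using card_qbox_eq by blast

lemma card_qbox: "card (qbox (x :: int^'n::finite) n) = (4 * n + 1) ^ CARD('n)"
  using card_qbox_eq by blast

lemma face_in_qbox: "face c Q \<Longrightarrow> Q \<in> qbox x n \<Longrightarrow> c \<in> qbox x n"
  unfolding face_def qbox_def mem_Collect_eq by (meson order_trans)

text \<open>A cube having a face in the box sticks out by at most one unit. This is why a box of
  radius \<open>n\<close> is influenced up to radius \<open>Suc n\<close>.\<close>

lemma coface_in_qbox:
  assumes "face c Q" "c \<in> qbox x n"
  shows "Q \<in> qbox x (Suc n)"
  unfolding qbox_def
proof (intro CollectI allI)
  fix i
  have "fst (Q i) \<le> fst (c i)" "fst (c i) + ilen (snd (c i)) \<le> fst (Q i) + ilen (snd (Q i))"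
    "x $ i - int n \<le> fst (c i)" "fst (c i) + ilen (snd (c i)) \<le> x $ i + int n"
    using assms by (auto simp: face_def qbox_def)
  then show "x $ i - int (Suc n) \<le> fst (Q i) \<and> fst (Q i) + ilen (snd (Q i)) \<le> x $ i + int (Suc n)"
    using ilen_bounds[of "snd (Q i)"] ilen_bounds[of "snd (c i)"] by linarith
qed

definition base :: "('n::finite) cube \<Rightarrow> int^'n" where
  "base Q = (\<chi> i. fst (Q i))"

lemma in_qbox_base: "Q \<in> qbox (base Q) 1"
  using ilen_bounds(2) by (simp add: qbox_def base_def)

lemma faces_subset_qbox: "{c. face c Q} \<subseteq> qbox (base Q) 1"
  using face_in_qbox[OF _ in_qbox_base] by blast

lemma finite_faces: "finite {c. face c Q}"
  using finite_subset[OF faces_subset_qbox] by simp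

text \<open>The origin of the constant \<open>5 ^ CARD('n)\<close> below. It counts all cubes in a
  box of radius 1; sharpness is irrelevant, uniformity in \<open>Q\<close> is what matters.\<close>

lemma card_faces_le: "card {c. face c (Q :: ('n::finite) cube)} \<le> 5 ^ CARD('n)"
  using card_mono[OF _ faces_subset_qbox, of Q] by (simp add: card_qbox)

lemma qbox_mono:
  assumes "\<And>i. y $ i - int m \<le> x $ i - int n" "\<And>i. x $ i + int n \<le> y $ i + int m"
  shows "qbox x n \<subseteq> qbox y m"
  using assms unfolding qbox_def by (blast intro: order_trans)

lemma base_in_qbox:
  assumes "Q \<in> qbox x n"
  shows "x $ i - int n \<le> base Q $ i" "base Q $ i \<le> x $ i + int n"
proof -
  have "x $ i - int n \<le> fst (Q i) \<and> fst (Q i) + ilen (snd (Q i)) \<le> x $ i + int n"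
    using assms by (auto simp: qbox_def)
  then show "x $ i - int n \<le> base Q $ i" "base Q $ i \<le> x $ i + int n"
    using ilen_bounds[of "snd (Q i)"] by (auto simp: base_def)
qed

lemma face_cshift: "face (cshift y c) (cshift y Q) \<longleftrightarrow> face c Q"
  by (simp add: face_def cshift_def)

lemma in_qbox_cshift: "cshift y c \<in> qbox (x + y) n \<longleftrightarrow> c \<in> qbox x n"
  by (simp add: qbox_def cshift_def algebra_simps)

lemma mem_cshift_image: "c \<in> cshift y ` A \<longleftrightarrow> cshift (- y) c \<in> A"
proof
  show "cshift (- y) c \<in> A \<Longrightarrow> c \<in> cshift y ` A" by (rule image_eqI[of _ _ "cshift (- y) c"]) simp
qed auto

lemma cover_cshift: "cover (cshift y ` U) = cshift y ` cover U"
proof (intro set_eqI)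
  fix c
  have "face c (cshift y Q) \<longleftrightarrow> face (cshift (- y) c) Q" for Q
    using face_cshift[of y "cshift (- y) c" Q] by simp
  then show "c \<in> cover (cshift y ` U) \<longleftrightarrow> c \<in> cshift y ` cover U"
    unfolding mem_cshift_image by (simp add: cover_def)
qed

lemma qbox_cshift: "qbox (x + y) n = cshift y ` qbox x n"
proof (intro set_eqI)
  fix c
  show "c \<in> qbox (x + y) n \<longleftrightarrow> c \<in> cshift y ` qbox x n"
    unfolding mem_cshift_image using in_qbox_cshift[of y "cshift (- y) c" x n] by simp
qed

lemma base_cshift: "base (cshift y Q) = base Q + y"
  by (simp add: base_def cshift_def vec_eq_iff)

section \<open>Bernoulli fields and the Efron--Stein inequality\<close>

text \<open>The probability that, among independent sites in \<open>I\<close> with opening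
  probabilities \<open>p\<close>, exactly those in \<open>A\<close> are open.\<close>

definition bern_weight :: "('c \<Rightarrow> real) \<Rightarrow> 'c set \<Rightarrow> 'c set \<Rightarrow> real" where
  "bern_weight p I A = (\<Prod>Q\<in>A. p Q) * (\<Prod>Q\<in>I - A. 1 - p Q)"

text \<open>Vector values are allowed so that the same calculus serves real variances and complex
  characteristic functions.\<close>

definition bern_exp :: "('c \<Rightarrow> real) \<Rightarrow> 'c set \<Rightarrow> ('c set \<Rightarrow> 'b::real_vector) \<Rightarrow> 'b" where
  "bern_exp p I f = (\<Sum>A\<in>Pow I. bern_weight p I A *\<^sub>R f A)"

lemma bern_exp_empty [simp]: "bern_exp p {} f = f {}"
  by (simp add: bern_exp_def bern_weight_def)

text \<open>Conditioning on the state of the single site \<open>a\<close>; this recursion drives the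
  inductions on \<open>I\<close>.\<close>

lemma bern_exp_insert:
  assumes "finite I" "a \<notin> I"
  shows "bern_exp p (insert a I) f
    = p a *\<^sub>R bern_exp p I (\<lambda>A. f (insert a A)) + (1 - p a) *\<^sub>R bern_exp p I f"
proof -
  have w1: "bern_weight p (insert a I) (insert a A) = p a * bern_weight p I A" if "A \<in> Pow I" for A
  proof -
    have "finite A" "a \<notin> A" "insert a I - insert a A = I - A"
      using that assms finite_subset by auto
    then show ?thesis by (simp add: bern_weight_def)
  qed
  have w0: "bern_weight p (insert a I) A = (1 - p a) * bern_weight p I A" if "A \<in> Pow I" for A
  proof -
    have "insert a I - A = insert a (I - A)" "finite (I - A)" "a \<notin> I - A"
      using that assms by auto
    then show ?thesis by (simp add: bern_weight_def)
  qed
  have "inj_on (insert a) (Pow I)" using assms(2) by (auto intro!: inj_onI)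
  moreover have "Pow I \<inter> insert a ` Pow I = {}" using assms(2) by auto
  ultimately have "bern_exp p (insert a I) f
     = (\<Sum>A\<in>Pow I. bern_weight p (insert a I) A *\<^sub>R f A)
       + (\<Sum>A\<in>Pow I. bern_weight p (insert a I) (insert a A) *\<^sub>R f (insert a A))"
    using assms(1) by (simp add: bern_exp_def Pow_insert sum.union_disjoint sum.reindex)
  also have "\<dots> = (\<Sum>A\<in>Pow I. ((1 - p a) * bern_weight p I A) *\<^sub>R f A)
       + (\<Sum>A\<in>Pow I. (p a * bern_weight p I A) *\<^sub>R f (insert a A))"
    by (intro arg_cong2[where f = "(+)"] sum.cong refl) (simp_all only: w0 w1)
  also have "\<dots> = p a *\<^sub>R bern_exp p I (\<lambda>A. f (insert a A)) + (1 - p a) *\<^sub>R bern_exp p I f"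
    by (simp add: bern_exp_def scaleR_sum_right)
  finally show ?thesis .
qed

lemma bern_exp_cong: "(\<And>A. A \<subseteq> I \<Longrightarrow> f A = g A) \<Longrightarrow> bern_exp p I f = bern_exp p I g"
  unfolding bern_exp_def by (intro sum.cong) auto

lemma bern_exp_add: "bern_exp p I (\<lambda>A. f A + g A) = bern_exp p I f + bern_exp p I g"
  by (simp add: bern_exp_def scaleR_add_right sum.distrib)

lemma bern_exp_diff: "bern_exp p I (\<lambda>A. f A - g A) = bern_exp p I f - bern_exp p I g"
  by (simp add: bern_exp_def scaleR_diff_right sum_subtractf)

lemma bern_exp_mult_left:
  fixes f :: "'c set \<Rightarrow> 'b::real_algebra"
  shows "bern_exp p I (\<lambda>A. k * f A) = k * bern_exp p I f"
  by (simp add: bern_exp_def sum_distrib_left)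

lemma bern_exp_mult_right:
  fixes f :: "'c set \<Rightarrow> 'b::real_algebra"
  shows "bern_exp p I (\<lambda>A. f A * k) = bern_exp p I f * k"
  by (simp add: bern_exp_def sum_distrib_right)

lemma bern_exp_const: "finite I \<Longrightarrow> bern_exp p I (\<lambda>_. k) = k"
  by (induction I rule: finite_induct) (auto simp: bern_exp_insert simp flip: scaleR_add_left)

lemma bern_exp_nonneg:
  fixes f :: "'c set \<Rightarrow> real"
  assumes "\<And>Q. 0 \<le> p Q" "\<And>Q. p Q \<le> 1" "\<And>A. 0 \<le> f A"
  shows "0 \<le> bern_exp p I f"
  unfolding bern_exp_def bern_weight_def using assms
  by (auto intro!: sum_nonneg mult_nonneg_nonneg prod_nonneg)

text \<open>Fubini for disjoint sets of sites, from which independence is deduced.\<close>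

lemma bern_exp_Un:
  assumes "finite I" "finite J" "I \<inter> J = {}"
  shows "bern_exp p (I \<union> J) h = bern_exp p I (\<lambda>A. bern_exp p J (\<lambda>B. h (A \<union> B)))"
  using assms(1,3)
proof (induction I arbitrary: h rule: finite_induct)
  case (insert a I)
  then have "a \<notin> I \<union> J" "I \<inter> J = {}" by auto
  then show ?case using insert assms(2)
    by (simp add: bern_exp_insert)
qed simp

lemma bern_exp_image:
  assumes "finite I" "inj h" "\<And>Q. p (h Q) = p Q"
  shows "bern_exp p (h ` I) f = bern_exp p I (\<lambda>A. f (h ` A))"
  using assms(1)
proof (induction I arbitrary: f rule: finite_induct)
  case (insert a I)
  then have "h a \<notin> h ` I" using assms(2) by (auto dest: injD)
  then show ?case using insert assms(3) by (simp add: bern_exp_insert)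
qed simp

lemma bern_exp_square_le:
  fixes f :: "'c set \<Rightarrow> real"
  assumes "finite I" "\<And>Q. 0 \<le> p Q" "\<And>Q. p Q \<le> 1"
  shows "(bern_exp p I f)\<^sup>2 \<le> bern_exp p I (\<lambda>A. (f A)\<^sup>2)"
proof -
  let ?m = "bern_exp p I f"
  have "0 \<le> bern_exp p I (\<lambda>A. (f A - ?m)\<^sup>2)"
    using assms by (intro bern_exp_nonneg) auto
  also have "(\<lambda>A. (f A - ?m)\<^sup>2) = (\<lambda>A. (f A)\<^sup>2 - 2 * ?m * f A + ?m\<^sup>2)"
    by (auto simp: power2_eq_square algebra_simps)
  also have "bern_exp p I \<dots> = bern_exp p I (\<lambda>A. (f A)\<^sup>2) - 2 * ?m * ?m + ?m\<^sup>2"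
    using assms(1) by (simp only: bern_exp_add bern_exp_diff bern_exp_mult_left bern_exp_const)
  finally show ?thesis by (simp add: power2_eq_square)
qed

text \<open>Removing \<open>Q\<close> in the second term makes the value independent of whether
  \<open>Q\<close> is open in \<open>A\<close>.\<close>

definition flip_diff :: "'c \<Rightarrow> ('c set \<Rightarrow> real) \<Rightarrow> 'c set \<Rightarrow> real" where
  "flip_diff Q f A = f (insert Q A) - f (A - {Q})"

text \<open>The Efron--Stein inequality: condition on the last coordinate and apply Jensen's
  inequality to the difference of the two conditional means.\<close>

lemma bern_exp_poincare:
  fixes f :: "'c set \<Rightarrow> real"
  assumes "finite I" and p: "\<And>Q. 0 \<le> p Q" "\<And>Q. p Q \<le> 1"
  shows "bern_exp p I (\<lambda>A. (f A)\<^sup>2) - (bern_exp p I f)\<^sup>2 \<le> (\<Sum>Q\<in>I. bern_exp p I (\<lambda>A. (flip_diff Q f A)\<^sup>2))"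
  using assms(1)
proof (induction I arbitrary: f rule: finite_induct)
  case (insert a I)
  define f1 where "f1 A = f (insert a A)" for A
  define x where "x = p a"
  define e1 e0 s1 s0 where "e1 = bern_exp p I f1" and "e0 = bern_exp p I f"
    and "s1 = bern_exp p I (\<lambda>A. (f1 A)\<^sup>2)" and "s0 = bern_exp p I (\<lambda>A. (f A)\<^sup>2)"
  define d1 d0 where "d1 = (\<Sum>Q\<in>I. bern_exp p I (\<lambda>A. (flip_diff Q f1 A)\<^sup>2))"
    and "d0 = (\<Sum>Q\<in>I. bern_exp p I (\<lambda>A. (flip_diff Q f A)\<^sup>2))"
  have x: "0 \<le> x" "x \<le> 1" using p by (auto simp: x_def)
  have IH: "s1 - e1\<^sup>2 \<le> d1" "s0 - e0\<^sup>2 \<le> d0"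
    unfolding s1_def e1_def d1_def s0_def e0_def d0_def by (intro insert.IH)+
  have E: "bern_exp p (insert a I) f = x * e1 + (1 - x) * e0"
    "bern_exp p (insert a I) (\<lambda>A. (f A)\<^sup>2) = x * s1 + (1 - x) * s0"
    using insert.hyps by (simp_all add: bern_exp_insert e1_def e0_def s1_def s0_def f1_def[abs_def] x_def)
  have "(\<Sum>Q\<in>I. bern_exp p (insert a I) (\<lambda>A. (flip_diff Q f A)\<^sup>2)) = x * d1 + (1 - x) * d0"
  proof -
    have "bern_exp p (insert a I) (\<lambda>A. (flip_diff Q f A)\<^sup>2)
      = x * bern_exp p I (\<lambda>A. (flip_diff Q f1 A)\<^sup>2) + (1 - x) * bern_exp p I (\<lambda>A. (flip_diff Q f A)\<^sup>2)"
      if "Q \<in> I" for Q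
    proof -
      have "flip_diff Q f (insert a A) = flip_diff Q f1 A" for A
        using that insert.hyps by (auto simp: flip_diff_def f1_def insert_commute insert_Diff_if)
      then show ?thesis using insert.hyps by (simp add: bern_exp_insert x_def)
    qed
    then show ?thesis by (simp add: d1_def d0_def sum.distrib sum_distrib_left)
  qed
  moreover have "bern_exp p (insert a I) (\<lambda>A. (flip_diff a f A)\<^sup>2) = bern_exp p I (\<lambda>A. (f1 A - f A)\<^sup>2)"
  proof -
    have "flip_diff a f (insert a A) = f1 A - f A" "flip_diff a f A = f1 A - f A" if "A \<subseteq> I" for A
    proof -
      have "a \<notin> A" using that insert.hyps(2) by blast
      then show "flip_diff a f (insert a A) = f1 A - f A" "flip_diff a f A = f1 A - f A"
        by (simp_all add: flip_diff_def f1_def)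
    qed
    then have "bern_exp p I (\<lambda>A. (flip_diff a f (insert a A))\<^sup>2) = bern_exp p I (\<lambda>A. (f1 A - f A)\<^sup>2)"
      "bern_exp p I (\<lambda>A. (flip_diff a f A)\<^sup>2) = bern_exp p I (\<lambda>A. (f1 A - f A)\<^sup>2)"
      by (intro bern_exp_cong; simp)+
    then show ?thesis using insert.hyps by (simp add: bern_exp_insert left_diff_distrib)
  qed
  moreover have "(e1 - e0)\<^sup>2 \<le> bern_exp p I (\<lambda>A. (f1 A - f A)\<^sup>2)"
    using bern_exp_square_le[of I p "\<lambda>A. f1 A - f A"] insert.hyps(1) p
    by (simp add: bern_exp_diff e1_def e0_def)
  ultimately have "x * d1 + (1 - x) * d0 + (e1 - e0)\<^sup>2
      \<le> (\<Sum>Q\<in>insert a I. bern_exp p (insert a I) (\<lambda>A. (flip_diff Q f A)\<^sup>2))"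
    using insert.hyps by simp
  moreover have "x * s1 + (1 - x) * s0 - (x * e1 + (1 - x) * e0)\<^sup>2
     = x * (s1 - e1\<^sup>2) + (1 - x) * (s0 - e0\<^sup>2) + x * (1 - x) * (e1 - e0)\<^sup>2"
    by (simp add: power2_eq_square algebra_simps)
  moreover have "x * (s1 - e1\<^sup>2) \<le> x * d1" "(1 - x) * (s0 - e0\<^sup>2) \<le> (1 - x) * d0"
    using IH x by (auto intro!: mult_left_mono)
  moreover have "x * (1 - x) * (e1 - e0)\<^sup>2 \<le> 1 * (e1 - e0)\<^sup>2"
    using x by (intro mult_right_mono) (auto intro!: mult_le_one)
  ultimately show ?case unfolding E by linarith
qed simp

section \<open>Functions determined by finitely many sites\<close>

definition depends_on :: "'c set \<Rightarrow> ('c set \<Rightarrow> 'b) \<Rightarrow> bool" where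
  "depends_on I f \<longleftrightarrow> (\<forall>S. f S = f (S \<inter> I))"

lemma depends_onD: "depends_on I f \<Longrightarrow> f S = f (S \<inter> I)"
  unfolding depends_on_def by (erule spec)

lemma depends_on_mono:
  assumes "depends_on I f" "I \<subseteq> J"
  shows "depends_on J f"
  unfolding depends_on_def
proof
  fix S
  have "S \<inter> J \<inter> I = S \<inter> I" using assms(2) by blast
  then show "f S = f (S \<inter> J)"
    using depends_onD[OF assms(1), of S] depends_onD[OF assms(1), of "S \<inter> J"] by simp
qed

lemma depends_on_comp: "depends_on I f \<Longrightarrow> depends_on I (\<lambda>S. h (f S))"
  unfolding depends_on_def by (intro allI arg_cong[where f = h]) (erule spec)

lemma depends_on_comp2: "depends_on I f \<Longrightarrow> depends_on I g \<Longrightarrow> depends_on I (\<lambda>S. h (f S) (g S))"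
  unfolding depends_on_def by metis

lemma depends_on_sum: "(\<And>x. x \<in> A \<Longrightarrow> depends_on I (f x)) \<Longrightarrow> depends_on I (\<lambda>S. \<Sum>x\<in>A. f x S)"
  unfolding depends_on_def by (intro allI sum.cong refl) (erule meta_allE, erule meta_impE, assumption, erule spec)

lemma depends_on_prod: "(\<And>x. x \<in> A \<Longrightarrow> depends_on I (f x)) \<Longrightarrow> depends_on I (\<lambda>S. \<Prod>x\<in>A. f x S)"
  unfolding depends_on_def by (intro allI prod.cong refl) (erule meta_allE, erule meta_impE, assumption, erule spec)

lemma depends_on_flip_diff:
  assumes "depends_on I f"
  shows "depends_on I (flip_diff Q f)"
proof -
  have "f (insert Q S) = f (insert Q (S \<inter> I))" "f (S - {Q}) = f (S \<inter> I - {Q})" for S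
  proof -
    have "insert Q S \<inter> I = insert Q (S \<inter> I) \<inter> I" "(S - {Q}) \<inter> I = (S \<inter> I - {Q}) \<inter> I" by auto
    then show "f (insert Q S) = f (insert Q (S \<inter> I))" "f (S - {Q}) = f (S \<inter> I - {Q})"
      using assms unfolding depends_on_def by metis+
  qed
  then show ?thesis by (simp add: depends_on_def flip_diff_def)
qed

lemma flip_diff_eq_0:
  assumes "depends_on I f" "Q \<notin> I"
  shows "flip_diff Q f S = 0"
proof -
  have "insert Q S \<inter> I = (S - {Q}) \<inter> I" using assms(2) by auto
  then show ?thesis using assms(1) unfolding depends_on_def flip_diff_def by (metis diff_self)
qed

text \<open>Such functions take finitely many values, and the class is closed under arbitrary
  pointwise operations. It therefore replaces all measurability and integrability side
  conditions.\<close>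

definition local_fun :: "('c set \<Rightarrow> 'b) \<Rightarrow> bool" where
  "local_fun f \<longleftrightarrow> (\<exists>I. finite I \<and> depends_on I f)"

lemma local_funI: "depends_on I f \<Longrightarrow> finite I \<Longrightarrow> local_fun f"
  unfolding local_fun_def by blast

lemma local_fun_const: "local_fun (\<lambda>_. k)"
  by (rule local_funI[of "{}"]) (auto simp: depends_on_def)

lemma local_fun_comp: "local_fun f \<Longrightarrow> local_fun (\<lambda>S. h (f S))"
  unfolding local_fun_def by (elim exE conjE, intro exI conjI, assumption, rule depends_on_comp)

lemma local_fun_comp2:
  assumes "local_fun f" "local_fun g"
  shows "local_fun (\<lambda>S. h (f S) (g S))"
proof -
  obtain I J where "finite I" "depends_on I f" "finite J" "depends_on J g"
    using assms unfolding local_fun_def by blast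
  then show ?thesis
    by (intro local_funI[of "I \<union> J"] depends_on_comp2[where h = h]) (auto intro: depends_on_mono)
qed

lemma local_fun_sum: "finite A \<Longrightarrow> (\<And>x. x \<in> A \<Longrightarrow> local_fun (f x)) \<Longrightarrow> local_fun (\<lambda>S. \<Sum>x\<in>A. f x S)"
proof (induction A rule: finite_induct)
  case (insert a A)
  then have "local_fun (\<lambda>S. f a S + (\<Sum>x\<in>A. f x S))"
    by (intro local_fun_comp2[where h = "(+)"]) auto
  then show ?case using insert.hyps by simp
qed (simp add: local_fun_const)

lemma local_fun_flip_diff: "local_fun f \<Longrightarrow> local_fun (flip_diff Q f)"
  unfolding local_fun_def by (elim exE conjE, intro exI conjI depends_on_flip_diff)

text \<open>Only the laws of the open set on finite sets of sites are recorded; they determine every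
  expectation of a local function.\<close>

locale bernoulli_field = prob_space M for M :: "'w measure" +
  fixes open_set :: "'w \<Rightarrow> 'c set" and p :: "'c \<Rightarrow> real"
  assumes p_nonneg: "0 \<le> p Q" and p_le_1: "p Q \<le> 1"
    and law_sets: "finite I \<Longrightarrow> A \<subseteq> I \<Longrightarrow> {w \<in> space M. open_set w \<inter> I = A} \<in> sets M"
    and law_prob: "finite I \<Longrightarrow> A \<subseteq> I \<Longrightarrow> prob {w \<in> space M. open_set w \<inter> I = A} = bern_weight p I A"
begin

definition Ex :: "('c set \<Rightarrow> 'b::{banach,second_countable_topology}) \<Rightarrow> 'b" where
  "Ex f = (\<integral>w. f (open_set w) \<partial>M)"

text \<open>The function is a finite combination of indicators of the patterns on \<open>I\<close>,
  whose probabilities the locale provides.\<close>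

lemma has_integral_depends_on:
  fixes f :: "'c set \<Rightarrow> 'b::{banach,second_countable_topology}"
  assumes "finite I" "depends_on I f"
  shows "has_bochner_integral M (\<lambda>w. f (open_set w)) (bern_exp p I f)"
proof -
  have eq: "f (open_set w) = (\<Sum>A\<in>Pow I. indicator {w \<in> space M. open_set w \<inter> I = A} w *\<^sub>R f A)"
    if "w \<in> space M" for w
  proof -
    have "(\<Sum>A\<in>Pow I. indicator {w \<in> space M. open_set w \<inter> I = A} w *\<^sub>R f A)
       = (\<Sum>A\<in>Pow I. if A = open_set w \<inter> I then f A else 0)"
      using that by (intro sum.cong) (auto simp: indicator_def)
    also have "\<dots> = f (open_set w \<inter> I)"
      using assms(1) by (subst sum.delta) auto
    finally show ?thesis using assms(2) unfolding depends_on_def by metis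
  qed
  have "has_bochner_integral M (\<lambda>w. \<Sum>A\<in>Pow I. indicator {w \<in> space M. open_set w \<inter> I = A} w *\<^sub>R f A)
      (\<Sum>A\<in>Pow I. prob {w \<in> space M. open_set w \<inter> I = A} *\<^sub>R f A)"
  proof (intro has_bochner_integral_sum has_bochner_integral_scaleR_left)
    fix A assume "A \<in> Pow I"
    then show "has_bochner_integral M (indicator {w \<in> space M. open_set w \<inter> I = A})
       (prob {w \<in> space M. open_set w \<inter> I = A})"
      using law_sets[OF assms(1), of A]
      by (intro has_bochner_integral_real_indicator) (auto simp: emeasure_eq_measure)
  qed
  moreover have "(\<Sum>A\<in>Pow I. prob {w \<in> space M. open_set w \<inter> I = A} *\<^sub>R f A) = bern_exp p I f"
    unfolding bern_exp_def by (intro sum.cong refl) (simp add: law_prob[OF assms(1)])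
  ultimately have "has_bochner_integral M (\<lambda>w. \<Sum>A\<in>Pow I. indicator {w \<in> space M. open_set w \<inter> I = A} w *\<^sub>R f A)
      (bern_exp p I f)" by simp
  then show ?thesis
    by (subst has_bochner_integral_cong[OF refl eq refl])
qed

lemma Ex_depends_on: "finite I \<Longrightarrow> depends_on I f \<Longrightarrow> Ex f = bern_exp p I f"
  unfolding Ex_def using has_integral_depends_on by (rule has_bochner_integral_integral_eq)

lemma integrable_local: "local_fun f \<Longrightarrow> integrable M (\<lambda>w. f (open_set w))"
  for f :: "'c set \<Rightarrow> 'b::{banach,second_countable_topology}"
  unfolding local_fun_def
  by (elim exE conjE, rule integrable.intros, rule has_integral_depends_on)

lemma Ex_const [simp]: "Ex (\<lambda>_. k) = k"
  using Ex_depends_on[of "{}" "\<lambda>_. k"] by (simp add: depends_on_def)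

lemma Ex_add: "local_fun f \<Longrightarrow> local_fun g \<Longrightarrow> Ex (\<lambda>S. f S + g S) = Ex f + Ex g"
  unfolding Ex_def by (intro Bochner_Integration.integral_add integrable_local)

lemma Ex_diff: "local_fun f \<Longrightarrow> local_fun g \<Longrightarrow> Ex (\<lambda>S. f S - g S) = Ex f - Ex g"
  unfolding Ex_def by (intro Bochner_Integration.integral_diff integrable_local)

lemma Ex_sum: "(\<And>x. x \<in> A \<Longrightarrow> local_fun (f x)) \<Longrightarrow> Ex (\<lambda>S. \<Sum>x\<in>A. f x S) = (\<Sum>x\<in>A. Ex (f x))"
  unfolding Ex_def by (intro Bochner_Integration.integral_sum integrable_local)

lemma Ex_mult_left: "Ex (\<lambda>S. k * f S) = k * Ex f" for k :: "'b::{real_normed_field,banach,second_countable_topology}"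
  unfolding Ex_def by (rule integral_mult_right_zero)

lemma Ex_divide: "Ex (\<lambda>S. f S / k) = Ex f / k" for k :: "'b::{real_normed_field,banach,second_countable_topology}"
  unfolding Ex_def by (rule integral_divide_zero)

lemma Ex_mono:
  fixes f g :: "'c set \<Rightarrow> real"
  shows "local_fun f \<Longrightarrow> local_fun g \<Longrightarrow> (\<And>S. f S \<le> g S) \<Longrightarrow> Ex f \<le> Ex g"
  unfolding Ex_def by (intro integral_mono integrable_local)

lemma norm_Ex_le:
  fixes f :: "'c set \<Rightarrow> 'b::{banach,second_countable_topology}"
  shows "norm (Ex f) \<le> Ex (\<lambda>S. norm (f S))"
  unfolding Ex_def by (rule integral_norm_bound)

lemma Ex_mult_indep:
  fixes f g :: "'c set \<Rightarrow> 'b::{real_normed_field,banach,second_countable_topology}"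
  assumes "finite I" "depends_on I f" "finite J" "depends_on J g" "I \<inter> J = {}"
  shows "Ex (\<lambda>S. f S * g S) = Ex f * Ex g"
proof -
  have "depends_on (I \<union> J) (\<lambda>S. f S * g S)"
    by (intro depends_on_comp2[where h = "(*)"] depends_on_mono[OF assms(2)] depends_on_mono[OF assms(4)]) auto
  then have "Ex (\<lambda>S. f S * g S) = bern_exp p I (\<lambda>A. bern_exp p J (\<lambda>B. f (A \<union> B) * g (A \<union> B)))"
    using assms by (subst Ex_depends_on[of "I \<union> J"]) (auto simp: bern_exp_Un)
  also have "\<dots> = bern_exp p I (\<lambda>A. bern_exp p J (\<lambda>B. f A * g B))"
  proof (intro bern_exp_cong)
    fix A B assume "A \<subseteq> I" "B \<subseteq> J"
    then have "(A \<union> B) \<inter> I = A \<inter> I" "(A \<union> B) \<inter> J = B \<inter> J" using assms(5) by auto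
    then show "f (A \<union> B) * g (A \<union> B) = f A * g B"
      using assms(2,4) unfolding depends_on_def by metis
  qed
  also have "\<dots> = Ex f * Ex g"
    unfolding Ex_depends_on[OF assms(1,2)] Ex_depends_on[OF assms(3,4)]
    by (simp add: bern_exp_mult_left bern_exp_mult_right)
  finally show ?thesis .
qed

lemma Ex_prod_indep:
  fixes f :: "'i \<Rightarrow> 'c set \<Rightarrow> 'b::{real_normed_field,banach,second_countable_topology}"
  assumes "finite A" "\<And>x. x \<in> A \<Longrightarrow> finite (I x)" "\<And>x. x \<in> A \<Longrightarrow> depends_on (I x) (f x)"
    "\<And>x y. x \<in> A \<Longrightarrow> y \<in> A \<Longrightarrow> x \<noteq> y \<Longrightarrow> I x \<inter> I y = {}"
  shows "Ex (\<lambda>S. \<Prod>x\<in>A. f x S) = (\<Prod>x\<in>A. Ex (f x))"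
  using assms
proof (induction A rule: finite_induct)
  case (insert a A)
  have "Ex (\<lambda>S. f a S * (\<Prod>x\<in>A. f x S)) = Ex (f a) * Ex (\<lambda>S. \<Prod>x\<in>A. f x S)"
  proof (rule Ex_mult_indep[of "I a" _ "\<Union>x\<in>A. I x"])
    show "I a \<inter> (\<Union>x\<in>A. I x) = {}" using insert.prems(3) insert.hyps(2) by blast
    show "depends_on (\<Union>x\<in>A. I x) (\<lambda>S. \<Prod>x\<in>A. f x S)"
      by (rule depends_on_prod, rule depends_on_mono[OF insert.prems(2)]) auto
  qed (use insert.prems insert.hyps in auto)
  then show ?case using insert by simp
qed simp

definition Var :: "('c set \<Rightarrow> real) \<Rightarrow> real" where
  "Var f = Ex (\<lambda>S. (f S - Ex f)\<^sup>2)"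

lemma Var_eq: "local_fun f \<Longrightarrow> Var f = Ex (\<lambda>S. (f S)\<^sup>2) - (Ex f)\<^sup>2"
proof -
  assume f: "local_fun f"
  have "Var f = Ex (\<lambda>S. (f S)\<^sup>2 - 2 * Ex f * f S + (Ex f)\<^sup>2)"
    unfolding Var_def by (simp add: power2_eq_square algebra_simps)
  also have "\<dots> = Ex (\<lambda>S. (f S)\<^sup>2) - 2 * Ex f * Ex f + (Ex f)\<^sup>2"
  proof -
    have 1: "local_fun (\<lambda>S. (f S)\<^sup>2)" "local_fun (\<lambda>S. 2 * Ex f * f S)"
      "local_fun (\<lambda>S. (f S)\<^sup>2 - 2 * Ex f * f S)"
      using f by (rule local_fun_comp)+
    show ?thesis
      unfolding Ex_add[OF 1(3) local_fun_const] Ex_diff[OF 1(1,2)] Ex_mult_left by simp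
  qed
  finally show ?thesis by (simp add: power2_eq_square)
qed

lemma Var_poincare:
  assumes "finite I" "depends_on I f"
  shows "Var f \<le> (\<Sum>Q\<in>I. Ex (\<lambda>S. (flip_diff Q f S)\<^sup>2))"
proof -
  have "depends_on I (\<lambda>S. (f S)\<^sup>2)" "depends_on I (\<lambda>S. (flip_diff Q f S)\<^sup>2)" for Q
    by (intro depends_on_comp[where h = "\<lambda>x. x\<^sup>2"] depends_on_flip_diff assms(2))+
  note eqs = this[THEN Ex_depends_on[OF assms(1)]] Ex_depends_on[OF assms]
  have "local_fun f" using assms by (intro local_funI)
  then show ?thesis
    using bern_exp_poincare[where p = p and f = f, OF assms(1) p_nonneg p_le_1]
    by (simp only: Var_eq eqs)
qed

text \<open>Relabelling the sites by a bijection that preserves \<open>p\<close> does not change the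
  law; applied to translations below.\<close>

lemma Ex_image:
  assumes "inj h" "\<And>Q. p (h Q) = p Q" "local_fun f" "surj h"
  shows "Ex (\<lambda>S. f (h ` S)) = Ex f"
proof -
  obtain I where I: "finite I" "depends_on I f" using assms(3) unfolding local_fun_def by blast
  have hI: "h ` (h -` I) = I" using assms(4) by (rule surj_image_vimage_eq)
  have fin: "finite (h -` I)" using I(1) assms(1) by (rule finite_vimageI)
  have "f (h ` S) = f (h ` (S \<inter> h -` I))" for S
  proof -
    have "h ` S \<inter> I = h ` (S \<inter> h -` I) \<inter> I" by auto
    then show ?thesis using I(2) unfolding depends_on_def by metis
  qed
  then have "depends_on (h -` I) (\<lambda>S. f (h ` S))" unfolding depends_on_def by blast
  then have "Ex (\<lambda>S. f (h ` S)) = bern_exp p (h -` I) (\<lambda>S. f (h ` S))"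
    using fin by (intro Ex_depends_on)
  also have "\<dots> = bern_exp p I f"
    using bern_exp_image[of "h -` I" h p f] fin assms(1,2) hI by simp
  finally show ?thesis using I by (simp add: Ex_depends_on)
qed

end

section \<open>Betti numbers of boxes\<close>

text \<open>The box cuts the complex after closure under faces, as in \<open>Xn\<close>: an open
  cube that sticks out still contributes its faces inside.\<close>

definition box_betti :: "nat \<Rightarrow> int^('n::{finite,linorder}) \<Rightarrow> nat \<Rightarrow> 'n cube set \<Rightarrow> real" where
  "box_betti q x n S = betti_cubes q (cover S \<inter> qbox x n)"

lemma depends_on_box_betti: "depends_on (qbox x (Suc n)) (box_betti q x n)"
proof -
  have "cover S \<inter> qbox x n = cover (S \<inter> qbox x (Suc n)) \<inter> qbox x n" for S
    using coface_in_qbox by (fastforce simp: cover_def)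
  then show ?thesis by (simp add: depends_on_def box_betti_def)
qed

lemma local_fun_box_betti: "local_fun (box_betti q x n)"
  by (rule local_funI[OF depends_on_box_betti]) simp

lemma box_betti_cshift: "box_betti q (x + y) n (cshift y ` S) = box_betti q x n S"
proof -
  have "cover (cshift y ` S) \<inter> qbox (x + y) n = cshift y ` (cover S \<inter> qbox x n)"
    unfolding cover_cshift qbox_cshift using inj_cshift[of y] by (simp add: image_Int)
  then show ?thesis by (simp add: box_betti_def betti_cubes_cshift)
qed

lemma cover_insert_eq: "cover (insert Q S) = cover (S - {Q}) \<union> {c. face c Q}"
  by (auto simp: cover_def)

lemma flip_diff_box_betti:
  "flip_diff Q (box_betti q x n) S =
    betti_cubes q ((cover (S - {Q}) \<inter> qbox x n) \<union> ({c. face c Q} \<inter> qbox x n))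
    - betti_cubes q (cover (S - {Q}) \<inter> qbox x n)"
  by (simp add: flip_diff_def box_betti_def cover_insert_eq Int_Un_distrib2)

lemma flip_diff_box_betti_bound:
  fixes Q :: "('n::{finite,linorder}) cube"
  shows "\<bar>flip_diff Q (box_betti q x n) S\<bar> \<le> 5 ^ CARD('n)"
proof -
  have "\<bar>flip_diff Q (box_betti q x n) S\<bar> \<le> real (card ({c. face c Q} \<inter> qbox x n))"
    unfolding flip_diff_box_betti by (rule betti_cubes_lipschitz) auto
  also have "card ({c. face c Q} \<inter> qbox x n) \<le> card {c. face c Q}"
    by (intro card_mono finite_faces) auto
  also have "card {c. face c Q} \<le> 5 ^ CARD('n)" by (rule card_faces_le)
  finally show ?thesis by simp
qed

text \<open>Since \<open>Q\<close> lies in the smaller window, opening it adds the same family of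
  faces in both windows, and a face already present in the larger complex is present in the smaller
  one. So supermodularity applies.\<close>

lemma flip_diff_box_betti_mono:
  assumes "Q \<in> qbox x n" "qbox x n \<subseteq> qbox y m"
  shows "flip_diff Q (box_betti q x n) S \<le> flip_diff Q (box_betti q y m) S"
proof -
  have f: "{c. face c Q} \<subseteq> qbox x n" using assms(1) face_in_qbox by blast
  then have "{c. face c Q} \<inter> qbox x n = {c. face c Q}" "{c. face c Q} \<inter> qbox y m = {c. face c Q}"
    using assms(2) by auto
  then show ?thesis
    unfolding flip_diff_box_betti using assms(2) f
    by (simp, intro betti_cubes_supermodular) (auto intro: finite_faces)
qed

lemma flip_diff_cshift:
  assumes "\<And>S. g (cshift y ` S) = f S"
  shows "flip_diff (cshift y Q) g (cshift y ` S) = flip_diff Q f S"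
proof -
  have "cshift y ` S - {cshift y Q} = cshift y ` (S - {Q})"
    using inj_cshift[of y] by (auto simp: inj_on_def)
  moreover have "insert (cshift y Q) (cshift y ` S) = cshift y ` insert Q S" by simp
  ultimately show ?thesis unfolding flip_diff_def using assms by metis
qed

text \<open>A box of radius \<open>m\<close> is influenced by cubes in the box of radius \<open>m + 1\<close>; the spacing
  \<open>2 * m + 4\<close> makes these enlarged boxes disjoint.\<close>

definition blocks :: "nat \<Rightarrow> nat \<Rightarrow> (int^'n::finite) set" where
  "blocks m r = (\<lambda>f. \<chi> i. int (2 * m + 4) * f i) ` PiE UNIV (\<lambda>_. {- int r .. int r})"

lemma finite_blocks: "finite (blocks m r)"
  by (simp add: blocks_def finite_PiE)

lemma card_blocks: "card (blocks m r :: (int^'n::finite) set) = (2 * r + 1) ^ CARD('n)"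
proof -
  have "inj_on (\<lambda>f. (\<chi> i. int (2 * m + 4) * f i) :: int^'n) (PiE UNIV (\<lambda>_. {- int r .. int r}))"
    by (auto intro!: inj_onI simp: vec_eq_iff)
  moreover have "card {- int r .. int r} = 2 * r + 1"
    by (rule int_int_eq[THEN iffD1]) simp
  ultimately show ?thesis by (simp only: blocks_def card_image card_PiE finite prod_constant)
qed

lemma qbox_blocks_disjoint:
  assumes "x \<in> blocks m r" "y \<in> blocks m r" "x \<noteq> y"
  shows "qbox x (Suc m) \<inter> qbox y (Suc m) = {}"
proof (rule ccontr)
  assume "qbox x (Suc m) \<inter> qbox y (Suc m) \<noteq> {}"
  then obtain c where c: "c \<in> qbox x (Suc m)" "c \<in> qbox y (Suc m)" by blast
  obtain f g where fg: "x = (\<chi> i. int (2 * m + 4) * f i)" "y = (\<chi> i. int (2 * m + 4) * g i)"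
    using assms by (auto simp: blocks_def)
  obtain i where i: "x $ i \<noteq> y $ i" using assms(3) by (auto simp: vec_eq_iff)
  \<comment> \<open>The base of the common cube is within \<open>m + 1\<close> of both centres, so
    these differ by at most \<open>2 * m + 2\<close>, less than one lattice step.\<close>
  have "\<bar>x $ i - y $ i\<bar> < int (2 * m + 4)"
    using base_in_qbox[OF c(1), of i] base_in_qbox[OF c(2), of i] by linarith
  moreover have "x $ i - y $ i = int (2 * m + 4) * (f i - g i)" by (simp add: fg algebra_simps)
  moreover have "f i - g i \<noteq> 0" using i fg by auto
  ultimately have "int (2 * m + 4) * \<bar>f i - g i\<bar> < int (2 * m + 4)" "\<bar>f i - g i\<bar> \<ge> 1"
    by (simp_all add: abs_mult)
  then show False by (smt (verit) mult_le_cancel_left1 of_nat_0_le_iff)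
qed

lemma qbox_block_subset:
  assumes "x \<in> blocks m r" "(2 * m + 4) * r + k \<le> n"
  shows "qbox x k \<subseteq> qbox 0 n"
proof (rule qbox_mono)
  fix i
  obtain f where f: "x = (\<chi> i. int (2 * m + 4) * f i)" "\<And>i. - int r \<le> f i" "\<And>i. f i \<le> int r"
    using assms by (auto simp: blocks_def PiE_iff)
  have "int (2 * m + 4) * f i \<le> int (2 * m + 4) * int r" "int (2 * m + 4) * (- int r) \<le> int (2 * m + 4) * f i"
    using f by (intro mult_left_mono; simp)+
  moreover have "int (2 * m + 4) * int r + int k \<le> int n" using assms(2) by (metis of_nat_add of_nat_le_iff of_nat_mult)
  ultimately show "0 $ i - int n \<le> x $ i - int k" "x $ i + int k \<le> 0 $ i + int n"
    unfolding f(1) vec_lambda_beta zero_index by linarith+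
qed

lemma qbox_mono_radius: "k \<le> m \<Longrightarrow> qbox x k \<subseteq> qbox x m"
  by (rule qbox_mono) auto

section \<open>Approximation by independent blocks\<close>

text \<open>For a product measure, stationarity takes the form \<open>p_cshift\<close>: opening
  probabilities are constant along translates.\<close>

locale cube_field = bernoulli_field M open_set p
  for M :: "'w measure" and open_set :: "'w \<Rightarrow> ('n::{finite,linorder}) cube set" and p :: "'n cube \<Rightarrow> real" +
  fixes q :: nat
  assumes p_cshift: "p (cshift x Q) = p Q"
begin

lemma Ex_cshift: "local_fun f \<Longrightarrow> Ex (\<lambda>S. f (cshift x ` S)) = Ex f"
  for f :: "'n cube set \<Rightarrow> 'b::{banach,second_countable_topology}"
  by (rule Ex_image[OF inj_cshift p_cshift _ surj_cshift])

lemma Ex_box_betti_comp: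
  fixes h :: "real \<Rightarrow> 'b::{banach,second_countable_topology}"
  shows "Ex (\<lambda>S. h (box_betti q x m S)) = Ex (\<lambda>S. h (box_betti q 0 m S))"
proof -
  have "Ex (\<lambda>S. h (box_betti q x m (cshift x ` S))) = Ex (\<lambda>S. h (box_betti q x m S))"
    by (rule Ex_cshift[OF local_fun_comp[OF local_fun_box_betti]])
  then show ?thesis using box_betti_cshift[of q 0 x m] by simp
qed

lemma Ex_box_betti: "Ex (box_betti q x m) = Ex (box_betti q 0 m)"
  using Ex_box_betti_comp[of "\<lambda>r. r"] by simp

definition add_cost :: "'n cube \<Rightarrow> nat \<Rightarrow> real" where
  "add_cost Q j = Ex (flip_diff Q (box_betti q 0 j))"

lemma local_fun_flip_box_betti: "local_fun (flip_diff Q (box_betti q x n))"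
  by (intro local_fun_flip_diff local_fun_box_betti)

text \<open>A window centred at the cube itself reduces every cube to a translate with base
  0.\<close>

lemma Ex_flip_box_betti_base:
  "Ex (flip_diff Q (box_betti q (base Q) j)) = add_cost (cshift (- base Q) Q) j"
proof -
  let ?y = "base Q"
  have "flip_diff (cshift ?y (cshift (- ?y) Q)) (box_betti q ?y j) (cshift ?y ` S)
      = flip_diff (cshift (- ?y) Q) (box_betti q 0 j) S" for S
    by (rule flip_diff_cshift) (use box_betti_cshift[of q 0 ?y j] in simp)
  then have "add_cost (cshift (- ?y) Q) j = Ex (\<lambda>S. flip_diff Q (box_betti q ?y j) (cshift ?y ` S))"
    unfolding add_cost_def by simp
  also have "\<dots> = Ex (flip_diff Q (box_betti q ?y j))"
    by (rule Ex_cshift[OF local_fun_flip_box_betti])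
  finally show ?thesis by simp
qed

lemma add_cost_mono:
  assumes "base Q = 0" "1 \<le> j" "j \<le> l"
  shows "add_cost Q j \<le> add_cost Q l"
  unfolding add_cost_def
proof (intro Ex_mono local_fun_flip_box_betti flip_diff_box_betti_mono)
  show "Q \<in> qbox 0 j" using in_qbox_base[of Q] assms qbox_mono_radius[of 1 j 0] by auto
  show "qbox 0 j \<subseteq> qbox 0 l" using assms by (intro qbox_mono_radius)
qed

lemma add_cost_le: "add_cost Q j \<le> (5 ^ CARD('n))"
proof -
  have "flip_diff Q (box_betti q 0 j) S \<le> (5 ^ CARD('n))" for S
    using flip_diff_box_betti_bound[of Q q 0 j S] by linarith
  then have "add_cost Q j \<le> Ex (\<lambda>S. (5 ^ CARD('n)))"
    unfolding add_cost_def by (intro Ex_mono local_fun_flip_box_betti local_fun_const)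
  then show ?thesis by simp
qed

text \<open>One radius \<open>k\<close> works for all \<open>Q\<close> with base 0, since there are
  finitely many. Summing their costs gives a single bounded increasing sequence.\<close>

lemma add_cost_stabilizes:
  assumes "\<epsilon> > 0"
  obtains k where "k \<ge> 1" "\<And>Q l. base Q = 0 \<Longrightarrow> k \<le> l \<Longrightarrow> add_cost Q l - add_cost Q k \<le> \<epsilon>"
proof -
  define B where "B = {Q :: 'n cube. base Q = 0}"
  have "B \<subseteq> qbox 0 1"
  proof
    fix Q assume "Q \<in> B"
    then show "Q \<in> qbox 0 1" using in_qbox_base[of Q] by (simp add: B_def)
  qed
  then have finB: "finite B" by (rule finite_subset) simp
  \<comment> \<open>The index is shifted because a cube with base 0 is only sure to lie in the
    window from radius 1 on.\<close>
  define a where "a j = (\<Sum>Q\<in>B. add_cost Q (Suc j))" for j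
  have inc: "incseq a"
    unfolding a_def by (intro incseq_SucI sum_mono add_cost_mono) (auto simp: B_def)
  have "a j \<le> real (card B) * (5 ^ CARD('n))" for j
    unfolding a_def using sum_bounded_above[of B "\<lambda>Q. add_cost Q (Suc j)" "5 ^ CARD('n)"] add_cost_le by simp
  then obtain L where L: "a \<longlonglongrightarrow> L" "\<And>j. a j \<le> L"
    using incseq_convergent[OF inc, of "real (card B) * (5 ^ CARD('n))"] by blast
  then obtain j where "\<bar>a j - L\<bar> < \<epsilon>"
    using LIMSEQ_D[OF L(1) assms] by (metis order_refl real_norm_def)
  then have j: "L - a j < \<epsilon>" by linarith
  show thesis
  proof (rule that[of "Suc j"])
    fix Q :: "'n cube" and l assume Q: "base Q = 0" and l: "Suc j \<le> l"
    obtain l' where l': "l = Suc l'" "j \<le> l'" using l by (cases l) auto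
    \<comment> \<open>Every summand is nonnegative by monotonicity, so each one is bounded by the
      sum.\<close>
    have "add_cost Q l - add_cost Q (Suc j) \<le> (\<Sum>Q\<in>B. add_cost Q l - add_cost Q (Suc j))"
      using finB Q l add_cost_mono by (intro member_le_sum) (auto simp: B_def)
    also have "\<dots> = a l' - a j" by (simp add: a_def l' sum_subtractf)
    also have "\<dots> \<le> \<epsilon>" using L(2)[of l'] j by linarith
    finally show "add_cost Q l - add_cost Q (Suc j) \<le> \<epsilon>" .
  qed simp
qed

definition remainder :: "nat \<Rightarrow> nat \<Rightarrow> nat \<Rightarrow> 'n cube set \<Rightarrow> real" where
  "remainder n m r S = box_betti q 0 n S - (\<Sum>x\<in>blocks m r. box_betti q x m S)"

lemma depends_on_remainder:
  assumes "(2 * m + 4) * r + m \<le> n"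
  shows "depends_on (qbox 0 (Suc n)) (remainder n m r)"
proof -
  have "depends_on (qbox 0 (Suc n)) (box_betti q x m)" if "x \<in> blocks m r" for x
    using qbox_block_subset[OF that, of "Suc m" "Suc n"] assms
    by (intro depends_on_mono[OF depends_on_box_betti]) simp
  then have "depends_on (qbox 0 (Suc n)) (\<lambda>S. \<Sum>x\<in>blocks m r. box_betti q x m S)"
    by (rule depends_on_sum)
  then show ?thesis
    unfolding remainder_def[abs_def] by (rule depends_on_comp2[OF depends_on_box_betti])
qed

lemma flip_diff_remainder:
  "flip_diff Q (remainder n m r) S =
     flip_diff Q (box_betti q 0 n) S - (\<Sum>x\<in>blocks m r. flip_diff Q (box_betti q x m) S)"
  by (simp add: flip_diff_def remainder_def sum_subtractf)

text \<open>The zones of influence of the blocks are disjoint, so at most one block notices the flip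
  of \<open>Q\<close>.\<close>

lemma flip_diff_remainder_block:
  assumes "x \<in> blocks m r" "Q \<in> qbox x (Suc m)"
  shows "flip_diff Q (remainder n m r) S = flip_diff Q (box_betti q 0 n) S - flip_diff Q (box_betti q x m) S"
proof -
  have "flip_diff Q (box_betti q y m) S = 0" if "y \<in> blocks m r - {x}" for y
    using that assms qbox_blocks_disjoint[of x m r y]
    by (intro flip_diff_eq_0[OF depends_on_box_betti]) auto
  then have "(\<Sum>y\<in>blocks m r. flip_diff Q (box_betti q y m) S) = flip_diff Q (box_betti q x m) S"
    using assms(1) by (subst sum.remove[OF finite_blocks assms(1)]) simp
  then show ?thesis by (simp add: flip_diff_remainder)
qed

lemma flip_diff_remainder_bound: "\<bar>flip_diff Q (remainder n m r) S\<bar> \<le> 2 * (5 ^ CARD('n))"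
proof (cases "\<exists>x\<in>blocks m r. Q \<in> qbox x (Suc m)")
  case True
  then obtain x where x: "x \<in> blocks m r" "Q \<in> qbox x (Suc m)" by blast
  show ?thesis
    unfolding flip_diff_remainder_block[OF x]
    using flip_diff_box_betti_bound[of Q q 0 n S] flip_diff_box_betti_bound[of Q q x m S] by linarith
next
  case False
  then have "flip_diff Q (box_betti q x m) S = 0" if "x \<in> blocks m r" for x
    using that by (intro flip_diff_eq_0[OF depends_on_box_betti]) auto
  then have "flip_diff Q (remainder n m r) S = flip_diff Q (box_betti q 0 n) S"
    by (simp add: flip_diff_remainder)
  then show ?thesis using flip_diff_box_betti_bound[of Q q 0 n S] by simp
qed

text \<open>The windows are nested: radius \<open>k\<close> about \<open>Q\<close>, the block, the
  large box, radius \<open>2 * n\<close> about \<open>Q\<close>. Monotonicity bounds the difference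
  between the two middle costs by that between the two outer ones, whose mean is at most
  \<open>\<epsilon>\<close>.\<close>

lemma Ex_flip_remainder_good:
  assumes k: "k \<ge> 1" "\<And>Q l. base Q = 0 \<Longrightarrow> k \<le> l \<Longrightarrow> add_cost Q l - add_cost Q k \<le> \<epsilon>"
    and "k \<le> m" "(2 * m + 4) * r + m \<le> n" and x: "x \<in> blocks m r" "Q \<in> qbox x (m - k)"
  shows "Ex (\<lambda>S. (flip_diff Q (remainder n m r) S)\<^sup>2) \<le> 2 * (5 ^ CARD('n)) * \<epsilon>"
proof -
  let ?y = "base Q"
  have sub0: "qbox x m \<subseteq> qbox 0 n" using qbox_block_subset[OF x(1)] assms(4) by blast
  have Qm: "Q \<in> qbox x m" using x(2) qbox_mono_radius[of "m - k" m x] by auto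
  have Qn: "Q \<in> qbox 0 n" using Qm sub0 by blast
  have Qy: "Q \<in> qbox ?y k" using in_qbox_base qbox_mono_radius[OF k(1)] by blast
  have sub1: "qbox ?y k \<subseteq> qbox x m"
  proof (rule qbox_mono)
    fix i
    show "x $ i - int m \<le> ?y $ i - int k" "?y $ i + int k \<le> x $ i + int m"
      using base_in_qbox[OF x(2), of i] assms(3) by auto
  qed
  \<comment> \<open>The base of \<open>Q\<close> is within \<open>n\<close> of the origin, so
    doubling the radius covers the large box.\<close>
  have sub2: "qbox 0 n \<subseteq> qbox ?y (2 * n)"
  proof (rule qbox_mono)
    fix i
    show "?y $ i - int (2 * n) \<le> 0 $ i - int n" "0 $ i + int n \<le> ?y $ i + int (2 * n)"
      using base_in_qbox[OF Qn, of i] by auto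
  qed
  define D where "D S = flip_diff Q (box_betti q 0 n) S - flip_diff Q (box_betti q x m) S" for S
  have D0: "0 \<le> D S" for S
    unfolding D_def using flip_diff_box_betti_mono[OF Qm sub0, of q S] by simp
  have D1: "D S \<le> flip_diff Q (box_betti q ?y (2 * n)) S - flip_diff Q (box_betti q ?y k) S" for S
    unfolding D_def using flip_diff_box_betti_mono[OF Qn sub2, of q S] flip_diff_box_betti_mono[OF Qy sub1, of q S]
    by linarith
  have eq: "flip_diff Q (remainder n m r) S = D S" for S
    unfolding D_def using x(2) qbox_mono_radius[of "m - k" "Suc m" x] le_SucI[OF diff_le_self, of m k]
    by (intro flip_diff_remainder_block[OF x(1)]) blast
  have D2: "D S \<le> 2 * (5 ^ CARD('n))" for S using flip_diff_remainder_bound[of Q n m r S] by (simp add: eq)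
  have loc: "local_fun D"
    unfolding D_def[abs_def] by (rule local_fun_comp2[OF local_fun_flip_box_betti local_fun_flip_box_betti])
  have loc2: "local_fun (\<lambda>S. flip_diff Q (box_betti q ?y (2 * n)) S - flip_diff Q (box_betti q ?y k) S)"
    by (rule local_fun_comp2[OF local_fun_flip_box_betti local_fun_flip_box_betti])
  \<comment> \<open>The sign of \<open>D\<close> is essential: with its upper bound it reduces the
    second moment to the first.\<close>
  have "Ex (\<lambda>S. (D S)\<^sup>2) \<le> Ex (\<lambda>S. 2 * (5 ^ CARD('n)) * D S)"
  proof (rule Ex_mono)
    show "(D S)\<^sup>2 \<le> 2 * (5 ^ CARD('n)) * D S" for S
      using mult_right_mono[OF D2[of S] D0[of S]] by (simp add: power2_eq_square)
  qed (rule local_fun_comp[OF loc])+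
  also have "\<dots> = 2 * (5 ^ CARD('n)) * Ex D" by (rule Ex_mult_left)
  also have "Ex D \<le> Ex (\<lambda>S. flip_diff Q (box_betti q ?y (2 * n)) S - flip_diff Q (box_betti q ?y k) S)"
    by (rule Ex_mono[OF loc loc2 D1])
  also have "\<dots> = add_cost (cshift (- ?y) Q) (2 * n) - add_cost (cshift (- ?y) Q) k"
    by (simp add: Ex_diff local_fun_flip_box_betti Ex_flip_box_betti_base)
  also have "\<dots> \<le> \<epsilon>"
    using assms(3,4) by (intro k(2)) (auto simp: base_cshift)
  finally show ?thesis by (simp add: eq)
qed

text \<open>The Efron-Stein sum is split. Cubes at depth \<open>k\<close> inside a block contribute
  a small amount each; all others are bounded uniformly and counted.\<close>

lemma Var_remainder_le:
  assumes k: "k \<ge> 1" "\<And>Q l. base Q = 0 \<Longrightarrow> k \<le> l \<Longrightarrow> add_cost Q l - add_cost Q k \<le> \<epsilon>"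
    and km: "k \<le> m" and n: "(2 * m + 4) * r + m \<le> n" and \<epsilon>: "\<epsilon> > 0"
  shows "Var (remainder n m r) \<le> 2 * (5 ^ CARD('n)) * \<epsilon> * (4 * real n + 5) ^ CARD('n)
    + (2 * (5 ^ CARD('n)))\<^sup>2 * ((4 * real n + 5) ^ CARD('n) - ((2 * real r + 1) * (4 * real (m - k) + 1)) ^ CARD('n))"
proof -
  define I where "I = (qbox 0 (Suc n) :: 'n cube set)"
  define A where "A = (\<Union>x\<in>blocks m r. qbox x (m - k) :: 'n cube set)"
  define g where "g Q = Ex (\<lambda>S. (flip_diff Q (remainder n m r) S)\<^sup>2)" for Q
  have finA: "finite A" by (simp add: A_def finite_blocks)
  have AI: "A \<subseteq> I"
    unfolding A_def I_def using n by (intro UN_least qbox_block_subset) auto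
  have "card A = (\<Sum>x\<in>(blocks m r :: (int, 'n) vec set). card (qbox x (m - k)))"
    unfolding A_def
  proof (rule card_UN_disjoint)
    show "\<forall>x\<in>blocks m r. \<forall>y\<in>blocks m r. x \<noteq> y \<longrightarrow> qbox x (m - k) \<inter> qbox y (m - k) = ({} :: 'n cube set)"
      using qbox_blocks_disjoint[of _ m r] qbox_mono_radius[of "m - k" "Suc m"]
      by (metis (no_types, lifting) Int_mono diff_le_self le_SucI subset_empty)
  qed (auto simp: finite_blocks)
  then have "card A = (2 * r + 1) ^ CARD('n) * (4 * (m - k) + 1) ^ CARD('n)"
    by (simp add: card_qbox card_blocks)
  then have cA: "real (card A) = ((2 * real r + 1) * (4 * real (m - k) + 1)) ^ CARD('n)"
    by (simp add: power_mult_distrib add.commute)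
  have cI: "real (card I) = (4 * real n + 5) ^ CARD('n)"
    by (simp add: I_def card_qbox of_nat_power algebra_simps)
  have good: "g Q \<le> 2 * (5 ^ CARD('n)) * \<epsilon>" if "Q \<in> A" for Q
    using that Ex_flip_remainder_good[OF k km n] unfolding A_def g_def by blast
  have loc: "local_fun (remainder n m r)"
    by (rule local_funI[OF depends_on_remainder[OF n]]) simp
  have bad: "g Q \<le> (2 * (5 ^ CARD('n)))\<^sup>2" for Q
  proof -
    have "g Q \<le> Ex (\<lambda>_. (2 * (5 ^ CARD('n)))\<^sup>2)"
      unfolding g_def
    proof (rule Ex_mono[OF _ local_fun_const])
      show "local_fun (\<lambda>S. (flip_diff Q (remainder n m r) S)\<^sup>2)"
        by (rule local_fun_comp[OF local_fun_flip_diff[OF loc]])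
      show "(flip_diff Q (remainder n m r) S)\<^sup>2 \<le> (2 * (5 ^ CARD('n)))\<^sup>2" for S
        using flip_diff_remainder_bound[of Q n m r S] by (subst abs_le_square_iff[symmetric]) simp
    qed
    then show ?thesis by simp
  qed
  have "Var (remainder n m r) \<le> (\<Sum>Q\<in>I. g Q)"
    unfolding g_def I_def by (rule Var_poincare[OF _ depends_on_remainder[OF n]]) simp
  also have "\<dots> = (\<Sum>Q\<in>A. g Q) + (\<Sum>Q\<in>I - A. g Q)"
    using AI by (subst sum.subset_diff[of A I]) (auto simp: I_def)
  also have "\<dots> \<le> real (card A) * (2 * (5 ^ CARD('n)) * \<epsilon>) + real (card (I - A)) * (2 * (5 ^ CARD('n)))\<^sup>2"
    by (intro add_mono sum_bounded_above good bad)
  also have "real (card (I - A)) = real (card I) - real (card A)"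
    using AI finA by (simp add: card_Diff_subset I_def card_mono of_nat_diff)
  also have "real (card A) * (2 * (5 ^ CARD('n)) * \<epsilon>) \<le> real (card I) * (2 * (5 ^ CARD('n)) * \<epsilon>)"
    using AI \<epsilon> card_mono[OF _ AI] by (intro mult_right_mono) (auto simp: I_def)
  finally show ?thesis unfolding cA cI by (simp add: mult.commute mult.left_commute)
qed

end

section \<open>Block counts and limits of volume ratios\<close>

definition block_count :: "nat \<Rightarrow> nat \<Rightarrow> nat" where
  "block_count n m = (n - (m + 2)) div (2 * m + 4)"

text \<open>\<open>block_count n m\<close> is the largest \<open>r\<close> for which the cells of
  half-width \<open>m + 2\<close> about the block centres stay inside the box.\<close>

lemma block_count_le:
  assumes "m + 2 \<le> n"
  shows "(2 * m + 4) * block_count n m + (m + 2) \<le> n"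
  using assms times_div_less_eq_dividend[of "2 * m + 4" "n - (m + 2)"] unfolding block_count_def by linarith

text \<open>The cells of side \<open>2 * m + 4\<close> tile a cube whose side falls short of
  \<open>2 * n\<close> by at most two cells.\<close>

lemma block_count_bounds:
  assumes "m + 2 \<le> n"
  shows "(2 * real m + 4) * (2 * real (block_count n m) + 1) \<le> 2 * real n"
    "2 * real n - 2 * (2 * real m + 4) \<le> (2 * real m + 4) * (2 * real (block_count n m) + 1)"
proof -
  have "real ((2 * m + 4) * block_count n m + (m + 2)) \<le> real n"
    using block_count_le[OF assms] by (simp only: of_nat_le_iff)
  then show "(2 * real m + 4) * (2 * real (block_count n m) + 1) \<le> 2 * real n"
    by (simp add: algebra_simps)
  have "n - (m + 2) < (2 * m + 4) * block_count n m + (2 * m + 4)"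
    unfolding block_count_def using dividend_less_times_div[of "2 * m + 4" "n - (m + 2)"] by simp
  then have "n \<le> (2 * m + 4) * block_count n m + (2 * m + 4) + (m + 2)" using assms by linarith
  then have "real n \<le> real ((2 * m + 4) * block_count n m + (2 * m + 4) + (m + 2))"
    by (simp only: of_nat_le_iff)
  then show "2 * real n - 2 * (2 * real m + 4) \<le> (2 * real m + 4) * (2 * real (block_count n m) + 1)"
    by (simp add: algebra_simps)
qed

lemma block_count_ratio:
  "(\<lambda>n. (2 * real (block_count n m) + 1) / (2 * real n)) \<longlonglongrightarrow> 1 / (2 * real m + 4)"
proof (rule tendsto_sandwich)
  let ?s = "2 * real m + 4"
  show "(\<lambda>n. 1 / ?s - 1 / real n) \<longlonglongrightarrow> 1 / ?s"
    using tendsto_diff[OF tendsto_const lim_const_over_n[of 1], of "1 / ?s"] by simp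
  show "(\<lambda>n. 1 / ?s) \<longlonglongrightarrow> 1 / ?s" by simp
  have s: "?s > 0" by simp
  show "\<forall>\<^sub>F n in sequentially. (2 * real (block_count n m) + 1) / (2 * real n) \<le> 1 / ?s"
    using eventually_ge_at_top[of "m + 2"]
  proof eventually_elim
    case (elim n)
    then show ?case using block_count_bounds(1)[OF elim] s
      by (simp add: divide_le_eq le_divide_eq mult.commute)
  qed
  show "\<forall>\<^sub>F n in sequentially. 1 / ?s - 1 / real n \<le> (2 * real (block_count n m) + 1) / (2 * real n)"
    using eventually_ge_at_top[of "m + 2"]
  proof eventually_elim
    case (elim n)
    then have n: "real n > 0" by simp
    have "1 / t - 1 / real n = (2 * real n - 2 * t) / (t * (2 * real n))" if "t > 0" for t
      using that n by (simp add: diff_divide_distrib)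
    from this[OF s] have "1 / ?s - 1 / real n = (2 * real n - 2 * ?s) / (?s * (2 * real n))" .
    also have "\<dots> \<le> (?s * (2 * real (block_count n m) + 1)) / (?s * (2 * real n))"
      using block_count_bounds(2)[OF elim] n by (intro divide_right_mono) auto
    also have "\<dots> = (2 * real (block_count n m) + 1) / (2 * real n)" using s by simp
    finally show ?case .
  qed
qed

lemma box_ratio: "(\<lambda>n. (4 * real n + 5) / (2 * real n)) \<longlonglongrightarrow> 2"
proof (rule Lim_transform_eventually)
  show "(\<lambda>n. 2 + (5/2) / real n) \<longlonglongrightarrow> 2"
    using tendsto_add[OF tendsto_const lim_const_over_n[of "5/2 :: real"], of 2] by simp
  show "\<forall>\<^sub>F n in sequentially. 2 + (5/2) / real n = (4 * real n + 5) / (2 * real n)"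
    using eventually_gt_at_top[of 0] by eventually_elim (simp add: field_simps)
qed

text \<open>The limit agrees with \<open>box_ratio\<close>: both count interval factors per unit
  length. Hence the cores asymptotically exhaust the cubes of the box.\<close>

lemma core_ratio: "(\<lambda>m. (4 * real (m - k) + 1) / (2 * real m + 4)) \<longlonglongrightarrow> 2"
proof (rule tendsto_sandwich)
  show "(\<lambda>m. 2 - (4 * real k + 7) / real m) \<longlonglongrightarrow> 2"
    using tendsto_diff[OF tendsto_const lim_const_over_n[of "4 * real k + 7"], of 2] by simp
  show "(\<lambda>m. 2 :: real) \<longlonglongrightarrow> 2" by simp
  show "\<forall>\<^sub>F m in sequentially. (4 * real (m - k) + 1) / (2 * real m + 4) \<le> 2"
  proof (intro always_eventually allI)
    fix m
    have "real (m - k) \<le> real m" by simp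
    then show "(4 * real (m - k) + 1) / (2 * real m + 4) \<le> 2" by (simp add: divide_le_eq)
  qed
  show "\<forall>\<^sub>F m in sequentially. 2 - (4 * real k + 7) / real m \<le> (4 * real (m - k) + 1) / (2 * real m + 4)"
    using eventually_ge_at_top[of k] eventually_gt_at_top[of 0]
  proof eventually_elim
    case (elim m)
    have "(4 * real k + 7) / (2 * real m + 4) \<le> (4 * real k + 7) / real m"
      using elim by (intro divide_left_mono) auto
    moreover have "(4 * real (m - k) + 1) / (2 * real m + 4) = 2 - (4 * real k + 7) / (2 * real m + 4)"
      using elim by (simp add: field_simps of_nat_diff)
    ultimately show ?case by linarith
  qed
qed

lemma exp_minus_quadratic:
  fixes u :: real
  assumes "0 \<le> u"
  shows "\<bar>exp (- u) - (1 - u)\<bar> \<le> u\<^sup>2"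
proof -
  have "1 + u + u\<^sup>2 / 2 \<le> exp u" using exp_lower_Taylor_quadratic[OF assms] .
  then have "exp (- u) * (1 + u + u\<^sup>2 / 2) \<le> exp (- u) * exp u" by (intro mult_left_mono) auto
  also have "\<dots> = 1" by (simp flip: exp_add)
  \<comment> \<open>The added term completes the product of the quadratic Taylor polynomials of
    \<open>exp (- u)\<close> and \<open>exp u\<close>; the common factor is then cancelled.\<close>
  also have "1 \<le> 1 + (u\<^sup>2)\<^sup>2 / 4" by simp
  also have "\<dots> = (1 - u + u\<^sup>2 / 2) * (1 + u + u\<^sup>2 / 2)"
    by (simp add: power2_eq_square field_simps)
  finally have "exp (- u) \<le> 1 - u + u\<^sup>2 / 2"
    by (rule mult_right_le_imp_le) (use assms in \<open>simp add: add_pos_nonneg\<close>)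
  moreover have "1 - u \<le> exp (- u)" using exp_ge_add_one_self[of "- u"] by simp
  ultimately show ?thesis using zero_le_power2[of u] by linarith
qed

lemma cmod_iexp_diff_le: "cmod (iexp x - iexp y) \<le> \<bar>x - y\<bar>"
proof -
  have "iexp x - iexp y = iexp y * (iexp (x - y) - 1)"
    by (simp add: algebra_simps flip: exp_add)
  then have "cmod (iexp x - iexp y) = cmod (iexp (x - y) - 1)" by (simp add: norm_mult)
  also have "\<dots> \<le> \<bar>x - y\<bar>" using iexp_approx1[of "x - y" 0] by simp
  finally show ?thesis .
qed

context cube_field begin

text \<open>Order of choices: \<open>\<epsilon>\<close> fixes the depth \<open>k\<close>, then
  \<open>m\<close> is taken so large that cubes outside the cores are rare, and only then does
  \<open>n\<close> grow.\<close>

lemma Var_remainder_small: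
  assumes "\<epsilon> > 0"
  shows "\<exists>m. \<forall>\<^sub>F n in sequentially. Var (remainder n m (block_count n m)) \<le> \<epsilon> * (2 * real n) ^ CARD('n)"
proof -
  let ?d = "CARD('n)"
  define L where "L = (5 :: real) ^ ?d"
  \<comment> \<open>Chosen so that the contribution of the cores tends to
    \<open>\<epsilon> / 4\<close> after division by the volume.\<close>
  define \<epsilon>' where "\<epsilon>' = \<epsilon> / (8 * L * 2 ^ ?d)"
  have L: "L > 0" by (simp add: L_def)
  have \<epsilon>': "\<epsilon>' > 0" using assms L by (simp add: \<epsilon>'_def)
  have eL: "2 * L * \<epsilon>' * 2 ^ ?d = \<epsilon> / 4" using L by (simp add: \<epsilon>'_def field_simps)
  obtain k where k: "k \<ge> 1" "\<And>Q l. base Q = 0 \<Longrightarrow> k \<le> l \<Longrightarrow> add_cost Q l - add_cost Q k \<le> \<epsilon>'"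
    using add_cost_stabilizes[OF \<epsilon>'] by blast
  have "(\<lambda>m. (2 * L)\<^sup>2 * (2 ^ ?d - ((4 * real (m - k) + 1) / (2 * real m + 4)) ^ ?d)) \<longlonglongrightarrow> (2 * L)\<^sup>2 * (2 ^ ?d - 2 ^ ?d)"
    by (intro tendsto_intros core_ratio)
  then have "\<forall>\<^sub>F m in sequentially. (2 * L)\<^sup>2 * (2 ^ ?d - ((4 * real (m - k) + 1) / (2 * real m + 4)) ^ ?d) < \<epsilon> / 4"
    using assms by (intro order_tendstoD(2)) auto
  then have "\<forall>\<^sub>F m in sequentially. k \<le> m \<and> (2 * L)\<^sup>2 * (2 ^ ?d - ((4 * real (m - k) + 1) / (2 * real m + 4)) ^ ?d) < \<epsilon> / 4"
    using eventually_ge_at_top[of k] by eventually_elim simp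
  then obtain m where m: "k \<le> m" "(2 * L)\<^sup>2 * (2 ^ ?d - ((4 * real (m - k) + 1) / (2 * real m + 4)) ^ ?d) < \<epsilon> / 4"
    using eventually_happens'[OF sequentially_bot] by blast
  define g where "g n = 2 * L * \<epsilon>' * ((4 * real n + 5) / (2 * real n)) ^ ?d
    + (2 * L)\<^sup>2 * (((4 * real n + 5) / (2 * real n)) ^ ?d
        - ((2 * real (block_count n m) + 1) / (2 * real n) * (4 * real (m - k) + 1)) ^ ?d)" for n
  have "g \<longlonglongrightarrow> 2 * L * \<epsilon>' * 2 ^ ?d + (2 * L)\<^sup>2 * (2 ^ ?d - (1 / (2 * real m + 4) * (4 * real (m - k) + 1)) ^ ?d)"
    unfolding g_def by (intro tendsto_intros box_ratio block_count_ratio)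
  moreover have "2 * L * \<epsilon>' * 2 ^ ?d + (2 * L)\<^sup>2 * (2 ^ ?d - (1 / (2 * real m + 4) * (4 * real (m - k) + 1)) ^ ?d) < \<epsilon>"
    using m(2) eL assms by simp
  ultimately have "\<forall>\<^sub>F n in sequentially. g n < \<epsilon>" by (rule order_tendstoD(2))
  then have "\<forall>\<^sub>F n in sequentially. Var (remainder n m (block_count n m)) \<le> \<epsilon> * (2 * real n) ^ ?d"
    using eventually_ge_at_top[of "m + 2"]
  proof eventually_elim
    case (elim n)
    have n: "(2 * real n) ^ ?d > 0" using elim by simp
    have "(2 * m + 4) * block_count n m + m \<le> n" using block_count_le[OF elim(2)] by linarith
    from Var_remainder_le[OF k m(1) this \<epsilon>']
    have "Var (remainder n m (block_count n m)) \<le> 2 * L * \<epsilon>' * (4 * real n + 5) ^ ?d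
      + (2 * L)\<^sup>2 * ((4 * real n + 5) ^ ?d - ((2 * real (block_count n m) + 1) * (4 * real (m - k) + 1)) ^ ?d)"
      by (simp add: L_def)
    also have "\<dots> = g n * (2 * real n) ^ ?d"
    proof -
      have 1: "(x / (2 * real n)) ^ ?d * (2 * real n) ^ ?d = x ^ ?d" for x
        using elim(2) by (simp add: power_divide)
      have 2: "(x / (2 * real n) * y) ^ ?d * (2 * real n) ^ ?d = (x * y) ^ ?d" for x y
        using 1[of "x * y"] by (simp only: times_divide_eq_left)
      show ?thesis
        unfolding g_def by (simp only: distrib_right left_diff_distrib mult.assoc 1 2)
    qed
    also have "\<dots> \<le> \<epsilon> * (2 * real n) ^ ?d" using elim(1) n by (intro mult_right_mono) auto
    finally show ?case .
  qed
  then show ?thesis by blast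
qed

text \<open>A crude bound of volume order, which keeps the second moment of
  \<open>norm_betti\<close> bounded.\<close>

lemma Var_box_betti_le: "Var (box_betti q 0 n) \<le> (5 ^ CARD('n))\<^sup>2 * (4 * real n + 5) ^ CARD('n)"
proof -
  have "Var (box_betti q 0 n) \<le> (\<Sum>Q\<in>qbox 0 (Suc n). Ex (\<lambda>S. (flip_diff Q (box_betti q 0 n) S)\<^sup>2))"
    by (rule Var_poincare[OF _ depends_on_box_betti]) simp
  also have "\<dots> \<le> real (card (qbox 0 (Suc n) :: 'n cube set)) * (5 ^ CARD('n))\<^sup>2"
  proof (rule sum_bounded_above)
    fix Q :: "'n cube"
    have "Ex (\<lambda>S. (flip_diff Q (box_betti q 0 n) S)\<^sup>2) \<le> Ex (\<lambda>_. (5 ^ CARD('n))\<^sup>2)"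
    proof (rule Ex_mono[OF _ local_fun_const])
      show "local_fun (\<lambda>S. (flip_diff Q (box_betti q 0 n) S)\<^sup>2)"
        by (rule local_fun_comp[OF local_fun_flip_box_betti])
      show "(flip_diff Q (box_betti q 0 n) S)\<^sup>2 \<le> (5 ^ CARD('n))\<^sup>2" for S
        using flip_diff_box_betti_bound[of Q q 0 n S] by (subst abs_le_square_iff[symmetric]) simp
    qed
    then show "Ex (\<lambda>S. (flip_diff Q (box_betti q 0 n) S)\<^sup>2) \<le> (5 ^ CARD('n))\<^sup>2" by simp
  qed
  also have "real (card (qbox 0 (Suc n) :: 'n cube set)) = (4 * real n + 5) ^ CARD('n)"
    by (simp add: card_qbox add.commute)
  finally show ?thesis by (simp add: mult.commute)
qed

end

section \<open>The central limit theorem for independent blocks\<close>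

context cube_field begin

definition vol :: "nat \<Rightarrow> real" where
  "vol n = (2 * real n) ^ CARD('n)"

lemma vol_ge: "n > 0 \<Longrightarrow> real n \<le> vol n"
proof -
  assume n: "n > 0"
  have "real n \<le> (2 * real n) ^ 1" by simp
  also have "\<dots> \<le> (2 * real n) ^ CARD('n)"
    using n by (intro power_increasing) (auto simp: Suc_le_eq)
  finally show ?thesis by (simp add: vol_def)
qed

lemma vol_pos: "n > 0 \<Longrightarrow> vol n > 0"
  by (simp add: vol_def)

definition centered :: "nat \<Rightarrow> (int, 'n) vec \<Rightarrow> 'n cube set \<Rightarrow> real" where
  "centered m x S = box_betti q x m S - Ex (box_betti q 0 m)"

lemma depends_on_centered: "depends_on (qbox x (Suc m)) (centered m x)"
  unfolding centered_def[abs_def] by (rule depends_on_comp[OF depends_on_box_betti])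

lemma local_fun_centered: "local_fun (centered m x)"
  by (rule local_funI[OF depends_on_centered]) simp

lemma Ex_centered: "Ex (centered m x) = 0"
  unfolding centered_def[abs_def] Ex_diff[OF local_fun_box_betti local_fun_const] Ex_const
  using Ex_box_betti[of x m] by simp

lemma Ex_centered_comp:
  fixes h :: "real \<Rightarrow> 'b::{banach,second_countable_topology}"
  shows "Ex (\<lambda>S. h (centered m x S)) = Ex (\<lambda>S. h (centered m 0 S))"
  unfolding centered_def using Ex_box_betti_comp[of "\<lambda>r. h (r - Ex (box_betti q 0 m))"] .

lemma Ex_centered_square: "Ex (\<lambda>S. (centered m x S)\<^sup>2) = Var (box_betti q 0 m)"
  using Ex_centered_comp[of "\<lambda>r. r\<^sup>2" m x] by (simp add: centered_def Var_def)

definition norm_betti :: "nat \<Rightarrow> 'n cube set \<Rightarrow> real" where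
  "norm_betti n S = centered n 0 S / sqrt (vol n)"

text \<open>Normalised by the volume of the whole box rather than of the blocks, so that the
  difference to \<open>norm_betti\<close> is the centred remainder.\<close>

definition norm_blocks :: "nat \<Rightarrow> nat \<Rightarrow> 'n cube set \<Rightarrow> real" where
  "norm_blocks m n S = (\<Sum>x\<in>blocks m (block_count n m). centered m x S) / sqrt (vol n)"

lemma local_fun_norm_betti: "local_fun (norm_betti n)"
  unfolding norm_betti_def[abs_def] by (rule local_fun_comp[OF local_fun_centered])

lemma local_fun_norm_blocks: "local_fun (norm_blocks m n)"
proof -
  have "local_fun (\<lambda>S. \<Sum>x\<in>blocks m (block_count n m). centered m x S)"
    by (rule local_fun_sum[OF finite_blocks local_fun_centered])
  then show ?thesis unfolding norm_blocks_def[abs_def] by (rule local_fun_comp)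
qed

lemma Ex_norm_betti_square: "Ex (\<lambda>S. (norm_betti n S)\<^sup>2) = Var (box_betti q 0 n) / vol n"
proof -
  have "(norm_betti n S)\<^sup>2 = (centered n 0 S)\<^sup>2 / vol n" for S
    by (simp add: norm_betti_def power_divide vol_def)
  then show ?thesis by (simp add: Ex_divide Ex_centered_square)
qed

text \<open>Distinct blocks are independent and centred, so only the diagonal of the double sum
  survives.\<close>

lemma Ex_norm_blocks_square:
  "Ex (\<lambda>S. (norm_blocks m n S)\<^sup>2)
    = (2 * real (block_count n m) + 1) ^ CARD('n) * Var (box_betti q 0 m) / vol n"
proof -
  define B where "B = (blocks m (block_count n m) :: (int, 'n) vec set)"
  define v where "v = Var (box_betti q 0 m)"
  have fin: "finite B" by (simp add: B_def finite_blocks)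
  have pair: "Ex (\<lambda>S. centered m x S * centered m y S) = (if x = y then v else 0)" if "x \<in> B" "y \<in> B" for x y
  proof (cases "x = y")
    case True
    then show ?thesis using Ex_centered_square[of m x] by (simp add: v_def power2_eq_square)
  next
    case False
    have "Ex (\<lambda>S. centered m x S * centered m y S) = Ex (centered m x) * Ex (centered m y)"
      using qbox_blocks_disjoint[OF that[unfolded B_def] False]
      by (intro Ex_mult_indep[OF _ depends_on_centered _ depends_on_centered]) auto
    then show ?thesis using False by (simp add: Ex_centered)
  qed
  have loc: "local_fun (\<lambda>S. centered m x S * centered m y S)" for x y
    by (rule local_fun_comp2[OF local_fun_centered local_fun_centered])
  have "(norm_blocks m n S)\<^sup>2 = (\<Sum>x\<in>B. \<Sum>y\<in>B. centered m x S * centered m y S) / vol n" for S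
    by (simp add: norm_blocks_def power_divide vol_def B_def power2_eq_square sum_product)
  then have "Ex (\<lambda>S. (norm_blocks m n S)\<^sup>2) = Ex (\<lambda>S. \<Sum>x\<in>B. \<Sum>y\<in>B. centered m x S * centered m y S) / vol n"
    by (simp add: Ex_divide)
  also have "Ex (\<lambda>S. \<Sum>x\<in>B. \<Sum>y\<in>B. centered m x S * centered m y S)
     = (\<Sum>x\<in>B. Ex (\<lambda>S. \<Sum>y\<in>B. centered m x S * centered m y S))"
    by (rule Ex_sum, rule local_fun_sum[OF fin loc])
  also have "\<dots> = (\<Sum>x\<in>B. \<Sum>y\<in>B. Ex (\<lambda>S. centered m x S * centered m y S))"
    by (intro sum.cong refl Ex_sum loc)
  also have "\<dots> = (\<Sum>x\<in>B. \<Sum>y\<in>B. if x = y then v else 0)"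
    by (intro sum.cong refl pair)
  also have "\<dots> = real (card B) * v" using fin by simp
  also have "real (card B) = (2 * real (block_count n m) + 1) ^ CARD('n)"
    by (simp add: B_def card_blocks add.commute)
  finally show ?thesis by (simp add: v_def)
qed

lemma Ex_norm_blocks_square_lim:
  "(\<lambda>n. Ex (\<lambda>S. (norm_blocks m n S)\<^sup>2)) \<longlonglongrightarrow> (1 / (2 * real m + 4)) ^ CARD('n) * Var (box_betti q 0 m)"
proof -
  have "(\<lambda>n. ((2 * real (block_count n m) + 1) / (2 * real n)) ^ CARD('n) * Var (box_betti q 0 m))
     \<longlonglongrightarrow> (1 / (2 * real m + 4)) ^ CARD('n) * Var (box_betti q 0 m)"
    by (intro tendsto_intros block_count_ratio)
  then show ?thesis unfolding Ex_norm_blocks_square vol_def by (simp add: power_divide)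
qed

lemma Ex_of_real: "local_fun f \<Longrightarrow> Ex (\<lambda>S. complex_of_real (f S)) = complex_of_real (Ex f)"
  unfolding Ex_def by simp

text \<open>Second-order Taylor expansion of the exponential; centring removes the linear
  term.\<close>

lemma char_centered_approx:
  "cmod (Ex (\<lambda>S. iexp (a * centered m 0 S)) - complex_of_real (1 - a\<^sup>2 * Var (box_betti q 0 m) / 2))
    \<le> \<bar>a\<bar> ^ 3 * Ex (\<lambda>S. \<bar>centered m 0 S\<bar> ^ 3)"
proof -
  let ?Y = "centered m 0"
  define T where "T r = 1 + \<i> * complex_of_real (a * r) - complex_of_real (a\<^sup>2 * r\<^sup>2 / 2)" for r
  have bound: "cmod (iexp (a * r) - T r) \<le> \<bar>a\<bar> ^ 3 * \<bar>r\<bar> ^ 3" for r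
  proof -
    have "(\<Sum>k\<le>2. (\<i> * complex_of_real (a * r)) ^ k / fact k) = T r"
      by (simp add: T_def numeral_2_eq_2 power_mult_distrib)
    then have "cmod (iexp (a * r) - T r) \<le> \<bar>a * r\<bar> ^ 3 / fact 3"
      using iexp_approx1[of "a * r" 2] by (simp add: numeral_3_eq_3)
    also have "\<dots> \<le> \<bar>a * r\<bar> ^ 3" by (simp add: fact_numeral)
    finally show ?thesis by (simp add: abs_mult power_mult_distrib)
  qed
  have l1: "local_fun (\<lambda>S. iexp (a * ?Y S))" "local_fun (\<lambda>S. T (?Y S))"
    "local_fun (\<lambda>S. complex_of_real (a * ?Y S))" "local_fun (\<lambda>S. \<i> * complex_of_real (a * ?Y S))"
    "local_fun (\<lambda>S. complex_of_real (a\<^sup>2 * (?Y S)\<^sup>2 / 2))" "local_fun (\<lambda>S. 1 + \<i> * complex_of_real (a * ?Y S))"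
    "local_fun (\<lambda>S. cmod (iexp (a * ?Y S) - T (?Y S)))" "local_fun (\<lambda>S. \<bar>a\<bar> ^ 3 * \<bar>?Y S\<bar> ^ 3)"
    by (rule local_fun_comp[OF local_fun_centered])+
  have l2: "local_fun (\<lambda>S. a * ?Y S)" "local_fun (\<lambda>S. a\<^sup>2 * (?Y S)\<^sup>2 / 2)"
    by (rule local_fun_comp[OF local_fun_centered])+
  have e1: "Ex (\<lambda>S. \<i> * complex_of_real (a * ?Y S)) = 0"
    unfolding Ex_mult_left Ex_of_real[OF l2(1)] by (simp add: Ex_mult_left Ex_centered)
  have e2: "Ex (\<lambda>S. complex_of_real (a\<^sup>2 * (?Y S)\<^sup>2 / 2)) = complex_of_real (a\<^sup>2 * Var (box_betti q 0 m) / 2)"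
    unfolding Ex_of_real[OF l2(2)] by (simp add: Ex_mult_left Ex_divide Ex_centered_square)
  have "Ex (\<lambda>S. T (?Y S)) = complex_of_real (1 - a\<^sup>2 * Var (box_betti q 0 m) / 2)"
    unfolding T_def Ex_diff[OF l1(6) l1(5)] Ex_add[OF local_fun_const l1(4)] e1 e2 by simp
  then have "cmod (Ex (\<lambda>S. iexp (a * ?Y S)) - complex_of_real (1 - a\<^sup>2 * Var (box_betti q 0 m) / 2))
      = cmod (Ex (\<lambda>S. iexp (a * ?Y S) - T (?Y S)))"
    by (simp only: Ex_diff[OF l1(1,2)])
  also have "\<dots> \<le> Ex (\<lambda>S. cmod (iexp (a * ?Y S) - T (?Y S)))" by (rule norm_Ex_le)
  also have "\<dots> \<le> Ex (\<lambda>S. \<bar>a\<bar> ^ 3 * \<bar>?Y S\<bar> ^ 3)"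
    by (rule Ex_mono[OF l1(7,8) bound])
  finally show ?thesis by (simp add: Ex_mult_left)
qed

lemma char_norm_blocks:
  "Ex (\<lambda>S. iexp (s * norm_blocks m n S))
    = Ex (\<lambda>S. iexp (s / sqrt (vol n) * centered m 0 S)) ^ ((2 * block_count n m + 1) ^ CARD('n))"
proof -
  let ?B = "blocks m (block_count n m) :: (int, 'n) vec set" and ?a = "s / sqrt (vol n)"
  have "iexp (s * norm_blocks m n S) = (\<Prod>x\<in>?B. iexp (?a * centered m x S))" for S
    unfolding exp_sum[OF finite_blocks, symmetric]
    by (simp add: norm_blocks_def sum_distrib_left sum_divide_distrib)
  then have "Ex (\<lambda>S. iexp (s * norm_blocks m n S)) = Ex (\<lambda>S. \<Prod>x\<in>?B. iexp (?a * centered m x S))"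
    by simp
  also have "\<dots> = (\<Prod>x\<in>?B. Ex (\<lambda>S. iexp (?a * centered m x S)))"
  proof (rule Ex_prod_indep[where I = "\<lambda>x. qbox x (Suc m)"])
    show "depends_on (qbox x (Suc m)) (\<lambda>S. iexp (?a * centered m x S))" for x
      by (rule depends_on_comp[OF depends_on_centered])
    show "qbox x (Suc m) \<inter> qbox y (Suc m) = {}" if "x \<in> ?B" "y \<in> ?B" "x \<noteq> y" for x y
      using that by (rule qbox_blocks_disjoint)
  qed (simp_all add: finite_blocks)
  also have "\<dots> = (\<Prod>x\<in>?B. Ex (\<lambda>S. iexp (?a * centered m 0 S)))"
    by (intro prod.cong refl Ex_centered_comp[of "\<lambda>r. iexp (?a * r)"])
  also have "\<dots> = Ex (\<lambda>S. iexp (?a * centered m 0 S)) ^ ((2 * block_count n m + 1) ^ CARD('n))"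
    by (simp add: card_blocks)
  finally show ?thesis .
qed

lemma Var_nonneg: "0 \<le> Var f"
  unfolding Var_def Ex_def by (rule Bochner_Integration.integral_nonneg) simp

text \<open>With \<open>m\<close> fixed, both terms are \<open>b\<close>-th powers with
  \<open>b\<close> at most the volume \<open>N\<close>. Their bases differ by order \<open>N\<close>
  to the power -3/2, so the powers differ by order \<open>1 / sqrt N\<close>. The comparison uses
  the variance at \<open>n\<close> instead of its limit, which makes the second term an exact
  power.\<close>

lemma char_norm_blocks_lim:
  "(\<lambda>n. Ex (\<lambda>S. iexp (s * norm_blocks m n S))
     - complex_of_real (exp (- (s\<^sup>2 / 2 * Ex (\<lambda>S. (norm_blocks m n S)\<^sup>2))))) \<longlonglongrightarrow> 0"
proof -
  define v where "v = Var (box_betti q 0 m)"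
  define K where "K = Ex (\<lambda>S. \<bar>centered m 0 S\<bar> ^ 3)"
  have v: "v \<ge> 0" by (simp add: v_def Var_nonneg)
  have K: "K \<ge> 0" unfolding K_def Ex_def by (rule Bochner_Integration.integral_nonneg) simp
  define C where "C = \<bar>s\<bar> ^ 3 * K + (s\<^sup>2 * v / 2)\<^sup>2"
  have C: "C \<ge> 0" using K by (simp add: C_def)
  have "\<forall>\<^sub>F n in sequentially. cmod (Ex (\<lambda>S. iexp (s * norm_blocks m n S))
     - complex_of_real (exp (- (s\<^sup>2 / 2 * Ex (\<lambda>S. (norm_blocks m n S)\<^sup>2))))) \<le> C * (1 / sqrt (real n))"
    using eventually_ge_at_top[of "m + 2"]
  proof eventually_elim
    case (elim n)
    define N where "N = vol n"
    define b where "b = (2 * block_count n m + 1) ^ CARD('n)"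
    define a where "a = s / sqrt N"
    define u where "u = a\<^sup>2 * v / 2"
    define z where "z = Ex (\<lambda>S. iexp (a * centered m 0 S))"
    have nN: "real n \<le> N" and N1: "N \<ge> 1" and n0: "real n > 0"
      using vol_ge[of n] elim by (auto simp: N_def)
    have N0: "N > 0" using N1 by simp
    have a2: "a\<^sup>2 = s\<^sup>2 / N" using N0 by (simp add: a_def power_divide)
    have u0: "u \<ge> 0" using v by (simp add: u_def)
    have bN: "real b \<le> N"
    proof -
      have "1 * (2 * real (block_count n m) + 1) \<le> (2 * real m + 4) * (2 * real (block_count n m) + 1)"
        by (intro mult_right_mono) auto
      from order_trans[OF this block_count_bounds(1)[OF elim]]
      have "2 * real (block_count n m) + 1 \<le> 2 * real n" by simp
      then have "(2 * real (block_count n m) + 1) ^ CARD('n) \<le> (2 * real n) ^ CARD('n)"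
        by (intro power_mono) auto
      then show ?thesis by (simp add: b_def N_def vol_def add.commute)
    qed
    \<comment> \<open>Both bases must lie in the closed unit disc, so that a difference of powers is
      at most the exponent times the difference of the bases.\<close>
    have z1: "cmod z \<le> 1"
    proof -
      have "cmod z \<le> Ex (\<lambda>S. cmod (iexp (a * centered m 0 S)))" unfolding z_def by (rule norm_Ex_le)
      then show ?thesis by simp
    qed
    have w1: "cmod (complex_of_real (exp (- u))) \<le> 1" using u0 by simp
    have eq1: "Ex (\<lambda>S. iexp (s * norm_blocks m n S)) = z ^ b"
      unfolding char_norm_blocks z_def a_def N_def b_def ..
    have eq2: "complex_of_real (exp (- (s\<^sup>2 / 2 * Ex (\<lambda>S. (norm_blocks m n S)\<^sup>2)))) = complex_of_real (exp (- u)) ^ b"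
    proof -
      have "- (s\<^sup>2 / 2 * Ex (\<lambda>S. (norm_blocks m n S)\<^sup>2)) = real b * (- u)"
        unfolding Ex_norm_blocks_square u_def a2 by (simp add: b_def N_def v_def ac_simps)
      then show ?thesis by (simp only: exp_of_nat_mult of_real_power)
    qed
    have dzw: "cmod (z - complex_of_real (exp (- u))) \<le> \<bar>a\<bar> ^ 3 * K + u\<^sup>2"
    proof -
      have "cmod (z - complex_of_real (1 - u)) \<le> \<bar>a\<bar> ^ 3 * K"
        using char_centered_approx[of a m] by (simp add: z_def u_def v_def K_def)
      moreover have "cmod (complex_of_real (1 - u) - complex_of_real (exp (- u))) \<le> u\<^sup>2"
        using exp_minus_quadratic[OF u0] unfolding of_real_diff[symmetric] norm_of_real by linarith
      ultimately show ?thesis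
        using norm_triangle_ineq[of "z - complex_of_real (1 - u)" "complex_of_real (1 - u) - complex_of_real (exp (- u))"]
        by simp
    qed
    have a3: "N * \<bar>a\<bar> ^ 3 = \<bar>s\<bar> ^ 3 / sqrt N"
    proof -
      have "\<bar>a\<bar> ^ 3 = \<bar>s\<bar> ^ 3 / (N * sqrt N)"
        using N0 by (simp add: a_def abs_divide power_divide power3_eq_cube)
      then show ?thesis using N0 by simp
    qed
    have u2: "N * u\<^sup>2 = (s\<^sup>2 * v / 2)\<^sup>2 / N"
    proof -
      have "u = (s\<^sup>2 * v / 2) / N" by (simp add: u_def a2)
      then show ?thesis using N0 by (simp add: power_divide power2_eq_square[of N])
    qed
    have "cmod (z ^ b - complex_of_real (exp (- u)) ^ b) \<le> real b * cmod (z - complex_of_real (exp (- u)))"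
      by (rule norm_power_diff[OF z1 w1])
    also have "\<dots> \<le> N * (\<bar>a\<bar> ^ 3 * K + u\<^sup>2)"
      using bN dzw N0 by (intro mult_mono) auto
    also have "\<dots> = \<bar>s\<bar> ^ 3 * K / sqrt N + (s\<^sup>2 * v / 2)\<^sup>2 / N"
      using a3 u2 by (simp add: distrib_left mult.assoc[symmetric])
    also have "\<dots> \<le> \<bar>s\<bar> ^ 3 * K / sqrt N + (s\<^sup>2 * v / 2)\<^sup>2 / sqrt N"
    proof -
      have "sqrt N \<le> N" using N1 by (simp add: real_le_lsqrt power2_eq_square)
      then show ?thesis using N0 by (intro add_left_mono divide_left_mono) auto
    qed
    also have "\<dots> = C * (1 / sqrt N)" by (simp add: C_def add_divide_distrib)
    also have "\<dots> \<le> C * (1 / sqrt (real n))"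
      using C nN n0 by (intro mult_left_mono divide_left_mono) auto
    finally show ?case unfolding eq1 eq2 .
  qed
  moreover have "(\<lambda>n. C * (1 / sqrt (real n))) \<longlonglongrightarrow> 0"
  proof -
    have "(\<lambda>n. 1 / sqrt (real n)) \<longlonglongrightarrow> 0"
      by (intro tendsto_divide_0[OF tendsto_const] filterlim_at_top_imp_at_infinity
          filterlim_compose[OF sqrt_at_top filterlim_real_sequentially])
    then show ?thesis by (rule tendsto_mult_right_zero)
  qed
  ultimately show ?thesis by (rule Lim_null_comparison)
qed

end

section \<open>From the blocks to the whole box\<close>

lemma abs_exp_minus_diff_le:
  fixes a b :: real
  assumes "0 \<le> a" "0 \<le> b"
  shows "\<bar>exp (- a) - exp (- b)\<bar> \<le> \<bar>a - b\<bar>"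
proof -
  have *: "exp (- a) - exp (- b) \<le> b - a" if "0 \<le> a" "a \<le> b" for a b :: real
  proof -
    have "exp (- a) - exp (- b) = exp (- a) * (1 - exp (- (b - a)))"
      by (simp add: algebra_simps flip: exp_add)
    also have "1 - exp (- (b - a)) \<le> b - a"
      using exp_ge_add_one_self[of "- (b - a)"] by linarith
    also have "exp (- a) * (b - a) \<le> 1 * (b - a)"
      using that by (intro mult_right_mono) auto
    finally show ?thesis by simp
  qed
  show ?thesis
  proof (cases "a \<le> b")
    case True
    then show ?thesis using *[OF assms(1) True] by simp
  next
    case False
    then show ?thesis using *[OF assms(2), of a] by simp
  qed
qed

text \<open>The constant may depend on \<open>e\<close>: here it is the limiting block variance for
  a suitable block size, and no limit need be guessed.\<close>

lemma convergent_if_approx_constant: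
  fixes x :: "nat \<Rightarrow> real"
  assumes "\<And>e. e > 0 \<Longrightarrow> \<exists>c. \<forall>\<^sub>F n in sequentially. \<bar>x n - c\<bar> \<le> e"
  shows "convergent x"
proof -
  have "Cauchy x"
  proof (rule metric_CauchyI)
    fix e :: real assume "e > 0"
    then obtain c where "\<forall>\<^sub>F n in sequentially. \<bar>x n - c\<bar> \<le> e / 3" using assms[of "e / 3"] by auto
    then obtain N where N: "\<And>n. n \<ge> N \<Longrightarrow> \<bar>x n - c\<bar> \<le> e / 3" by (auto simp: eventually_sequentially)
    have "dist (x m) (x n) < e" if "m \<ge> N" "n \<ge> N" for m n
      using N[OF that(1)] N[OF that(2)] \<open>e > 0\<close> unfolding dist_real_def by linarith
    then show "\<exists>N. \<forall>m\<ge>N. \<forall>n\<ge>N. dist (x m) (x n) < e" by blast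
  qed
  then show ?thesis by (rule Cauchy_convergent)
qed

context cube_field begin

lemma norm_betti_minus_norm_blocks:
  "norm_betti n S - norm_blocks m n S
    = (remainder n m (block_count n m) S - Ex (remainder n m (block_count n m))) / sqrt (vol n)"
proof -
  let ?B = "blocks m (block_count n m) :: (int, 'n) vec set"
  have l: "local_fun (\<lambda>S. \<Sum>x\<in>?B. box_betti q x m S)"
    by (rule local_fun_sum[OF finite_blocks local_fun_box_betti])
  have "Ex (remainder n m (block_count n m)) = Ex (box_betti q 0 n) - (\<Sum>x\<in>?B. Ex (box_betti q x m))"
    unfolding remainder_def[abs_def] Ex_diff[OF local_fun_box_betti l] Ex_sum[OF local_fun_box_betti] ..
  also have "(\<Sum>x\<in>?B. Ex (box_betti q x m)) = (\<Sum>x\<in>?B. Ex (box_betti q 0 m))"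
    by (intro sum.cong refl Ex_box_betti)
  finally have E: "Ex (remainder n m (block_count n m)) = Ex (box_betti q 0 n) - (\<Sum>x\<in>?B. Ex (box_betti q 0 m))" .
  show ?thesis
    unfolding E by (simp add: norm_betti_def norm_blocks_def centered_def remainder_def sum_subtractf
        flip: diff_divide_distrib)
qed

text \<open>Both estimates follow from closeness in mean square. In the constant, the power of 5
  bounds the second moment of \<open>norm_betti\<close>, and the 2 absorbs
  \<open>\<delta> + \<delta> * \<delta>\<close>.\<close>

lemma block_approximation:
  assumes "\<delta> > 0" "\<delta> \<le> 1"
  shows "\<exists>m. \<forall>\<^sub>F n in sequentially.
     \<bar>Ex (\<lambda>S. (norm_betti n S)\<^sup>2) - Ex (\<lambda>S. (norm_blocks m n S)\<^sup>2)\<bar> \<le> \<delta> * ((5 ^ CARD('n))\<^sup>2 * 5 ^ CARD('n) + 2) \<and>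
     (\<forall>s. cmod (Ex (\<lambda>S. iexp (s * norm_betti n S)) - Ex (\<lambda>S. iexp (s * norm_blocks m n S))) \<le> \<bar>s\<bar> * \<delta>)"
proof -
  have "\<delta>\<^sup>2 > 0" using assms by simp
  \<comment> \<open>Using the square of \<open>\<delta>\<close> makes the root mean square of the
    difference at most \<open>\<delta>\<close>.\<close>
  from Var_remainder_small[OF this] obtain m where
    m: "\<forall>\<^sub>F n in sequentially. Var (remainder n m (block_count n m)) \<le> \<delta>\<^sup>2 * vol n"
    unfolding vol_def by blast
  have "\<forall>\<^sub>F n in sequentially.
     \<bar>Ex (\<lambda>S. (norm_betti n S)\<^sup>2) - Ex (\<lambda>S. (norm_blocks m n S)\<^sup>2)\<bar> \<le> \<delta> * ((5 ^ CARD('n))\<^sup>2 * 5 ^ CARD('n) + 2) \<and>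
     (\<forall>s. cmod (Ex (\<lambda>S. iexp (s * norm_betti n S)) - Ex (\<lambda>S. iexp (s * norm_blocks m n S))) \<le> \<bar>s\<bar> * \<delta>)"
    using m eventually_gt_at_top[of 0]
  proof eventually_elim
    case (elim n)
    define V U R where "V = norm_betti n" and "U = norm_blocks m n" and "R S = V S - U S" for S
    have N: "vol n > 0" using elim(2) by (rule vol_pos)
    have lV: "local_fun V" and lU: "local_fun U"
      unfolding V_def U_def by (rule local_fun_norm_betti local_fun_norm_blocks)+
    have lR: "local_fun R" unfolding R_def[abs_def] by (rule local_fun_comp2[OF lV lU])
    have lsq: "local_fun (\<lambda>S. (V S)\<^sup>2)" "local_fun (\<lambda>S. (U S)\<^sup>2)" "local_fun (\<lambda>S. (R S)\<^sup>2)"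
      by (rule local_fun_comp[OF lV] local_fun_comp[OF lU] local_fun_comp[OF lR])+
    have R2: "Ex (\<lambda>S. (R S)\<^sup>2) \<le> \<delta>\<^sup>2"
    proof -
      have "(R S)\<^sup>2 = (remainder n m (block_count n m) S - Ex (remainder n m (block_count n m)))\<^sup>2 / vol n" for S
        using N unfolding R_def V_def U_def norm_betti_minus_norm_blocks by (simp add: power_divide)
      then have "Ex (\<lambda>S. (R S)\<^sup>2) = Var (remainder n m (block_count n m)) / vol n"
        by (simp add: Ex_divide Var_def)
      also have "\<dots> \<le> \<delta>\<^sup>2" using elim(1) N by (simp add: divide_le_eq)
      finally show ?thesis .
    qed
    have V2: "Ex (\<lambda>S. (V S)\<^sup>2) \<le> (5 ^ CARD('n))\<^sup>2 * 5 ^ CARD('n)"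
    proof -
      have "(4 * real n + 5) ^ CARD('n) \<le> (5 * (2 * real n)) ^ CARD('n)"
        using elim(2) by (intro power_mono) auto
      then have "(4 * real n + 5) ^ CARD('n) \<le> 5 ^ CARD('n) * vol n"
        unfolding vol_def by (simp only: power_mult_distrib)
      then have "(5 ^ CARD('n))\<^sup>2 * (4 * real n + 5) ^ CARD('n) \<le> (5 ^ CARD('n))\<^sup>2 * (5 ^ CARD('n) * vol n)"
        by (intro mult_left_mono) auto
      then have "Var (box_betti q 0 n) \<le> (5 ^ CARD('n))\<^sup>2 * 5 ^ CARD('n) * vol n"
        using order_trans[OF Var_box_betti_le[of n]] by (simp only: mult.assoc)
      then show ?thesis using N unfolding V_def Ex_norm_betti_square by (simp add: divide_le_eq)
    qed
    have "\<bar>Ex (\<lambda>S. (V S)\<^sup>2) - Ex (\<lambda>S. (U S)\<^sup>2)\<bar> \<le> Ex (\<lambda>S. \<bar>(V S)\<^sup>2 - (U S)\<^sup>2\<bar>)"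
      using norm_Ex_le[of "\<lambda>S. (V S)\<^sup>2 - (U S)\<^sup>2"] by (simp add: Ex_diff[OF lsq(1,2)])
    also have "\<dots> \<le> Ex (\<lambda>S. \<delta> * (V S)\<^sup>2 + (1 / \<delta> + 1) * (R S)\<^sup>2)"
    proof (rule Ex_mono)
      show "local_fun (\<lambda>S. \<bar>(V S)\<^sup>2 - (U S)\<^sup>2\<bar>)"
        by (rule local_fun_comp2[OF lV lU])
      show "local_fun (\<lambda>S. \<delta> * (V S)\<^sup>2 + (1 / \<delta> + 1) * (R S)\<^sup>2)"
        by (rule local_fun_comp2[OF lV lR])
      fix S
      have 0: "(V S)\<^sup>2 - (U S)\<^sup>2 = 2 * (V S * R S) - (R S)\<^sup>2"
        by (simp add: R_def power2_eq_square algebra_simps)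
      \<comment> \<open>Young's inequality for the cross term: large weight on the small
        \<open>R\<close>, small weight on the bounded \<open>V\<close>.\<close>
      have "0 \<le> \<delta> * (V S - R S / \<delta>)\<^sup>2" "0 \<le> \<delta> * (V S + R S / \<delta>)\<^sup>2" using assms(1) by simp_all
      moreover have "\<delta> * (V S - R S / \<delta>)\<^sup>2 = \<delta> * (V S)\<^sup>2 - 2 * (V S * R S) + 1 / \<delta> * (R S)\<^sup>2"
        "\<delta> * (V S + R S / \<delta>)\<^sup>2 = \<delta> * (V S)\<^sup>2 + 2 * (V S * R S) + 1 / \<delta> * (R S)\<^sup>2"
        using assms(1) by (simp_all add: power2_eq_square field_simps)
      ultimately have "\<bar>2 * (V S * R S)\<bar> \<le> \<delta> * (V S)\<^sup>2 + 1 / \<delta> * (R S)\<^sup>2" by linarith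
      then show "\<bar>(V S)\<^sup>2 - (U S)\<^sup>2\<bar> \<le> \<delta> * (V S)\<^sup>2 + (1 / \<delta> + 1) * (R S)\<^sup>2"
        unfolding 0 distrib_right using zero_le_power2[of "R S"] by linarith
    qed
    also have "\<dots> = \<delta> * Ex (\<lambda>S. (V S)\<^sup>2) + (1 / \<delta> + 1) * Ex (\<lambda>S. (R S)\<^sup>2)"
      unfolding Ex_add[OF local_fun_comp[OF lsq(1)] local_fun_comp[OF lsq(3)]] Ex_mult_left ..
    also have "\<dots> \<le> \<delta> * ((5 ^ CARD('n))\<^sup>2 * 5 ^ CARD('n)) + (1 / \<delta> + 1) * \<delta>\<^sup>2"
      using V2 R2 assms(1) by (intro add_mono mult_left_mono) auto
    also have "(1 / \<delta> + 1) * \<delta>\<^sup>2 = \<delta> + \<delta> * \<delta>" using assms(1) by (simp add: power2_eq_square field_simps)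
    also have "\<delta> * \<delta> \<le> \<delta> * 1" using assms by (intro mult_left_mono) auto
    finally have 1: "\<bar>Ex (\<lambda>S. (V S)\<^sup>2) - Ex (\<lambda>S. (U S)\<^sup>2)\<bar> \<le> \<delta> * ((5 ^ CARD('n))\<^sup>2 * 5 ^ CARD('n) + 2)"
      by (simp add: algebra_simps)
    have absR: "Ex (\<lambda>S. \<bar>R S\<bar>) \<le> \<delta>"
    proof -
      have "Ex (\<lambda>S. \<bar>R S\<bar>) \<le> Ex (\<lambda>S. \<delta> / 2 + 1 / (2 * \<delta>) * (R S)\<^sup>2)"
      proof (rule Ex_mono)
        show "local_fun (\<lambda>S. \<bar>R S\<bar>)" "local_fun (\<lambda>S. \<delta> / 2 + 1 / (2 * \<delta>) * (R S)\<^sup>2)"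
          by (rule local_fun_comp[OF lR])+
        fix S
        have "0 \<le> (\<bar>R S\<bar> - \<delta>)\<^sup>2 / (2 * \<delta>)" using assms(1) by simp
        also have "\<dots> = \<delta> / 2 + 1 / (2 * \<delta>) * (R S)\<^sup>2 - \<bar>R S\<bar>"
          using assms(1) by (simp add: power2_diff field_simps) (simp add: power2_eq_square)
        finally show "\<bar>R S\<bar> \<le> \<delta> / 2 + 1 / (2 * \<delta>) * (R S)\<^sup>2" by simp
      qed
      also have "\<dots> = \<delta> / 2 + 1 / (2 * \<delta>) * Ex (\<lambda>S. (R S)\<^sup>2)"
        unfolding Ex_add[OF local_fun_const local_fun_comp[OF lsq(3)]] Ex_mult_left Ex_const ..
      also have "\<dots> \<le> \<delta> / 2 + 1 / (2 * \<delta>) * \<delta>\<^sup>2"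
        using R2 assms(1) by (intro add_left_mono mult_left_mono) auto
      also have "\<dots> = \<delta>" using assms(1) by (simp add: power2_eq_square)
      finally show ?thesis .
    qed
    have 2: "cmod (Ex (\<lambda>S. iexp (s * V S)) - Ex (\<lambda>S. iexp (s * U S))) \<le> \<bar>s\<bar> * \<delta>" for s
    proof -
      have l: "local_fun (\<lambda>S. iexp (s * V S))" "local_fun (\<lambda>S. iexp (s * U S))"
        by (rule local_fun_comp[OF lV] local_fun_comp[OF lU])+
      have "cmod (Ex (\<lambda>S. iexp (s * V S)) - Ex (\<lambda>S. iexp (s * U S))) = cmod (Ex (\<lambda>S. iexp (s * V S) - iexp (s * U S)))"
        by (simp only: Ex_diff[OF l])
      also have "\<dots> \<le> Ex (\<lambda>S. cmod (iexp (s * V S) - iexp (s * U S)))" by (rule norm_Ex_le)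
      also have "\<dots> \<le> Ex (\<lambda>S. \<bar>s\<bar> * \<bar>R S\<bar>)"
      proof (rule Ex_mono)
        show "local_fun (\<lambda>S. cmod (iexp (s * V S) - iexp (s * U S)))" by (rule local_fun_comp2[OF lV lU])
        show "local_fun (\<lambda>S. \<bar>s\<bar> * \<bar>R S\<bar>)" by (rule local_fun_comp[OF lR])
        show "cmod (iexp (s * V S) - iexp (s * U S)) \<le> \<bar>s\<bar> * \<bar>R S\<bar>" for S
          using cmod_iexp_diff_le[of "s * V S" "s * U S"]
          by (simp only: R_def abs_mult[symmetric] right_diff_distrib)
      qed
      also have "\<dots> = \<bar>s\<bar> * Ex (\<lambda>S. \<bar>R S\<bar>)" by (rule Ex_mult_left)
      also have "\<dots> \<le> \<bar>s\<bar> * \<delta>" using absR by (intro mult_left_mono) auto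
      finally show ?thesis .
    qed
    show ?case using 1 2 unfolding V_def U_def by blast
  qed
  then show ?thesis by blast
qed

text \<open>For each accuracy a block size \<open>m\<close> is fixed before \<open>n\<close> tends
  to infinity, so no rate in \<open>m\<close> is needed and the blocks need not grow with
  \<open>n\<close>.\<close>

theorem box_betti_clt:
  "\<exists>\<sigma>2\<ge>0. (\<lambda>n. Var (box_betti q 0 n) / vol n) \<longlonglongrightarrow> \<sigma>2 \<and>
    (\<forall>s. (\<lambda>n. Ex (\<lambda>S. iexp (s * norm_betti n S))) \<longlonglongrightarrow> complex_of_real (exp (- (s\<^sup>2 / 2 * \<sigma>2))))"
proof -
  define x where "x n = Var (box_betti q 0 n) / vol n" for n
  define C where "C = (5 ^ CARD('n))\<^sup>2 * 5 ^ CARD('n) + (2 :: real)"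
  have C: "C > 0" by (simp add: C_def add_pos_pos)
  have x: "x n = Ex (\<lambda>S. (norm_betti n S)\<^sup>2)" for n by (simp add: x_def Ex_norm_betti_square)
  have x0: "x n \<ge> 0" for n by (simp add: x_def Var_nonneg vol_def)
  have "convergent x"
  proof (rule convergent_if_approx_constant)
    fix e :: real assume e: "e > 0"
    define \<delta> where "\<delta> = min 1 (e / (2 * C))"
    have \<delta>: "\<delta> > 0" "\<delta> \<le> 1" using e C by (auto simp: \<delta>_def)
    have "\<delta> \<le> e / (2 * C)" by (simp add: \<delta>_def)
    then have \<delta>C: "\<delta> * C \<le> e / 2" using C by (simp add: field_simps)
    obtain m where "\<forall>\<^sub>F n in sequentially. \<bar>x n - Ex (\<lambda>S. (norm_blocks m n S)\<^sup>2)\<bar> \<le> \<delta> * C \<and>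
        (\<forall>s. cmod (Ex (\<lambda>S. iexp (s * norm_betti n S)) - Ex (\<lambda>S. iexp (s * norm_blocks m n S))) \<le> \<bar>s\<bar> * \<delta>)"
      using block_approximation[OF \<delta>] unfolding x C_def by blast
    then have m: "\<forall>\<^sub>F n in sequentially. \<bar>x n - Ex (\<lambda>S. (norm_blocks m n S)\<^sup>2)\<bar> \<le> \<delta> * C"
      by (rule eventually_mono) blast
    define c where "c = (1 / (2 * real m + 4)) ^ CARD('n) * Var (box_betti q 0 m)"
    have "\<forall>\<^sub>F n in sequentially. dist (Ex (\<lambda>S. (norm_blocks m n S)\<^sup>2)) c < e / 2"
      using Ex_norm_blocks_square_lim[of m] e unfolding c_def by (intro tendstoD) auto
    with m have "\<forall>\<^sub>F n in sequentially. \<bar>x n - c\<bar> \<le> e"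
      unfolding dist_real_def by eventually_elim (use \<delta>C in linarith)
    then show "\<exists>c. \<forall>\<^sub>F n in sequentially. \<bar>x n - c\<bar> \<le> e" by blast
  qed
  then obtain \<sigma>2 where \<sigma>2: "x \<longlonglongrightarrow> \<sigma>2" unfolding convergent_def by blast
  have "\<sigma>2 \<ge> 0" using LIMSEQ_le_const[OF \<sigma>2, of 0] x0 by blast
  moreover have "(\<lambda>n. Ex (\<lambda>S. iexp (s * norm_betti n S))) \<longlonglongrightarrow> complex_of_real (exp (- (s\<^sup>2 / 2 * \<sigma>2)))" for s
  proof -
    \<comment> \<open>The Gaussian with the variance at \<open>n\<close> is compared first; its
      passage to \<open>\<sigma>2\<close> is then continuity.\<close>
    have a: "(\<lambda>n. Ex (\<lambda>S. iexp (s * norm_betti n S)) - complex_of_real (exp (- (s\<^sup>2 / 2 * x n)))) \<longlonglongrightarrow> 0"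
    proof (rule tendstoI)
      fix e :: real assume e: "e > 0"
      \<comment> \<open>Collects the factors of \<open>\<delta>\<close> in the two approximation
        errors; the summand 1 keeps it positive when \<open>s = 0\<close>.\<close>
      define A where "A = \<bar>s\<bar> + s\<^sup>2 / 2 * C + 1"
      have A: "A > 0" using C by (simp add: A_def add_nonneg_pos)
      define \<delta> where "\<delta> = min 1 (e / (2 * A))"
      have \<delta>: "\<delta> > 0" "\<delta> \<le> 1" using e A by (auto simp: \<delta>_def)
      have "\<delta> \<le> e / (2 * A)" by (simp add: \<delta>_def)
      then have "\<delta> * A \<le> e / 2" using A by (simp add: field_simps)
      then have \<delta>A: "\<bar>s\<bar> * \<delta> + s\<^sup>2 / 2 * (\<delta> * C) \<le> e / 2" using \<delta>(1) by (simp add: A_def algebra_simps)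
      obtain m where m: "\<forall>\<^sub>F n in sequentially. \<bar>x n - Ex (\<lambda>S. (norm_blocks m n S)\<^sup>2)\<bar> \<le> \<delta> * C \<and>
          (\<forall>s. cmod (Ex (\<lambda>S. iexp (s * norm_betti n S)) - Ex (\<lambda>S. iexp (s * norm_blocks m n S))) \<le> \<bar>s\<bar> * \<delta>)"
        using block_approximation[OF \<delta>] unfolding x C_def by blast
      have "\<forall>\<^sub>F n in sequentially. dist (Ex (\<lambda>S. iexp (s * norm_blocks m n S))
          - complex_of_real (exp (- (s\<^sup>2 / 2 * Ex (\<lambda>S. (norm_blocks m n S)\<^sup>2))))) 0 < e / 2"
        using char_norm_blocks_lim[of s m] e by (intro tendstoD) auto
      with m show "\<forall>\<^sub>F n in sequentially. dist (Ex (\<lambda>S. iexp (s * norm_betti n S)) - complex_of_real (exp (- (s\<^sup>2 / 2 * x n)))) 0 < e"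
      proof eventually_elim
        case (elim n)
        define y where "y = Ex (\<lambda>S. (norm_blocks m n S)\<^sup>2)"
        define \<phi> \<psi> where "\<phi> = Ex (\<lambda>S. iexp (s * norm_betti n S))" and "\<psi> = Ex (\<lambda>S. iexp (s * norm_blocks m n S))"
        have y0: "y \<ge> 0" unfolding y_def Ex_def by (rule Bochner_Integration.integral_nonneg) simp
        have "\<bar>exp (- (s\<^sup>2 / 2 * y)) - exp (- (s\<^sup>2 / 2 * x n))\<bar> \<le> \<bar>s\<^sup>2 / 2 * y - s\<^sup>2 / 2 * x n\<bar>"
          using y0 x0[of n] by (intro abs_exp_minus_diff_le) auto
        also have "\<dots> = s\<^sup>2 / 2 * \<bar>x n - y\<bar>"
          by (simp only: right_diff_distrib[symmetric] abs_mult) (simp add: abs_minus_commute)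
        also have "\<dots> \<le> s\<^sup>2 / 2 * (\<delta> * C)" using elim(1) unfolding y_def by (intro mult_left_mono) auto
        finally have 1: "cmod (complex_of_real (exp (- (s\<^sup>2 / 2 * y))) - complex_of_real (exp (- (s\<^sup>2 / 2 * x n)))) \<le> s\<^sup>2 / 2 * (\<delta> * C)"
          unfolding of_real_diff[symmetric] norm_of_real .
        have 2: "cmod (\<phi> - \<psi>) \<le> \<bar>s\<bar> * \<delta>" using elim(1) unfolding \<phi>_def \<psi>_def by blast
        have 3: "cmod (\<psi> - complex_of_real (exp (- (s\<^sup>2 / 2 * y)))) < e / 2"
          using elim(2) unfolding \<psi>_def y_def dist_norm diff_zero .
        have "\<phi> - complex_of_real (exp (- (s\<^sup>2 / 2 * x n))) = (\<phi> - \<psi>) + ((\<psi> - complex_of_real (exp (- (s\<^sup>2 / 2 * y))))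
            + (complex_of_real (exp (- (s\<^sup>2 / 2 * y))) - complex_of_real (exp (- (s\<^sup>2 / 2 * x n)))))"
          by simp
        then have "cmod (\<phi> - complex_of_real (exp (- (s\<^sup>2 / 2 * x n)))) \<le> cmod (\<phi> - \<psi>)
            + (cmod (\<psi> - complex_of_real (exp (- (s\<^sup>2 / 2 * y))))
            + cmod (complex_of_real (exp (- (s\<^sup>2 / 2 * y))) - complex_of_real (exp (- (s\<^sup>2 / 2 * x n)))))"
          by (simp only:) (rule order_trans[OF norm_triangle_ineq add_left_mono[OF norm_triangle_ineq]])
        then show ?case using 1 2 3 \<delta>A unfolding \<phi>_def dist_norm diff_zero by linarith
      qed
    qed
    have b: "(\<lambda>n. complex_of_real (exp (- (s\<^sup>2 / 2 * x n)))) \<longlonglongrightarrow> complex_of_real (exp (- (s\<^sup>2 / 2 * \<sigma>2)))"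
      by (intro tendsto_intros \<sigma>2)
    from tendsto_add[OF a b] show ?thesis by simp
  qed
  ultimately show ?thesis using \<sigma>2 unfolding x_def by blast
qed

end

section \<open>The random cubical model\<close>

lemma real_distribution_gaussian_law:
  assumes "0 \<le> v"
  shows "real_distribution (gaussian_law v)"
proof (cases "v = 0")
  case True
  then show ?thesis
    by (auto simp: gaussian_law_def real_distribution_def real_distribution_axioms_def intro!: prob_space_return)
next
  case False
  then have "prob_space (gaussian_law v)"
    using assms by (simp add: gaussian_law_def prob_space_normal_density)
  then show ?thesis
    using False by (simp add: gaussian_law_def real_distribution_def real_distribution_axioms_def)
qed

text \<open>Scaling the standard normal by \<open>sqrt v\<close>; the degenerate case is the point
  mass at 0, whose characteristic function is 1.\<close>

lemma char_gaussian_law: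
  assumes "0 \<le> v"
  shows "char (gaussian_law v) s = complex_of_real (exp (- (s\<^sup>2 / 2 * v)))"
proof (cases "v = 0")
  case True
  then show ?thesis by (simp add: gaussian_law_def char_def integral_return)
next
  case False
  with assms have v: "v > 0" by simp
  interpret std: real_distribution std_normal_distribution by (rule real_dist_normal_dist)
  have "distributed std_normal_distribution lborel (\<lambda>x. x) std_normal_density"
    by (auto simp: distributed_def distr_id2 intro: measurable_ident_sets)
  then have "distributed std_normal_distribution lborel (\<lambda>x. 0 + sqrt v * x) (normal_density (0 + sqrt v * 0) (\<bar>sqrt v\<bar> * 1))"
    using v by (intro std.normal_density_affine) auto
  then have "distr std_normal_distribution lborel (\<lambda>x. sqrt v * x) = density lborel (normal_density 0 (sqrt v))"
    using v by (simp add: distributed_def)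
  then have "gaussian_law v = distr std_normal_distribution lborel (\<lambda>x. sqrt v * x)"
    using False by (simp add: gaussian_law_def)
  then have "char (gaussian_law v) s = (CLINT x|std_normal_distribution. iexp (s * (sqrt v * x)))"
    by (simp add: char_def integral_distr)
  also have "\<dots> = char std_normal_distribution (s * sqrt v)"
    by (simp add: char_def mult.assoc)
  also have "\<dots> = complex_of_real (exp (- (s\<^sup>2 / 2 * v)))"
    using v by (simp add: char_std_normal_distribution power_mult_distrib)
  finally show ?thesis .
qed

lemma measurable_tau:
  assumes "\<And>Q. sets (\<mu> Q) = sets (restrict_space borel {0..1::real})"
  shows "tau x \<in> measurable (PiM UNIV \<mu>) (PiM UNIV \<mu>)"
proof -
  have "(\<lambda>\<omega>. \<lambda>Q\<in>UNIV. \<omega> (cshift (- x) Q)) \<in> measurable (PiM UNIV \<mu>) (PiM UNIV \<mu>)"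
  proof (rule measurable_restrict)
    fix Q
    have "(\<lambda>\<omega>. \<omega> (cshift (- x) Q)) \<in> measurable (PiM UNIV \<mu>) (\<mu> (cshift (- x) Q))"
      by (rule measurable_component_singleton) simp
    moreover have "sets (\<mu> (cshift (- x) Q)) = sets (\<mu> Q)" using assms by simp
    ultimately show "(\<lambda>\<omega>. \<omega> (cshift (- x) Q)) \<in> measurable (PiM UNIV \<mu>) (\<mu> Q)"
      using measurable_cong_sets[OF refl] by blast
  qed
  then show ?thesis by (simp add: tau_def[abs_def] restrict_UNIV)
qed

text \<open>A pattern on finitely many cubes is a cylinder event: each coordinate is confined to
  values at most \<open>t\<close> or above \<open>t\<close>, so its probability factorises.\<close>

lemma cube_field_product:
  fixes \<mu> :: "('n::{finite,linorder}) cube \<Rightarrow> real measure"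
  assumes marg_prob: "\<And>Q. prob_space (\<mu> Q)"
    and marg_sets: "\<And>Q. sets (\<mu> Q) = sets (restrict_space borel {0..1::real})"
    and stationary: "\<And>x. distr (PiM UNIV \<mu>) (PiM UNIV \<mu>) (tau x) = PiM UNIV \<mu>"
  shows "cube_field (PiM UNIV \<mu>) (\<lambda>\<omega>. {Q. \<omega> Q \<le> t}) (\<lambda>Q. measure (\<mu> Q) {x \<in> space (\<mu> Q). x \<le> t})"
proof -
  interpret product_prob_space \<mu> UNIV
    by (rule product_prob_spaceI) (rule marg_prob)
  let ?P = "PiM UNIV \<mu>"
  define p where "p Q = measure (\<mu> Q) {x \<in> space (\<mu> Q). x \<le> t}" for Q
  have space: "space (\<mu> Q) = {0..1}" for Q
    using sets_eq_imp_space_eq[OF marg_sets[of Q]] by (simp add: space_restrict_space)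
  have le: "{x \<in> space (\<mu> Q). x \<le> t} \<in> sets (\<mu> Q)" for Q
    unfolding space marg_sets sets_restrict_space by (auto intro!: image_eqI[of _ _ "{..t}"])
  have gt: "{x \<in> space (\<mu> Q). \<not> x \<le> t} \<in> sets (\<mu> Q)" for Q
    using le[of Q] by (rule sets.sets_Collect_neg)
  have p1: "measure (\<mu> Q) {x \<in> space (\<mu> Q). \<not> x \<le> t} = 1 - p Q" for Q
    unfolding p_def by (rule prob_space.prob_neg[OF marg_prob le])
  have law: "{w \<in> space ?P. {Q. w Q \<le> t} \<inter> I = A} \<in> sets ?P
      \<and> measure ?P {w \<in> space ?P. {Q. w Q \<le> t} \<inter> I = A} = bern_weight p I A"
    if I: "finite I" "A \<subseteq> I" for I A
  proof -
    define X where "X Q = (if Q \<in> A then {x \<in> space (\<mu> Q). x \<le> t} else {x \<in> space (\<mu> Q). \<not> x \<le> t})" for Q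
    have X: "X Q \<in> sets (\<mu> Q)" for Q using le gt by (simp add: X_def)
    have eq: "{w \<in> space ?P. {Q. w Q \<le> t} \<inter> I = A} = prod_emb UNIV \<mu> I (PiE I X)"
      using I(2) by (auto simp: prod_emb_def space_PiM PiE_iff X_def split: if_splits)
    have "measure ?P (prod_emb UNIV \<mu> I (PiE I X)) = (\<Prod>Q\<in>I. measure (\<mu> Q) (X Q))"
      using I X by (intro measure_PiM_emb) auto
    also have "\<dots> = (\<Prod>Q\<in>A. measure (\<mu> Q) (X Q)) * (\<Prod>Q\<in>I - A. measure (\<mu> Q) (X Q))"
      using prod.subset_diff[OF I(2,1), of "\<lambda>Q. measure (\<mu> Q) (X Q)"] by (simp add: mult.commute)
    also have "\<dots> = bern_weight p I A"
      unfolding bern_weight_def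
      by (intro arg_cong2[where f = "(*)"] prod.cong refl) (auto simp: X_def p1[unfolded p_def] p_def)
    finally show ?thesis unfolding eq using I X by (auto intro!: sets_PiM_I)
  qed
  have sing: "{w \<in> space ?P. w Q \<le> t} \<in> sets ?P \<and> measure ?P {w \<in> space ?P. w Q \<le> t} = p Q" for Q
  proof -
    have "{w \<in> space ?P. {Q. w Q \<le> t} \<inter> {Q} = {Q}} = {w \<in> space ?P. w Q \<le> t}" by auto
    then show ?thesis using law[of "{Q}" "{Q}"] by (simp add: bern_weight_def)
  qed
  have shift: "p (cshift x Q) = p Q" for x Q
  proof -
    let ?A = "{w \<in> space ?P. w Q \<le> t}"
    have A: "?A \<in> sets ?P" using sing by blast
    \<comment> \<open>The shift by \<open>- x\<close> makes coordinate \<open>Q\<close> of the image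
      read off coordinate \<open>cshift x Q\<close>.\<close>
    have "p Q = measure (distr ?P ?P (tau (- x))) ?A" unfolding stationary using sing by simp
    also have "\<dots> = measure ?P (tau (- x) -` ?A \<inter> space ?P)"
      by (rule measure_distr[OF measurable_tau[OF marg_sets] A])
    also have "tau (- x) -` ?A \<inter> space ?P = {w \<in> space ?P. w (cshift x Q) \<le> t}"
      using measurable_space[OF measurable_tau[of \<mu> "- x", OF marg_sets]] by (auto simp: tau_def)
    finally show ?thesis by (simp add: sing)
  qed
  have "cube_field ?P (\<lambda>\<omega>. {Q. \<omega> Q \<le> t}) p"
  proof (unfold_locales)
    show "0 \<le> p Q" "p Q \<le> 1" for Q
      using prob_space.prob_le_1[OF marg_prob] by (auto simp: p_def)
  qed (use law shift in blast)+
  then show ?thesis by (simp add: p_def[abs_def])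
qed

lemma betti_Xn: "real (betti q (Xn n t \<omega>)) = box_betti q 0 n {Q. \<omega> Q \<le> t}"
proof -
  have "betti q (Xn n t \<omega>) + bdry_rank q (cover {Q. \<omega> Q \<le> t} \<inter> qbox 0 n)
      + bdry_rank (Suc q) (cover {Q. \<omega> Q \<le> t} \<inter> qbox 0 n)
    = card (cubes_dim q (cover {Q. \<omega> Q \<le> t} \<inter> qbox 0 n))"
    using betti_rank[of q "Xn n t \<omega>"] by (simp add: cubes_in_Xn bdry_rank_def)
  then show ?thesis by (simp add: box_betti_def betti_cubes_def)
qed

theorem theorem2p12:
  fixes \<mu> :: "('n::{finite,linorder}) cube \<Rightarrow> real measure"
    and P :: "('n cube \<Rightarrow> real) measure"
    and q :: nat and t :: real
  assumes marg_prob: "\<And>Q. prob_space (\<mu> Q)"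
    and marg_sets: "\<And>Q. sets (\<mu> Q) = sets (restrict_space borel {0..1::real})"
    and product: "P = PiM UNIV \<mu>"
    and stationary: "\<And>x. distr P P (tau x) = P"
    and ergodic: "\<And>A. A \<in> sets P \<Longrightarrow> (\<forall>x. tau x -` A \<inter> space P = A) \<Longrightarrow>
                       measure P A = 0 \<or> measure P A = 1"
    and q_lt: "q < CARD('n)"
    and t_range: "0 \<le> t" "t \<le> 1"
  shows "\<exists>\<sigma>2 \<ge> 0.
     (\<lambda>n. prob_space.expectation P
            (\<lambda>\<omega>. (real (betti q (Xn n t \<omega>))
                   - prob_space.expectation P (\<lambda>\<omega>'. real (betti q (Xn n t \<omega>'))))\<^sup>2)
          / (2 * real n) ^ CARD('n)) \<longlonglongrightarrow> \<sigma>2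
   \<and> weak_conv_m
       (\<lambda>n. distr P borel
          (\<lambda>\<omega>. (real (betti q (Xn n t \<omega>))
                 - prob_space.expectation P (\<lambda>\<omega>'. real (betti q (Xn n t \<omega>'))))
                / sqrt ((2 * real n) ^ CARD('n))))
       (gaussian_law \<sigma>2)"
proof -
  interpret cube_field P "\<lambda>\<omega>. {Q. \<omega> Q \<le> t}" "\<lambda>Q. measure (\<mu> Q) {x \<in> space (\<mu> Q). x \<le> t}" q
    unfolding product using marg_prob marg_sets stationary[unfolded product] by (rule cube_field_product)
  obtain \<sigma>2 where \<sigma>2: "\<sigma>2 \<ge> 0" "(\<lambda>n. Var (box_betti q 0 n) / vol n) \<longlonglongrightarrow> \<sigma>2"
    "\<And>s. (\<lambda>n. Ex (\<lambda>S. iexp (s * norm_betti n S))) \<longlonglongrightarrow> complex_of_real (exp (- (s\<^sup>2 / 2 * \<sigma>2)))"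
    using box_betti_clt by blast
  define V where "V n \<omega> = norm_betti n {Q. \<omega> Q \<le> t}" for n \<omega>
  \<comment> \<open>Measurability of the Betti number is inherited from its dependence on finitely
    many cubes.\<close>
  have meas: "V n \<in> borel_measurable P" for n
    unfolding V_def[abs_def] by (rule borel_measurable_integrable[OF integrable_local[OF local_fun_norm_betti]])
  have "weak_conv_m (\<lambda>n. distr P borel (V n)) (gaussian_law \<sigma>2)"
  proof (rule levy_continuity)
    show "real_distribution (distr P borel (V n))" for n
      using meas by (rule real_distribution_distr)
    show "real_distribution (gaussian_law \<sigma>2)" using \<sigma>2(1) by (rule real_distribution_gaussian_law)
    have "char (distr P borel (V n)) s = Ex (\<lambda>S. iexp (s * norm_betti n S))" for n s
      unfolding char_def Ex_def using meas by (subst integral_distr) (auto simp: V_def)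
    then show "(\<lambda>n. char (distr P borel (V n)) s) \<longlonglongrightarrow> char (gaussian_law \<sigma>2) s" for s
      using \<sigma>2(3) by (simp add: char_gaussian_law[OF \<sigma>2(1)])
  qed
  then show ?thesis
    using \<sigma>2(1,2)
    unfolding betti_Xn V_def norm_betti_def centered_def vol_def Var_def Ex_def by blast
qed

end
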